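(* As $s\to\infty$, $(\Lambda_s,Y_s)$ converges in distribution to $(0,Z)$, where $Z$ has the uniform distribution on $[0,1]$.
   Context: Let $\{\Theta_n\}_{n\ge 1}$ be i.i.d. random variables with density $\frac12\cos\theta$ on $(-\pi/2,\pi/2)$ (and $0$ elsewhere), let $X_n=\tan\Theta_n$, $S_0=0$, $S_n=S_{n-1}+X_n$ for $n\ge1$. For $s>0$ let $N_s=\inf\{n>0: S_n>s\}$ (finite almost surely). Consider the semi-infinite strip $D=\{(x,y)\in\mathbb{R}^2: x\le 0,\ 0\le y\le 1\}$. A light ray starts at $(-s,0)$ and follows the consecutive line segments from $\left(-s+S_{n-1},\frac{1-(-1)^{n-1}}{2}\right)$ to $\left(-s+S_{n},\frac{1-(-1)^{n}}{2}\right)$, $n=1,2,\dots,N_s$; the last of these segments (with $n=N_s$) crosses the right edge $\{0\}\times[0,1]$. Let $(0,Y_s)$ be the point where this last segment crosses the right edge, and let $\Lambda_s\in(-\pi/2,\pi/2)$ be the signed angle between this last segment and the normal (horizontal direction) to the right edge, positive if the exiting ray is travelling upward ($N_s$ odd) and negative if it is travelling downward ($N_s$ even); thus $\cot|\Lambda_s|=X_{N_s}$. *)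

theory Defs
  imports "HOL-Probability.Probability"
begin

text \<open>
  Convergence in distribution, along a filter, of random elements of a topological space; the
  library's \<^const>\<open>weak_conv_m\<close> only covers sequences of laws on the real line.
  The limit may live on a different probability space.
\<close>

definition converges_in_distribution ::
  "'a measure \<Rightarrow> ('i \<Rightarrow> 'a \<Rightarrow> 'c::topological_space) \<Rightarrow> 'b measure \<Rightarrow> ('b \<Rightarrow> 'c) \<Rightarrow> 'i filter \<Rightarrow> bool"
where
  "converges_in_distribution M X M' X' F \<longleftrightarrow>
     (\<forall>\<^sub>F i in F. X i \<in> borel_measurable M) \<and> X' \<in> borel_measurable M' \<and>
     (\<forall>f :: 'c \<Rightarrow> real. continuous_on UNIV f \<and> bounded (range f) \<longrightarrow>
        ((\<lambda>i. LINT \<omega>|M. f (X i \<omega>)) \<longlongrightarrow> (LINT \<omega>|M'. f (X' \<omega>))) F)"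

definition step :: "(nat \<Rightarrow> 'a \<Rightarrow> real) \<Rightarrow> nat \<Rightarrow> 'a \<Rightarrow> real" where
  "step \<Theta> n \<omega> = tan (\<Theta> n \<omega>)"

definition walk :: "(nat \<Rightarrow> 'a \<Rightarrow> real) \<Rightarrow> nat \<Rightarrow> 'a \<Rightarrow> real" where
  "walk \<Theta> n \<omega> = (\<Sum>k=1..n. step \<Theta> k \<omega>)"

text \<open>
  The passage time is finite almost surely; on the exceptional null set, where the set below is
  empty, its value is the (irrelevant) natural number \<open>Inf {}\<close>.
\<close>

definition passage_time :: "(nat \<Rightarrow> 'a \<Rightarrow> real) \<Rightarrow> real \<Rightarrow> 'a \<Rightarrow> nat" where
  "passage_time \<Theta> s \<omega> = Inf {n. 0 < n \<and> walk \<Theta> n \<omega> > s}"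

definition ray_vertex :: "(nat \<Rightarrow> 'a \<Rightarrow> real) \<Rightarrow> real \<Rightarrow> nat \<Rightarrow> 'a \<Rightarrow> real \<times> real" where
  "ray_vertex \<Theta> s n \<omega> = (- s + walk \<Theta> n \<omega>, (1 - (-1) ^ n) / 2)"

definition exit_height :: "(nat \<Rightarrow> 'a \<Rightarrow> real) \<Rightarrow> real \<Rightarrow> 'a \<Rightarrow> real" where
  "exit_height \<Theta> s \<omega> =
     (let n = passage_time \<Theta> s \<omega>
      in THE y. (0, y) \<in> closed_segment (ray_vertex \<Theta> s (n - 1) \<omega>) (ray_vertex \<Theta> s n \<omega>))"

text \<open>
  The outward normal of the right edge is the direction \<open>(1, 0)\<close>, so the signed angle from it to
  the direction of the exiting segment is the argument of the latter as a complex number. It is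
  positive exactly when the ray travels upward.
\<close>

definition exit_angle :: "(nat \<Rightarrow> 'a \<Rightarrow> real) \<Rightarrow> real \<Rightarrow> 'a \<Rightarrow> real" where
  "exit_angle \<Theta> s \<omega> =
     (let n = passage_time \<Theta> s \<omega>;
          d = ray_vertex \<Theta> s n \<omega> - ray_vertex \<Theta> s (n - 1) \<omega>
      in Arg (Complex (fst d) (snd d)))"

lemma passage_time_props:
  assumes "\<exists>n>0. walk \<Theta> n \<omega> > s" "s > 0" and N: "N = passage_time \<Theta> s \<omega>"
  shows "N > 0" "walk \<Theta> N \<omega> > s" "walk \<Theta> (N - 1) \<omega> \<le> s" "step \<Theta> N \<omega> > 0"
proof -
  have "N \<in> {n. 0 < n \<and> walk \<Theta> n \<omega> > s}"
    unfolding N passage_time_def using assms(1) by (intro Inf_nat_def1) auto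
  then show 1: "N > 0" and 2: "walk \<Theta> N \<omega> > s" by auto
  show 3: "walk \<Theta> (N - 1) \<omega> \<le> s"
  proof (rule ccontr)
    assume "\<not> walk \<Theta> (N - 1) \<omega> \<le> s"
    moreover from this have "N - 1 > 0"
      using \<open>s > 0\<close> by (cases "N - 1") (auto simp: walk_def)
    ultimately have "N \<le> N - 1"
      unfolding N passage_time_def by (intro cInf_lower) (auto simp: passage_time_def)
    with 1 show False by simp
  qed
  have "walk \<Theta> N \<omega> = walk \<Theta> (N - 1) \<omega> + step \<Theta> N \<omega>"
    using 1 by (cases N) (auto simp: walk_def)
  with 2 3 show "step \<Theta> N \<omega> > 0" by linarith
qed

lemma exit_height_unique:
  assumes "\<exists>n>0. walk \<Theta> n \<omega> > s" "s > 0" and N: "N = passage_time \<Theta> s \<omega>"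
  shows "\<exists>!y. (0, y) \<in> closed_segment (ray_vertex \<Theta> s (N - 1) \<omega>) (ray_vertex \<Theta> s N \<omega>)"
proof -
  note P = passage_time_props[OF assms]
  define a b where "a = - s + walk \<Theta> (N - 1) \<omega>" and "b = - s + walk \<Theta> N \<omega>"
  define c d :: real where "c = (1 - (-1) ^ (N - 1)) / 2" and "d = (1 - (-1) ^ N) / 2"
  have ab: "a \<le> 0" "b > 0" using P by (auto simp: a_def b_def)
  have root: "(1 - u) * a + u * b = 0 \<longleftrightarrow> u = - a / (b - a)" for u
    using ab by (auto simp: field_simps)
  have *: "(0, y) \<in> closed_segment (a, c) (b, d) \<longleftrightarrow>
      (\<exists>u. 0 \<le> u \<and> u \<le> 1 \<and> (1 - u) * a + u * b = 0 \<and> y = (1 - u) * c + u * d)" for y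
    by (auto simp: closed_segment_def)
  have "0 \<le> - a / (b - a)" "- a / (b - a) \<le> 1" using ab by (auto simp: field_simps)
  then show ?thesis
    unfolding ray_vertex_def a_def[symmetric] b_def[symmetric] c_def[symmetric] d_def[symmetric]
      * root by auto
qed

lemma exit_angle_props:
  assumes "\<exists>n>0. walk \<Theta> n \<omega> > s" "s > 0" and N: "N = passage_time \<Theta> s \<omega>"
  shows "\<bar>exit_angle \<Theta> s \<omega>\<bar> < pi / 2"
    and "odd N \<Longrightarrow> exit_angle \<Theta> s \<omega> > 0" and "even N \<Longrightarrow> exit_angle \<Theta> s \<omega> < 0"
    and "cot \<bar>exit_angle \<Theta> s \<omega>\<bar> = step \<Theta> N \<omega>"
proof -
  note P = passage_time_props[OF assms]
  let ?x = "step \<Theta> N \<omega>"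
  define e :: real where "e = (if odd N then 1 else -1)"
  have "ray_vertex \<Theta> s N \<omega> - ray_vertex \<Theta> s (N - 1) \<omega> = (?x, e)"
    using P(1) by (cases N) (auto simp: ray_vertex_def walk_def e_def)
  then have A: "exit_angle \<Theta> s \<omega> = Arg (Complex ?x e)"
    by (simp only: exit_angle_def N[symmetric] Let_def fst_conv snd_conv)
  have B: "Arg (Complex ?x e) = arctan (e / ?x)"
    using P(4) by (simp add: arg_conv_arctan)
  show "\<bar>exit_angle \<Theta> s \<omega>\<bar> < pi / 2"
    unfolding A B using arctan_lbound[of "e / ?x"] arctan_ubound[of "e / ?x"]
    by (simp add: abs_less_iff)
  show "odd N \<Longrightarrow> exit_angle \<Theta> s \<omega> > 0" "even N \<Longrightarrow> exit_angle \<Theta> s \<omega> < 0"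
    unfolding A B using P(4) by (auto simp: e_def)
  have "\<bar>arctan (e / ?x)\<bar> = arctan (1 / ?x)"
    using P(4) by (auto simp: e_def arctan_minus)
  then show "cot \<bar>exit_angle \<Theta> s \<omega>\<bar> = ?x"
    unfolding A B using P(4) by (simp add: cot_altdef tan_arctan)
qed

end

theory Submission imports Defs "HOL-Real_Asymp.Real_Asymp" begin

text \<open>
  Measure positions by the distance \<open>u\<close> to the right edge. If the exiting step is taken from
  distance \<open>U\<close> and has horizontal length \<open>X\<close>, then it crosses the edge after the fraction \<open>U / X\<close> of its
  course, so the exit height is \<open>U / X\<close> when the ray travels upward and \<open>1 - U / X\<close> when it
  travels downward. A step exceeds \<open>u\<close> with probability \<open>tail u\<close>, which is close to
  \<open>1 / (4 * u^2)\<close> for large \<open>u\<close>, and one step of the walk killed at its exit is described by the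
  operator \<open>killed\<close>. The occupation of the killed walk is governed by the Green function, the sum
  of the powers of this operator, and three facts about it give the theorem.

  The exit is certain. A bounded nonnegative function that does not exceed its average over the
  killed step must vanish, because a logarithm truncated at a high level is a supersolution
  (\<open>bounded_subharmonic_zero\<close>). Hence the survival probabilities tend to zero, and the Green
  function gives the tail total mass one (\<open>survival_tendsto_0\<close>, \<open>tail_series_sums_1\<close>).

  The exit happens from far away by a long step. As the step has infinite variance, the walk started
  at a large distance rarely comes near the edge before it jumps over it: the very slowly decreasing
  function \<open>1 / ln (ln u)\<close> is a supersolution far from the edge. So every function that is small
  compared with the tail has a vanishing Green potential (\<open>green_small_relative_to_tail\<close>). In
  particular the exiting step is long, whence the angle tends to zero.

  The parity of the exit index is asymptotically fair and independent of \<open>U\<close> and \<open>X\<close>. The first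
  and the second power of \<open>killed\<close> share a positive part, so a bounded function that nearly
  changes sign under \<open>killed\<close> is contracted by averaging the two
  (\<open>alternating_green_tendsto_0\<close>).

  By the last fact the probability of an exit height at most \<open>t\<close> is close to half the sum of the
  probabilities of \<open>U / X \<le> t\<close> and of \<open>1 - U / X \<le> t\<close>. From distance \<open>u\<close>, the lengths that
  realise these two events have masses \<open>tail (u / t)\<close> and \<open>tail u - tail (u / (1 - t))\<close>. The tail
  being asymptotically an inverse square, they add up to
  \<open>(t^2 + 1 - (1 - t)^2) * tail u = 2 * t * tail u\<close>, up to an error that is small compared with the
  tail. The second fact discards the error, the first evaluates the rest to \<open>2 * t\<close>, and the
  distribution function of the exit height tends to \<open>t\<close>.
\<close>

section \<open>The law of one step\<close>

definition step_density :: "real \<Rightarrow> real" where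
  "step_density x = 1 / (2 * (1 + x\<^sup>2) * sqrt (1 + x\<^sup>2))"

definition tail :: "real \<Rightarrow> real" where
  "tail u = (1 - u / sqrt (1 + u\<^sup>2)) / 2"

definition step_law :: "real measure" where
  "step_law = density lborel (\<lambda>x. ennreal (step_density x))"

lemma one_plus_square_pos: "0 < 1 + (x::real)\<^sup>2"
  by (simp add: add_pos_nonneg)

lemma step_density_measurable [measurable]: "step_density \<in> borel_measurable borel"
  unfolding step_density_def[abs_def] by measurable

lemma step_density_pos: "0 < step_density x"
  unfolding step_density_def using one_plus_square_pos[of x] by simp

lemma step_density_even: "step_density (- x) = step_density x"
  by (simp add: step_density_def)

lemma step_density_ge_near_0:
  assumes "\<bar>x\<bar> \<le> 1"
  shows "step_density 1 \<le> step_density x"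
proof -
  have "x\<^sup>2 \<le> 1" using assms by (simp add: abs_square_le_1)
  then have "(1 + x\<^sup>2) * sqrt (1 + x\<^sup>2) \<le> (1 + 1\<^sup>2) * sqrt (1 + 1\<^sup>2)"
    by (intro mult_mono) auto
  then show ?thesis
    unfolding step_density_def using one_plus_square_pos[of x]
    by (intro divide_left_mono mult_pos_pos) (auto simp: algebra_simps)
qed

lemma has_field_derivative_tail:
  "((\<lambda>x. - tail x) has_field_derivative step_density x) (at x)"
proof -
  have p: "0 < 1 + x\<^sup>2" by (rule one_plus_square_pos)
  define r where "r = sqrt (1 + x\<^sup>2)"
  have r: "r > 0" "r * r = 1 + x\<^sup>2" using p by (auto simp: r_def)
  have "((\<lambda>x. sqrt (1 + x\<^sup>2)) has_field_derivative x / r) (at x)"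
    using p by (auto intro!: derivative_eq_intros simp: r_def field_simps)
  from DERIV_cdivide[OF DERIV_diff[OF DERIV_divide[OF DERIV_ident this] DERIV_const], of 1 2]
  have "((\<lambda>x. - tail x) has_field_derivative (r - x * (x / r)) / (r * r) / 2) (at x)"
    using r by (simp add: tail_def r_def minus_divide_left del: minus_divide_left[symmetric])
  also have "(r - x * (x / r)) / (r * r) / 2 = step_density x"
    unfolding step_density_def r_def[symmetric] using r
    by (simp add: field_simps power2_eq_square)
  finally show ?thesis .
qed

lemma tail_pos: "0 < tail u"
proof -
  have "u < sqrt (1 + u\<^sup>2)" by (rule real_less_rsqrt) simp
  then show ?thesis using one_plus_square_pos[of u] by (simp add: tail_def)
qed

lemma tail_antimono: assumes "x \<le> y" shows "tail y \<le> tail x"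
proof -
  have "- tail x \<le> - tail y"
    using has_field_derivative_tail step_density_pos less_imp_le
    by (intro DERIV_nonneg_imp_nondecreasing[OF assms]) blast
  then show ?thesis by simp
qed

lemma tail_minus: "tail (- u) = 1 - tail u"
  by (simp add: tail_def diff_divide_distrib add_divide_distrib)

lemma tail_le_1: "tail u \<le> 1"
  using tail_pos[of "-u"] by (simp add: tail_minus)

lemma tail_tendsto_0: "(tail \<longlongrightarrow> 0) at_top"
  unfolding tail_def[abs_def] by real_asymp

lemma tail_measurable [measurable]: "tail \<in> borel_measurable borel"
  unfolding tail_def[abs_def] by measurable

lemma sets_step_law [simp, measurable_cong]: "sets step_law = sets borel"
  and space_step_law [simp]: "space step_law = UNIV"
  by (simp_all add: step_law_def)

lemma emeasure_step_law_atLeast: "emeasure step_law {u..} = ennreal (tail u)"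
proof -
  have "emeasure step_law {u..} = (\<integral>\<^sup>+x. ennreal (step_density x) * indicator {u..} x \<partial>lborel)"
    unfolding step_law_def by (subst emeasure_density) auto
  also have "\<dots> = ennreal (0 - - tail u)"
    using has_field_derivative_tail step_density_pos tail_tendsto_0
    by (intro nn_integral_FTC_atLeast) (auto intro: less_imp_le tendsto_eq_intros)
  finally show ?thesis by simp
qed

lemma step_law_singleton: "emeasure step_law {u} = 0"
  unfolding step_law_def by (subst emeasure_density) (auto simp: nn_integral_0_iff_AE AE_lborel_singleton intro!: AE_mp[OF AE_lborel_singleton[of u]])

lemma emeasure_step_law_greaterThan: "emeasure step_law {u<..} = ennreal (tail u)"
proof -
  have "emeasure step_law {u..} = emeasure step_law ({u<..} \<union> {u})"
    by (rule arg_cong[where f = "emeasure step_law"]) auto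
  also have "\<dots> = emeasure step_law {u<..} + emeasure step_law {u}"
    by (rule plus_emeasure[symmetric]) auto
  finally show ?thesis by (simp add: step_law_singleton emeasure_step_law_atLeast)
qed

lemma step_law_symmetric: "distr step_law borel uminus = step_law"
proof -
  have "distr (density lborel (\<lambda>x. ennreal (step_density x))) borel uminus
      = density (distr lborel borel uminus) (\<lambda>x. ennreal (step_density x))"
    by (subst density_distr) (auto simp: step_density_even)
  also have "distr lborel borel uminus = (lborel :: real measure)"
    by (simp add: lborel_distr_uminus)
  finally show ?thesis by (simp add: step_law_def)
qed

interpretation step_law: prob_space step_law
proof
  have "emeasure step_law UNIV = emeasure step_law ({0..} \<union> {..<0})"
    by (rule arg_cong[where f = "emeasure step_law"]) auto
  also have "\<dots> = emeasure step_law {0..} + emeasure step_law {..<0}"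
    by (rule plus_emeasure[symmetric]) auto
  also have "emeasure step_law {..<0} = emeasure (distr step_law borel uminus) {..<0}"
    by (simp only: step_law_symmetric)
  also have "\<dots> = emeasure step_law {0<..}"
    by (subst emeasure_distr) (auto intro!: arg_cong[where f = "emeasure step_law"])
  finally have "emeasure step_law UNIV = ennreal (1 / 2) + ennreal (1 / 2)"
    by (simp only: emeasure_step_law_atLeast emeasure_step_law_greaterThan tail_def) simp
  also have "\<dots> = 1"
    by (subst ennreal_plus[symmetric]) auto
  finally show "emeasure step_law (space step_law) = 1"
    by simp
qed

lemma measure_step_law_greaterThan: "measure step_law {u<..} = tail u"
  and measure_step_law_atLeast: "measure step_law {u..} = tail u"
  using tail_pos[of u]
  by (simp_all add: measure_def emeasure_step_law_atLeast emeasure_step_law_greaterThan)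

lemma integral_step_law_reflect:
  fixes g :: "real \<Rightarrow> real"
  assumes [measurable]: "g \<in> borel_measurable borel"
  shows "(LINT x|step_law. g (- x)) = (LINT x|step_law. g x)"
proof -
  have "(LINT x|step_law. g x) = (LINT x|distr step_law borel uminus. g x)"
    by (simp only: step_law_symmetric)
  also have "\<dots> = (LINT x|step_law. g (- x))"
    by (rule integral_distr) auto
  finally show ?thesis ..
qed

lemma sin_arctan_tail: "(1 - sin (arctan u)) / 2 = tail u"
  by (simp add: sin_arctan tail_def)

text \<open>The event that the tangent exceeds \<open>u\<close> is the event that the angle exceeds \<open>arctan u\<close>, and the
  cosine density integrates to a sine there.\<close>
lemma distr_tan_angle:
  assumes D: "distributed M lborel \<theta>
    (\<lambda>\<theta>. ennreal (indicator {- (pi / 2) <..< pi / 2} \<theta> * (cos \<theta> / 2)))" (is "distributed _ _ _ ?d")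
  shows "distr M borel (\<lambda>\<omega>. tan (\<theta> \<omega>)) = step_law"
proof (rule measure_eqI_lessThan)
  have [measurable]: "\<theta> \<in> borel_measurable M"
    using distributed_measurable[OF D] by simp
  have [measurable]: "(tan :: real \<Rightarrow> real) \<in> borel_measurable borel"
    unfolding tan_def[abs_def] by measurable
  fix u :: real
  have lt: "arctan u < pi / 2" "- (pi / 2) < arctan u"
    using arctan_ubound arctan_lbound by auto
  have "emeasure (distr M borel (\<lambda>\<omega>. tan (\<theta> \<omega>))) {u<..} = emeasure M (\<theta> -` {t. u < tan t} \<inter> space M)"
    by (subst emeasure_distr) (auto intro!: arg_cong[where f = "emeasure M"])
  also have "\<dots> = (\<integral>\<^sup>+t. ?d t * indicator {t. u < tan t} t \<partial>lborel)"
    by (rule distributed_emeasure[OF D]) measurable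
  also have "\<dots> = (\<integral>\<^sup>+t. ennreal (cos t / 2) * indicator {arctan u..pi / 2} t \<partial>lborel)"
  proof (rule nn_integral_cong_AE)
    have "?d t * indicator {t. u < tan t} t = ennreal (cos t / 2) * indicator {arctan u..pi / 2} t"
      if "t \<noteq> arctan u" "t \<noteq> pi / 2" for t
    proof (cases "- (pi / 2) < t \<and> t < pi / 2")
      case True
      then have "u < tan t \<longleftrightarrow> arctan u < t"
        using arctan_less_iff[of u "tan t"] arctan_tan[of t] by auto
      then show ?thesis using True that by (auto simp: indicator_def)
    next
      case False
      then show ?thesis using that lt by (auto simp: indicator_def)
    qed
    note eq = this
    show "AE t in lborel. ?d t * indicator {t. u < tan t} t
        = ennreal (cos t / 2) * indicator {arctan u..pi / 2} t"
      using AE_lborel_singleton[of "arctan u"] AE_lborel_singleton[of "pi / 2"]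
      by (rule eventually_elim2) (use eq in blast)
  qed
  also have "\<dots> = ennreal (sin (pi / 2) / 2 - sin (arctan u) / 2)"
  proof (rule nn_integral_FTC_Icc[where F = "\<lambda>t. sin t / 2"])
    show "((\<lambda>t. sin t / 2) has_real_derivative cos x / 2) (at x)" for x
      by (auto intro!: derivative_eq_intros)
    show "0 \<le> cos x / 2" if "x \<in> {arctan u..pi / 2}" for x
      using that lt by (auto intro!: cos_ge_zero)
  qed (use lt in auto)
  also have "\<dots> = emeasure step_law {u<..}"
    using sin_arctan_tail[of u]
    by (simp add: emeasure_step_law_greaterThan diff_divide_distrib)
  finally show *: "emeasure (distr M borel (\<lambda>\<omega>. tan (\<theta> \<omega>))) {u<..} = emeasure step_law {u<..}" .
  show "emeasure (distr M borel (\<lambda>\<omega>. tan (\<theta> \<omega>))) {u<..} < \<infinity>"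
    unfolding * by (simp add: emeasure_step_law_greaterThan)
qed auto

section \<open>The killed walk as an operator\<close>

definition bounded_borel :: "(real \<Rightarrow> real) \<Rightarrow> bool" where
  "bounded_borel \<phi> \<longleftrightarrow> \<phi> \<in> borel_measurable borel \<and> (\<exists>C. \<forall>x. \<bar>\<phi> x\<bar> \<le> C)"

lemma bounded_borelI:
  assumes "\<phi> \<in> borel_measurable borel" "\<And>x. \<bar>\<phi> x\<bar> \<le> C"
  shows "bounded_borel \<phi>"
  using assms unfolding bounded_borel_def by blast

lemma bounded_borel_measurable [measurable_dest]:
  "bounded_borel \<phi> \<Longrightarrow> \<phi> \<in> borel_measurable borel"
  by (simp add: bounded_borel_def)

lemma bounded_borelE:
  assumes "bounded_borel \<phi>"
  obtains C where "0 \<le> C" "\<And>x. \<bar>\<phi> x\<bar> \<le> C"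
proof -
  from assms obtain C where C: "\<And>x. \<bar>\<phi> x\<bar> \<le> C" unfolding bounded_borel_def by blast
  show thesis by (rule that[of C]) (use order_trans[OF abs_ge_zero C[of 0]] C in auto)
qed

lemma bounded_borel_const [simp, intro]: "bounded_borel (\<lambda>_. c)"
  by (rule bounded_borelI[of _ "\<bar>c\<bar>"]) auto

lemma bounded_borel_tail [simp, intro]: "bounded_borel tail"
  using tail_pos tail_le_1 by (intro bounded_borelI[of _ 1]) (auto simp: abs_of_pos)

lemma bounded_borel_indicator [simp, intro]: "A \<in> sets borel \<Longrightarrow> bounded_borel (indicator A)"
  by (rule bounded_borelI[of _ 1]) (auto simp: indicator_def)

lemma bounded_borel_add [intro]:
  assumes "bounded_borel \<phi>" "bounded_borel \<psi>"
  shows "bounded_borel (\<lambda>x. \<phi> x + \<psi> x)"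
proof -
  note [measurable] = assms[THEN bounded_borel_measurable]
  obtain C D where "\<And>x. \<bar>\<phi> x\<bar> \<le> C" "\<And>x. \<bar>\<psi> x\<bar> \<le> D"
    using assms by (meson bounded_borelE)
  then show ?thesis
    by (intro bounded_borelI[of _ "C + D"]) (auto intro: order_trans[OF abs_triangle_ineq] add_mono)
qed

lemma bounded_borel_cmult [intro]:
  assumes "bounded_borel \<phi>"
  shows "bounded_borel (\<lambda>x. c * \<phi> x)"
proof -
  note [measurable] = assms[THEN bounded_borel_measurable]
  obtain C where "\<And>x. \<bar>\<phi> x\<bar> \<le> C" using assms by (meson bounded_borelE)
  then show ?thesis
    by (intro bounded_borelI[of _ "\<bar>c\<bar> * C"]) (auto simp: abs_mult intro: mult_left_mono)
qed

lemma bounded_borel_diff [intro]: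
  assumes "bounded_borel \<phi>" "bounded_borel \<psi>"
  shows "bounded_borel (\<lambda>x. \<phi> x - \<psi> x)"
  using bounded_borel_add[OF assms(1) bounded_borel_cmult[OF assms(2), of "-1"]] by simp

lemma bounded_borel_abs [intro]:
  assumes "bounded_borel \<phi>"
  shows "bounded_borel (\<lambda>x. \<bar>\<phi> x\<bar>)"
  using assms unfolding bounded_borel_def by auto

lemma bounded_borel_max0 [intro]:
  assumes "bounded_borel \<phi>"
  shows "bounded_borel (\<lambda>x. max 0 (\<phi> x))"
proof -
  note [measurable] = assms[THEN bounded_borel_measurable]
  obtain C where "\<And>x. \<bar>\<phi> x\<bar> \<le> C" using assms by (meson bounded_borelE)
  then show ?thesis
    by (intro bounded_borelI[of _ C])
       (auto simp: max_def intro: order_trans[OF abs_ge_zero] abs_le_D1)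
qed

text \<open>One step of the walk seen from the edge: \<open>killed \<phi> s\<close> averages \<open>\<phi>\<close> over the new distance to the
  edge when the old one is \<open>s\<close>, on the event that the edge is not passed. Only the values of \<open>\<phi>\<close>
  on the nonnegative half-line enter.\<close>
definition killed :: "(real \<Rightarrow> real) \<Rightarrow> real \<Rightarrow> real" where
  "killed \<phi> s = (LINT x|step_law. indicator {..s} x * \<phi> (s - x))"

lemma integrable_step_law_bounded:
  fixes g :: "real \<Rightarrow> real"
  assumes "g \<in> borel_measurable borel" "\<And>x. \<bar>g x\<bar> \<le> C"
  shows "integrable step_law g"
  using assms by (intro step_law.integrable_const_bound[of _ C]) auto

lemma integrable_killed:
  assumes "bounded_borel \<phi>"
  shows "integrable step_law (\<lambda>x. indicator {..s} x * \<phi> (s - x))"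
proof -
  note [measurable] = assms[THEN bounded_borel_measurable]
  obtain C where "0 \<le> C" "\<And>x. \<bar>\<phi> x\<bar> \<le> C" using assms by (meson bounded_borelE)
  then show ?thesis
    by (intro integrable_step_law_bounded[of _ C]) (auto simp: indicator_def)
qed

lemma killed_mono:
  assumes "bounded_borel \<phi>" "bounded_borel \<psi>" "\<And>x. 0 \<le> x \<Longrightarrow> \<phi> x \<le> \<psi> x"
  shows "killed \<phi> s \<le> killed \<psi> s"
  unfolding killed_def using assms
  by (intro integral_mono integrable_killed) (auto simp: indicator_def)

lemma killed_add:
  assumes "bounded_borel \<phi>" "bounded_borel \<psi>"
  shows "killed (\<lambda>x. \<phi> x + \<psi> x) s = killed \<phi> s + killed \<psi> s"
  unfolding killed_def distrib_left using assms
  by (intro Bochner_Integration.integral_add integrable_killed)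

lemma killed_diff:
  assumes "bounded_borel \<phi>" "bounded_borel \<psi>"
  shows "killed (\<lambda>x. \<phi> x - \<psi> x) s = killed \<phi> s - killed \<psi> s"
  unfolding killed_def right_diff_distrib using assms
  by (intro Bochner_Integration.integral_diff integrable_killed)

lemma killed_cmult: "killed (\<lambda>x. c * \<phi> x) s = c * killed \<phi> s"
  unfolding killed_def by (simp add: mult.left_commute)

lemma killed_zero [simp]: "killed (\<lambda>_. 0) s = 0"
  by (simp add: killed_def)

lemma killed_const: "killed (\<lambda>_. c) s = c * (1 - tail s)"
proof -
  have "killed (\<lambda>_. c) s = c * measure step_law {..s}"
    by (simp add: killed_def mult.commute)
  also have "measure step_law {..s} = 1 - measure step_law {s<..}"
    using step_law.prob_compl[of "{s<..}"] by (simp add: Compl_eq_Diff_UNIV[symmetric])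
  finally show ?thesis by (simp add: measure_step_law_greaterThan)
qed

lemma abs_killed_le:
  assumes "bounded_borel \<phi>"
  shows "\<bar>killed \<phi> s\<bar> \<le> killed (\<lambda>x. \<bar>\<phi> x\<bar>) s"
proof -
  have "killed \<phi> s \<le> killed (\<lambda>x. \<bar>\<phi> x\<bar>) s"
    using assms by (intro killed_mono) auto
  moreover have "killed (\<lambda>x. - 1 * \<phi> x) s \<le> killed (\<lambda>x. \<bar>\<phi> x\<bar>) s"
    using assms by (intro killed_mono bounded_borel_cmult bounded_borel_abs) auto
  ultimately show ?thesis by (simp only: killed_cmult)
qed

lemma killed_nonneg: "(\<And>x. 0 \<le> x \<Longrightarrow> 0 \<le> \<phi> x) \<Longrightarrow> 0 \<le> killed \<phi> s"
  unfolding killed_def by (intro integral_nonneg_AE) (auto simp: indicator_def)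

lemma abs_killed_le_const:
  assumes "bounded_borel \<phi>" "\<And>x. 0 \<le> x \<Longrightarrow> \<bar>\<phi> x\<bar> \<le> C"
  shows "\<bar>killed \<phi> s\<bar> \<le> C"
proof -
  have C: "0 \<le> C" using assms(2)[of 0] by simp
  have "\<bar>killed \<phi> s\<bar> \<le> killed (\<lambda>x. \<bar>\<phi> x\<bar>) s" by (rule abs_killed_le[OF assms(1)])
  also have "\<dots> \<le> killed (\<lambda>_. C) s" using assms by (intro killed_mono) auto
  also have "\<dots> \<le> C" using C tail_pos[of s] by (simp add: killed_const mult_left_le)
  finally show ?thesis .
qed

lemma bounded_borel_killed [intro]:
  assumes "bounded_borel \<phi>"
  shows "bounded_borel (killed \<phi>)"
proof -
  note [measurable] = assms[THEN bounded_borel_measurable]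
  obtain C where C: "\<And>x. \<bar>\<phi> x\<bar> \<le> C" using assms by (meson bounded_borelE)
  have "Measurable.pred (borel \<Otimes>\<^sub>M step_law) (\<lambda>(s, x). x \<le> s)"
    by measurable
  then have "(\<lambda>(s, x). indicator {..s} x * \<phi> (s - x)) \<in> borel_measurable (borel \<Otimes>\<^sub>M step_law)"
    unfolding indicator_def by (simp add: case_prod_beta)
  then have "killed \<phi> \<in> borel_measurable borel"
    unfolding killed_def[abs_def] by measurable
  then show ?thesis
    using abs_killed_le_const[OF assms C] by (intro bounded_borelI) auto
qed

lemma bounded_borel_funpow [intro]: "bounded_borel \<phi> \<Longrightarrow> bounded_borel ((killed ^^ n) \<phi>)"
  by (induction n) auto

lemma killed_tendsto:
  assumes "\<And>n. bounded_borel (\<phi> n)" "\<And>n x. 0 \<le> x \<Longrightarrow> \<bar>\<phi> n x\<bar> \<le> C"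
    and "\<And>x. 0 \<le> x \<Longrightarrow> (\<lambda>n. \<phi> n x) \<longlonglongrightarrow> \<psi> x" and "\<psi> \<in> borel_measurable borel"
  shows "(\<lambda>n. killed (\<phi> n) s) \<longlonglongrightarrow> killed \<psi> s"
proof -
  note [measurable] = assms(1)[THEN bounded_borel_measurable] assms(4)
  have C: "0 \<le> C" using assms(2)[of 0] by (meson abs_ge_zero order_trans order_refl)
  show ?thesis unfolding killed_def
    by (rule integral_dominated_convergence[of _ _ _ "\<lambda>_. C"])
       (use assms(2,3) C in \<open>auto simp: indicator_def\<close>)
qed

text \<open>A function vanishing at infinity keeps this property: a single step started far from the
  boundary ends far from the boundary.\<close>
lemma killed_tendsto_0_at_top:
  assumes "bounded_borel \<phi>" "(\<phi> \<longlongrightarrow> 0) at_top"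
  shows "(killed \<phi> \<longlongrightarrow> 0) at_top"
proof -
  note [measurable] = assms(1)[THEN bounded_borel_measurable]
  obtain C where C: "0 \<le> C" "\<And>x. \<bar>\<phi> x\<bar> \<le> C" using assms by (meson bounded_borelE)
  have "((\<lambda>s. LINT x|step_law. indicator {..s} x * \<phi> (s - x)) \<longlongrightarrow> (LINT x|step_law. 0)) at_top"
  proof (rule integral_dominated_convergence_at_top[where w = "\<lambda>_. C"])
    have "((\<lambda>s. indicator {..s} x * \<phi> (s - x)) \<longlongrightarrow> 0) at_top" for x :: real
    proof -
      have "filterlim (\<lambda>s. s - x) at_top at_top" by real_asymp
      then have "((\<lambda>s. \<phi> (s - x)) \<longlongrightarrow> 0) at_top"
        by (rule filterlim_compose[OF assms(2)])
      moreover have "\<forall>\<^sub>F s in at_top. \<phi> (s - x) = indicator {..s} x * \<phi> (s - x)"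
        using eventually_ge_at_top[of x] by eventually_elim auto
      ultimately show ?thesis by (simp add: tendsto_cong)
    qed
    then show "AE x in step_law. ((\<lambda>s. indicator {..s} x * \<phi> (s - x)) \<longlongrightarrow> 0) at_top"
      by simp
  qed (use C in \<open>auto simp: indicator_def\<close>)
  then show ?thesis unfolding killed_def[abs_def] by simp
qed

lemma killed_funpow_mono:
  assumes "bounded_borel \<phi>" "bounded_borel \<psi>" "\<And>x. \<phi> x \<le> \<psi> x"
  shows "(killed ^^ n) \<phi> s \<le> (killed ^^ n) \<psi> s"
  by (induction n arbitrary: s) (use assms in \<open>auto intro!: killed_mono\<close>)

lemma killed_funpow_add:
  assumes "bounded_borel \<phi>" "bounded_borel \<psi>"
  shows "(killed ^^ n) (\<lambda>x. \<phi> x + \<psi> x) = (\<lambda>s. (killed ^^ n) \<phi> s + (killed ^^ n) \<psi> s)"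
proof (induction n)
  case (Suc n)
  show ?case
    by (simp only: funpow.simps o_apply Suc.IH)
       (intro ext killed_add bounded_borel_funpow assms)
qed simp

lemma killed_funpow_diff:
  assumes "bounded_borel \<phi>" "bounded_borel \<psi>"
  shows "(killed ^^ n) (\<lambda>x. \<phi> x - \<psi> x) = (\<lambda>s. (killed ^^ n) \<phi> s - (killed ^^ n) \<psi> s)"
proof (induction n)
  case (Suc n)
  show ?case
    by (simp only: funpow.simps o_apply Suc.IH)
       (intro ext killed_diff bounded_borel_funpow assms)
qed simp

lemma killed_funpow_cmult: "(killed ^^ n) (\<lambda>x. c * \<phi> x) = (\<lambda>s. c * (killed ^^ n) \<phi> s)"
proof (induction n)
  case (Suc n)
  show ?case
    by (simp only: funpow.simps o_apply Suc.IH) (intro ext killed_cmult)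
qed simp

lemma killed_funpow_abs_le:
  assumes "bounded_borel \<phi>" "bounded_borel \<psi>" "\<And>x. \<bar>\<phi> x\<bar> \<le> \<psi> x"
  shows "\<bar>(killed ^^ n) \<phi> s\<bar> \<le> (killed ^^ n) \<psi> s"
proof -
  have "(killed ^^ n) \<phi> s \<le> (killed ^^ n) \<psi> s"
    using assms by (intro killed_funpow_mono) (auto simp: abs_le_iff)
  moreover have "(killed ^^ n) (\<lambda>x. -1 * \<phi> x) s \<le> (killed ^^ n) \<psi> s"
    using assms by (intro killed_funpow_mono bounded_borel_cmult) (auto simp: abs_le_iff)
  ultimately show ?thesis by (simp only: killed_funpow_cmult)
qed

text \<open>Each step loses exactly the mass that passes the edge, and these losses telescope.\<close>
lemma sum_killed_tail:
  "(\<Sum>n<m. (killed ^^ n) tail s) = 1 - (killed ^^ m) (\<lambda>_. 1) s"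
proof -
  have "(killed ^^ n) tail s = (killed ^^ n) (\<lambda>_. 1) s - (killed ^^ Suc n) (\<lambda>_. 1) s" for n
  proof -
    have "tail = (\<lambda>x. (\<lambda>_. 1) x - killed (\<lambda>_. 1) x)"
      by (simp add: killed_const fun_eq_iff)
    then have "(killed ^^ n) tail = (killed ^^ n) (\<lambda>x. (\<lambda>_. 1) x - killed (\<lambda>_. 1) x)"
      by simp
    also have "\<dots> = (\<lambda>s. (killed ^^ n) (\<lambda>_. 1) s - (killed ^^ n) (killed (\<lambda>_. 1)) s)"
      by (rule killed_funpow_diff) auto
    finally show ?thesis by (simp add: funpow_swap1)
  qed
  then show ?thesis by (induction m) simp_all
qed

lemma integrable_killed_reflect:
  assumes v: "bounded_borel v"
  shows "integrable step_law (\<lambda>x. indicator {..u} (- x) * v (u + x))"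
proof -
  note [measurable] = v[THEN bounded_borel_measurable]
  obtain C where C: "0 \<le> C" "\<And>x. \<bar>v x\<bar> \<le> C" using v by (meson bounded_borelE)
  show ?thesis
    by (rule integrable_step_law_bounded[of _ C]) (use C in \<open>auto simp: indicator_def\<close>)
qed

lemma integrable_drift:
  assumes v: "bounded_borel v"
  shows "integrable step_law
    (\<lambda>x. 2 * v u - indicator {..u} x * v (u - x) - indicator {..u} (- x) * v (u + x))"
  using integrable_killed[OF v] integrable_killed_reflect[OF v]
  by (intro Bochner_Integration.integrable_diff) auto

text \<open>Pairing a step with its reflection turns the drift of \<open>v\<close> into a symmetric second
  difference, up to the mass lost at the boundary.\<close>
lemma killed_drift:
  assumes v: "bounded_borel v"
  shows "v u - killed v u =
    (LINT x|step_law. 2 * v u - indicator {..u} x * v (u - x) - indicator {..u} (- x) * v (u + x)) / 2"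
proof -
  note [measurable] = v[THEN bounded_borel_measurable]
  have int: "integrable step_law (\<lambda>x. indicator {..u} x * v (u - x))"
    by (rule integrable_killed[OF v])
  have int': "integrable step_law (\<lambda>x. indicator {..u} (- x) * v (u + x))"
    by (rule integrable_killed_reflect[OF v])
  have "killed v u = (LINT x|step_law. indicator {..u} (- x) * v (u + x))"
    using integral_step_law_reflect[of "\<lambda>x. indicator {..u} x * v (u - x)"]
    by (simp add: killed_def)
  then show ?thesis using int int'
    by (simp add: killed_def[symmetric] step_law.prob_space[simplified])
qed

section \<open>A maximum principle and recurrence\<close>

text \<open>From a distance at most \<open>R\<close> every step loses at least the mass \<open>tail R\<close>, so repeating the
  inequality makes the bound on \<open>\<phi>\<close> shrink geometrically.\<close>
lemma compact_subharmonic_zero: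
  assumes \<phi>: "bounded_borel \<phi>" and nonneg: "\<And>u. 0 \<le> u \<Longrightarrow> 0 \<le> \<phi> u"
    and sub: "\<And>u. 0 \<le> u \<Longrightarrow> \<phi> u \<le> killed \<phi> u"
    and supp: "\<And>u. R < u \<Longrightarrow> \<phi> u = 0" and "0 \<le> u"
  shows "\<phi> u = 0"
proof -
  obtain C where C: "0 \<le> C" "\<And>x. \<bar>\<phi> x\<bar> \<le> C" using \<phi> by (meson bounded_borelE)
  let ?q = "1 - tail R"
  have q: "0 \<le> ?q" "?q < 1" using tail_le_1[of R] tail_pos[of R] by auto
  have bound: "\<forall>u\<ge>0. \<phi> u \<le> ?q ^ n * C" for n
  proof (induction n)
    case 0
    then show ?case using C by (auto intro: abs_le_D1)
  next
    case (Suc n)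
    show ?case
    proof (intro allI impI)
      fix u :: real assume u: "0 \<le> u"
      show "\<phi> u \<le> ?q ^ Suc n * C"
      proof (cases "u \<le> R")
        case True
        have "\<phi> u \<le> killed \<phi> u" by (rule sub[OF u])
        also have "\<dots> \<le> killed (\<lambda>_. ?q ^ n * C) u"
          using Suc \<phi> by (intro killed_mono) auto
        also have "\<dots> \<le> ?q ^ n * C * ?q"
          unfolding killed_const using tail_antimono[OF True] q C
          by (intro mult_left_mono) auto
        finally show ?thesis by (simp add: mult_ac)
      next
        case False
        then show ?thesis using supp[of u] q C by simp
      qed
    qed
  qed
  have "(\<lambda>n. ?q ^ n * C) \<longlonglongrightarrow> 0 * C"
    by (intro tendsto_mult tendsto_const LIMSEQ_power_zero) (use q in auto)
  then have "\<phi> u \<le> 0 * C"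
    by (rule LIMSEQ_le_const) (use bound \<open>0 \<le> u\<close> in auto)
  with nonneg[OF \<open>0 \<le> u\<close>] show ?thesis by simp
qed

lemma step_law_tail_mean:
  assumes "0 \<le> u"
  shows "integrable step_law (\<lambda>x. indicator {u<..} x * x)"
    and "(LINT x|step_law. indicator {u<..} x * x) = 1 / (2 * sqrt (1 + u\<^sup>2))"
proof -
  let ?f = "\<lambda>x. step_density x * x" and ?F = "\<lambda>x. - 1 / (2 * sqrt (1 + x\<^sup>2))"
  have der: "(?F has_real_derivative ?f x) (at x)" for x
  proof -
    define r where "r = sqrt (1 + x\<^sup>2)"
    have r: "r > 0" "r * r = 1 + x\<^sup>2" using one_plus_square_pos[of x] by (auto simp: r_def)
    have "((\<lambda>x. sqrt (1 + x\<^sup>2)) has_field_derivative x / r) (at x)"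
      using one_plus_square_pos[of x] by (auto intro!: derivative_eq_intros simp: r_def field_simps)
    from DERIV_cmult[OF DERIV_inverse'[OF this], of "- 1 / 2"]
    have "((\<lambda>x. - 1 / 2 * inverse (sqrt (1 + x\<^sup>2))) has_field_derivative
        - 1 / 2 * - (inverse r * (x / r) * inverse r)) (at x)"
      using r by (simp add: r_def)
    also have "- 1 / 2 * - (inverse r * (x / r) * inverse r) = ?f x"
      unfolding step_density_def r_def[symmetric] r(2)[symmetric] using r(1) by (simp add: field_simps)
    finally show ?thesis by (simp add: field_simps)
  qed
  have nn: "(\<integral>\<^sup>+x. ennreal (?f x) * indicator {u..} x \<partial>lborel) = ennreal (0 - ?F u)"
  proof (rule nn_integral_FTC_atLeast[where F = ?F])
    show "(?F \<longlongrightarrow> 0) at_top" by real_asymp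
  qed (use der assms less_imp_le[OF step_density_pos] in \<open>auto intro!: mult_nonneg_nonneg\<close>)
  have "(\<integral>\<^sup>+x. ennreal (indicator {u<..} x * x) \<partial>step_law)
      = (\<integral>\<^sup>+x. ennreal (step_density x) * ennreal (indicator {u<..} x * x) \<partial>lborel)"
    unfolding step_law_def by (rule nn_integral_density) auto
  also have "\<dots> = (\<integral>\<^sup>+x. ennreal (?f x) * indicator {u..} x \<partial>lborel)"
  proof (rule nn_integral_cong_AE, rule AE_mp[OF AE_lborel_singleton[of u] AE_I2], rule impI)
    fix x :: real assume "x \<noteq> u"
    then show "ennreal (step_density x) * ennreal (indicator {u<..} x * x) = ennreal (?f x) * indicator {u..} x"
      using assms less_imp_le[OF step_density_pos[of x]]
      by (auto simp: indicator_def simp flip: ennreal_mult')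
  qed
  also note nn
  finally have *: "(\<integral>\<^sup>+x. ennreal (indicator {u<..} x * x) \<partial>step_law) = ennreal (1 / (2 * sqrt (1 + u\<^sup>2)))"
    by simp
  have "has_bochner_integral step_law (\<lambda>x. indicator {u<..} x * x) (1 / (2 * sqrt (1 + u\<^sup>2)))"
    using * assms one_plus_square_pos[of u]
    by (intro has_bochner_integral_nn_integral) (auto simp: indicator_def)
  then show "integrable step_law (\<lambda>x. indicator {u<..} x * x)"
    and "(LINT x|step_law. indicator {u<..} x * x) = 1 / (2 * sqrt (1 + u\<^sup>2))"
    by (auto simp: has_bochner_integral_iff)
qed

text \<open>The logarithm is a supersolution far from the edge: passing the edge costs about
  \<open>ln u / (4 * u^2)\<close>, jumps of moderate size cost as well by concavity, and jumps beyond twice the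
  distance gain only of the order \<open>1 / u^2\<close>. Truncation at the level \<open>R\<close> keeps these properties
  and makes the function equal to one from there on.\<close>
definition barrier :: "real \<Rightarrow> real \<Rightarrow> real" where
  "barrier R u = min 1 (ln (1 + max 0 u) / ln (1 + R))"

lemma barrier_bounds: "0 < R \<Longrightarrow> 0 \<le> barrier R u" "barrier R u \<le> 1"
  by (auto simp: barrier_def intro!: divide_nonneg_pos)

lemma bounded_borel_barrier [intro]:
  assumes "0 < R" shows "bounded_borel (barrier R)"
proof (rule bounded_borelI)
  show "barrier R \<in> borel_measurable borel" unfolding barrier_def[abs_def] by measurable
  show "\<bar>barrier R u\<bar> \<le> 1" for u using barrier_bounds[of R u] assms by simp
qed

text \<open>The gain from upward jumps longer than \<open>u\<close>, bounded by the tangent of the logarithm, against the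
  loss at the edge. The threshold 8 makes \<open>ln (1 + u)\<close> at least 2.\<close>
lemma ln_drift_margin:
  assumes "8 \<le> u"
  shows "1 / ((1 + u) * sqrt (1 + u\<^sup>2)) \<le> 2 * ln (1 + u) * tail u"
proof -
  define r where "r = sqrt (1 + u\<^sup>2)"
  have r: "0 < r" "r * r = 1 + u * u" using one_plus_square_pos[of u]
    by (auto simp: r_def power2_eq_square)
  have "r \<le> 1 + u" unfolding r_def using assms
    by (intro real_le_lsqrt) (auto simp: power2_eq_square algebra_simps)
  have "exp 2 = exp 1 * (exp 1 :: real)" by (simp flip: exp_add)
  also have "\<dots> \<le> 3 * 3" by (intro mult_mono exp_le) auto
  finally have "2 \<le> ln (1 + u)" using assms by (subst ln_ge_iff) auto
  then have "2 * (1 + u) \<le> ln (1 + u) * (1 + u)" using assms by (intro mult_right_mono) auto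
  moreover have "r + u \<le> 2 * (1 + u)" using \<open>r \<le> 1 + u\<close> by simp
  ultimately have le: "r + u \<le> ln (1 + u) * (1 + u)" by (rule order_trans[rotated])
  have "(r - u) * (r + u) = 1" using r by (simp add: algebra_simps)
  then have "r - u = 1 / (r + u)" using r assms by (simp add: field_simps)
  moreover have "2 * tail u = (r - u) / r"
    using r by (simp add: tail_def r_def[symmetric] diff_divide_distrib)
  ultimately have t2: "2 * tail u = 1 / (r * (r + u))" by (simp add: mult.commute)
  have t: "2 * ln (1 + u) * tail u = ln (1 + u) / (r * (r + u))"
    using arg_cong[OF t2, of "\<lambda>z. ln (1 + u) * z"] by (simp add: mult_ac)
  have "1 * (r * (r + u)) \<le> ln (1 + u) * ((1 + u) * r)"
    using mult_left_mono[OF le, of r] r by (simp add: mult_ac)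
  then show ?thesis unfolding t r_def[symmetric] using r assms
    by (simp add: divide_simps mult_ac)
qed

lemma killed_barrier_le:
  assumes R: "0 < R" and u: "8 \<le> u"
  shows "killed (barrier R) u \<le> barrier R u"
proof (cases "1 \<le> ln (1 + u) / ln (1 + R)")
  case True
  have "killed (barrier R) u \<le> killed (\<lambda>_. 1) u"
    using R barrier_bounds by (intro killed_mono) auto
  also have "\<dots> \<le> 1" using tail_pos[of u] by (simp add: killed_const)
  finally show ?thesis using True u by (simp add: barrier_def)
next
  case False
  define D where "D = ln (1 + R)"
  have D: "0 < D" using R by (simp add: D_def)
  have bu: "barrier R u = ln (1 + u) / D" using False u by (simp add: barrier_def D_def)
  have bx: "barrier R x \<le> ln (1 + x) / D" if "0 \<le> x" for x
    using that by (simp add: barrier_def D_def)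
  define c where "c = 1 / ((1 + u) * D)"
  \<comment> \<open>The one-sided lower bound for the symmetric second difference; only steps longer than \<open>u\<close>
      contribute to it.\<close>
  let ?h = "\<lambda>x. indicator {u<..} x * barrier R u - c * (indicator {u<..} x * x)"
  let ?g = "\<lambda>x. 2 * barrier R u - indicator {..u} x * barrier R (u - x)
                 - indicator {..u} (- x) * barrier R (u + x)"
  note [measurable] = bounded_borel_measurable[OF bounded_borel_barrier[OF R]]
  have [measurable]: "?h \<in> borel_measurable borel" by measurable
  have int_1: "integrable step_law (\<lambda>x. indicator {u<..} x * barrier R u)"
    by (rule integrable_step_law_bounded[of _ 1])
       (use barrier_bounds[of R] R in \<open>auto simp: indicator_def\<close>)
  have int_2: "integrable step_law (\<lambda>x. c * (indicator {u<..} x * x))"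
    using step_law_tail_mean(1)[of u] u by (intro integrable_mult_right) auto
  have int_h: "integrable step_law ?h"
    by (rule Bochner_Integration.integrable_diff[OF int_1 int_2])
  have int_h': "integrable step_law (\<lambda>x. ?h (- x))"
  proof -
    have "integrable (distr step_law borel uminus) ?h" using int_h by (simp only: step_law_symmetric)
    then show ?thesis by (subst (asm) integrable_distr_eq) auto
  qed
  have le: "?h x + ?h (- x) \<le> ?g x" for x
  proof -
    have far: "barrier R (u + y) \<le> barrier R u + c * y" if "u < y" for y
    proof -
      have "ln (1 + (u + y)) - ln (1 + u) \<le> (1 + (u + y) - (1 + u)) / (1 + u)"
        using that u by (intro ln_diff_le) auto
      then have "ln (1 + (u + y)) / D \<le> (ln (1 + u) + y / (1 + u)) / D"
        using D by (intro divide_right_mono) auto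
      then have "ln (1 + (u + y)) / D \<le> ln (1 + u) / D + y / (1 + u) / D"
        by (simp only: add_divide_distrib)
      then show ?thesis using bx[of "u + y"] that u by (simp add: bu c_def)
    qed
    consider "u < x" | "x < - u" | "\<bar>x\<bar> \<le> u" by linarith
    then show ?thesis
    proof cases
      case 1
      then show ?thesis using far[of x] u by (simp add: indicator_def)
    next
      case 2
      then show ?thesis using far[of "- x"] u by (simp add: indicator_def)
    next
      case 3
      then have p: "0 < 1 + (u - x)" "0 < 1 + (u + x)" by auto
      have "ln (1 + (u - x)) + ln (1 + (u + x)) = ln ((1 + (u - x)) * (1 + (u + x)))"
        using p by (simp add: ln_mult)
      also have "\<dots> \<le> ln ((1 + u) * (1 + u))"
      proof (subst ln_le_cancel_iff)
        show "0 < (1 + (u - x)) * (1 + (u + x))" by (rule mult_pos_pos[OF p])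
        show "0 < (1 + u) * (1 + u)" using u by simp
        have "(1 + (u - x)) * (1 + (u + x)) = (1 + u) * (1 + u) - x * x" by (simp add: algebra_simps)
        then show "(1 + (u - x)) * (1 + (u + x)) \<le> (1 + u) * (1 + u)" by simp
      qed
      also have "\<dots> = 2 * ln (1 + u)" using u by (simp add: ln_mult)
      finally have "(ln (1 + (u - x)) + ln (1 + (u + x))) / D \<le> 2 * ln (1 + u) / D"
        using D by (intro divide_right_mono) auto
      moreover have "x \<le> u" "- x \<le> u" using 3 by auto
      moreover have "barrier R (u - x) \<le> ln (1 + (u - x)) / D" "barrier R (u + x) \<le> ln (1 + (u + x)) / D"
        using 3 by (auto intro!: bx)
      ultimately show ?thesis
        by (simp add: indicator_def bu add_divide_distrib)
    qed
  qed
  have "0 \<le> 2 * (barrier R u * tail u - c * (1 / (2 * sqrt (1 + u\<^sup>2))))"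
  proof -
    have "1 / ((1 + u) * sqrt (1 + u\<^sup>2)) / D \<le> 2 * ln (1 + u) * tail u / D"
      by (rule divide_right_mono[OF ln_drift_margin[OF u]]) (use D in auto)
    then show ?thesis by (simp add: bu c_def mult_ac)
  qed
  also have "\<dots> = 2 * (LINT x|step_law. ?h x)"
  proof -
    have "(LINT x|step_law. ?h x) = (LINT x|step_law. indicator {u<..} x * barrier R u)
        - (LINT x|step_law. c * (indicator {u<..} x * x))"
      by (rule Bochner_Integration.integral_diff[OF int_1 int_2])
    then show ?thesis using step_law_tail_mean(2)[of u] u
      by (simp add: measure_step_law_greaterThan mult.commute)
  qed
  also have "\<dots> = (LINT x|step_law. ?h x + ?h (- x))"
    using int_h int_h' integral_step_law_reflect[of ?h]
    by (subst Bochner_Integration.integral_add) auto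
  also have "\<dots> \<le> (LINT x|step_law. ?g x)"
  proof (rule integral_mono[OF _ _ le])
    show "integrable step_law (\<lambda>x. ?h x + ?h (- x))"
      by (rule Bochner_Integration.integrable_add[OF int_h int_h'])
    show "integrable step_law ?g"
      by (rule integrable_drift[OF bounded_borel_barrier[OF R]])
  qed
  also have "\<dots> = 2 * (barrier R u - killed (barrier R) u)"
    by (subst killed_drift) (use R in auto)
  finally show ?thesis by simp
qed

text \<open>If \<open>\<phi>\<close> is at most \<open>K\<close>, then it is at most \<open>(1 - tail 8) * K\<close> on the interval from 0 to 8, since
  there a step loses mass at least \<open>tail 8\<close>. The excess of \<open>\<phi>\<close> over this value plus \<open>K\<close> times a
  barrier vanishes close to the edge and far away, hence everywhere by
  \<open>compact_subharmonic_zero\<close>. Letting the barrier recede gives the improved bound on the whole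
  half-line, and it can be iterated.\<close>
lemma bounded_subharmonic_zero:
  assumes \<phi>: "bounded_borel \<phi>" and nonneg: "\<And>u. 0 \<le> u \<Longrightarrow> 0 \<le> \<phi> u"
    and sub: "\<And>u. 0 \<le> u \<Longrightarrow> \<phi> u \<le> killed \<phi> u" and "0 \<le> u"
  shows "\<phi> u = 0"
proof -
  obtain C where C: "0 \<le> C" "\<And>x. \<bar>\<phi> x\<bar> \<le> C" using \<phi> by (meson bounded_borelE)
  let ?q = "1 - tail 8"
  have q: "0 \<le> ?q" "?q < 1" using tail_le_1[of 8] tail_pos[of 8] by auto
  have improve: "\<forall>u\<ge>0. \<phi> u \<le> ?q * K" if K: "\<forall>u\<ge>0. \<phi> u \<le> K" for K
  proof -
    have "\<phi> 0 \<le> K" using K by simp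
    with nonneg[of 0] have K0: "0 \<le> K" by simp
    have near: "\<phi> u \<le> ?q * K" if "0 \<le> u" "u \<le> 8" for u
    proof -
      have "\<phi> u \<le> killed (\<lambda>_. K) u"
        using sub[OF that(1)] by (rule order_trans) (use K in \<open>auto intro!: killed_mono \<phi>\<close>)
      also have "\<dots> \<le> K * ?q"
        unfolding killed_const using tail_antimono[OF that(2)] K0 by (intro mult_left_mono) auto
      finally show ?thesis by (simp add: mult.commute)
    qed
    have upper: "\<phi> u \<le> ?q * K + K * barrier R u" if R: "0 < R" and u: "0 \<le> u" for R u
    proof -
      let ?e = "\<lambda>u. \<phi> u - (?q * K + K * barrier R u)"
      let ?d = "\<lambda>u. max 0 (?e u)"
      have bb: "bounded_borel ?e" using \<phi> R by (intro bounded_borel_diff bounded_borel_add bounded_borel_cmult) auto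
      have "?d u = 0"
      proof (rule compact_subharmonic_zero[of ?d R])
        show "bounded_borel ?d" using bb by (rule bounded_borel_max0)
        show "?d u = 0" if "R < u" for u
        proof -
          have "1 \<le> ln (1 + u) / ln (1 + R)" using that R by simp
          then have "barrier R u = 1" using that R by (simp add: barrier_def)
          moreover have "\<phi> u \<le> K" using K that R by simp
          moreover have "0 \<le> ?q * K" using q K0 by simp
          ultimately have "?e u \<le> 0" by (simp only: mult_1_right)
          then show ?thesis by (rule max_absorb1)
        qed
        fix u :: real assume u: "0 \<le> u"
        have kd: "0 \<le> killed ?d u" by (rule killed_nonneg) auto
        show "?d u \<le> killed ?d u"
        proof (cases "u \<le> 8")
          case True
          have "0 \<le> K * barrier R u" using K0 barrier_bounds R by simp
          then have "?e u \<le> 0" using near[OF u True] by linarith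
          then show ?thesis using kd by simp
        next
          case False
          have "K * killed (barrier R) u \<le> K * barrier R u"
            using killed_barrier_le[OF R, of u] False K0 by (intro mult_left_mono) auto
          moreover have "killed (\<lambda>_. ?q * K) u \<le> ?q * K"
            unfolding killed_const using q K0 tail_pos[of u] by (intro mult_left_le) auto
          ultimately have "?e u \<le> killed \<phi> u - (killed (\<lambda>_. ?q * K) u + killed (\<lambda>x. K * barrier R x) u)"
            using sub[OF u] by (simp only: killed_cmult)
          also have "killed (\<lambda>_. ?q * K) u + killed (\<lambda>x. K * barrier R x) u
              = killed (\<lambda>x. ?q * K + K * barrier R x) u"
            by (rule killed_add[symmetric]) (intro bounded_borel_const bounded_borel_cmult bounded_borel_barrier R)+
          also have "killed \<phi> u - \<dots> = killed ?e u"
            by (rule killed_diff[symmetric])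
               (intro \<phi> bounded_borel_add bounded_borel_const bounded_borel_cmult bounded_borel_barrier R)+
          also have "\<dots> \<le> killed ?d u"
            by (rule killed_mono[OF bb bounded_borel_max0[OF bb]]) auto
          finally show ?thesis using kd by simp
        qed
      qed (use u in auto)
      then show ?thesis by (simp add: max_def split: if_splits)
    qed
    show ?thesis
    proof (intro allI impI)
      fix u :: real assume u: "0 \<le> u"
      have "((\<lambda>R. 1 / ln (1 + R)) \<longlongrightarrow> (0 :: real)) at_top" by real_asymp
      from tendsto_mult[OF tendsto_const[of "ln (1 + max 0 u)"] this]
      have "((\<lambda>R. barrier R u) \<longlongrightarrow> min 1 0) at_top"
        unfolding barrier_def by (intro tendsto_min tendsto_const) simp
      then have "((\<lambda>R. ?q * K + K * barrier R u) \<longlongrightarrow> ?q * K + K * 0) at_top"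
        by (intro tendsto_intros) simp
      then have "\<phi> u \<le> ?q * K + K * 0"
        by (rule tendsto_lowerbound)
           (use upper u in \<open>auto intro: eventually_mono[OF eventually_gt_at_top[of 0]]\<close>)
      then show "\<phi> u \<le> ?q * K" by simp
    qed
  qed
  have bound: "\<forall>u\<ge>0. \<phi> u \<le> ?q ^ n * C" for n
  proof (induction n)
    case 0
    then show ?case using C by (auto intro: abs_le_D1)
  next
    case (Suc n)
    then show ?case using improve[OF Suc] by (simp add: mult_ac)
  qed
  have "(\<lambda>n. ?q ^ n * C) \<longlonglongrightarrow> 0 * C"
    by (intro tendsto_mult tendsto_const LIMSEQ_power_zero) (use q in auto)
  then have "\<phi> u \<le> 0 * C"
    by (rule LIMSEQ_le_const) (use bound \<open>0 \<le> u\<close> in auto)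
  with nonneg[OF \<open>0 \<le> u\<close>] show ?thesis by simp
qed

text \<open>The limit of the survival probabilities is a bounded fixed point of \<open>killed\<close>.\<close>
lemma survival_tendsto_0:
  assumes "0 \<le> s"
  shows "(\<lambda>n. (killed ^^ n) (\<lambda>_. 1) s) \<longlonglongrightarrow> 0"
proof -
  define a where "a n = (killed ^^ n) (\<lambda>_. 1)" for n
  have bb: "bounded_borel (a n)" for n unfolding a_def by auto
  have a_Suc: "a (Suc n) = killed (a n)" for n by (simp add: a_def)
  have nonneg: "0 \<le> a n x" for n x
    by (induction n arbitrary: x) (auto simp: a_def intro: killed_nonneg)
  have dec: "a (Suc n) x \<le> a n x" for n x
  proof (induction n arbitrary: x)
    case 0
    show ?case using tail_pos[of x] by (simp add: a_def killed_const)
  next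
    case (Suc n)
    have "killed (a (Suc n)) x \<le> killed (a n) x"
      by (rule killed_mono[OF bb bb Suc])
    then show ?case by (simp only: a_Suc)
  qed
  have le1: "a n x \<le> 1" for n x
  proof (induction n)
    case (Suc n)
    then show ?case by (rule order_trans[OF dec])
  qed (simp add: a_def)
  define e where "e x = lim (\<lambda>n. a n x)" for x
  have lim: "(\<lambda>n. a n x) \<longlonglongrightarrow> e x" for x
  proof -
    have "convergent (\<lambda>n. a n x)"
      by (intro Bseq_monoseq_convergent decseq_imp_monoseq decseq_SucI dec BseqI'[of _ 1])
         (use nonneg le1 in auto)
    then show ?thesis unfolding e_def by (simp add: convergent_LIMSEQ_iff)
  qed
  have [measurable]: "a n \<in> borel_measurable borel" for n using bb by (rule bounded_borel_measurable)
  have e_meas: "e \<in> borel_measurable borel"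
    by (rule borel_measurable_LIMSEQ_metric[where f = a]) (auto intro: lim)
  have e_bounds: "0 \<le> e x" "e x \<le> 1" for x
    using nonneg le1 by (auto intro: LIMSEQ_le_const[OF lim] LIMSEQ_le_const2[OF lim])
  have "e s = 0"
  proof (rule bounded_subharmonic_zero[of e s])
    show "bounded_borel e" using e_meas e_bounds by (intro bounded_borelI[of _ 1]) auto
    show "e u \<le> killed e u" for u
    proof -
      have "(\<lambda>n. killed (a n) u) \<longlonglongrightarrow> killed e u"
        by (rule killed_tendsto[OF bb _ lim e_meas, of 1]) (use nonneg le1 in auto)
      moreover have "(\<lambda>n. killed (a n) u) \<longlonglongrightarrow> e u"
        using LIMSEQ_Suc[OF lim[of u]] by (simp add: a_Suc)
      ultimately have "killed e u = e u" by (rule LIMSEQ_unique)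
      then show ?thesis by simp
    qed
  qed (use e_bounds assms in auto)
  then show ?thesis using lim[of s] by (simp add: a_def)
qed

section \<open>Green functions\<close>

text \<open>For \<open>\<theta> = 1\<close> this is the expected sum of \<open>\<psi>\<close> along the killed walk started at distance \<open>s\<close>;
  for \<open>\<theta> = - 1\<close> the visits are counted with the sign given by the parity of their time.\<close>
definition green :: "real \<Rightarrow> (real \<Rightarrow> real) \<Rightarrow> real \<Rightarrow> real" where
  "green \<theta> \<psi> s = (\<Sum>n. \<theta> ^ n * (killed ^^ n) \<psi> s)"

lemma killed_funpow_nonneg:
  assumes "\<And>x. 0 \<le> \<phi> x"
  shows "0 \<le> (killed ^^ n) \<phi> s"
  by (induction n arbitrary: s) (use assms in \<open>auto intro: killed_nonneg\<close>)

lemma tail_series_sums_1: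
  assumes "0 \<le> s"
  shows "(\<lambda>n. (killed ^^ n) tail s) sums 1"
  unfolding sums_def sum_killed_tail
  using tendsto_diff[OF tendsto_const[of 1] survival_tendsto_0[OF assms]] by simp

lemma sum_killed_tail_le_1: "(\<Sum>n<m. (killed ^^ n) tail s) \<le> 1"
  unfolding sum_killed_tail by (simp add: killed_funpow_nonneg)

lemma summable_killed_tail: "summable (\<lambda>n. (killed ^^ n) tail s)"
  by (rule summableI_nonneg_bounded[of _ 1])
     (auto intro: killed_funpow_nonneg sum_killed_tail_le_1 less_imp_le[OF tail_pos])

lemma suminf_killed_tail_le_1: "(\<Sum>n. (killed ^^ n) tail s) \<le> 1"
  by (rule suminf_le_const[OF summable_killed_tail sum_killed_tail_le_1])

text \<open>The tail sums to at most one along the killed walk, so domination by the tail is the natural condition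
  for the Green series to converge, with the dominating constant as a bound for its value.\<close>
locale tail_dominated =
  fixes \<psi> :: "real \<Rightarrow> real" and C :: real
  assumes bb: "bounded_borel \<psi>" and dom: "\<And>x. \<bar>\<psi> x\<bar> \<le> C * tail x"
begin

lemma C_nonneg: "0 \<le> C"
  using order_trans[OF abs_ge_zero dom[of 0]] tail_pos[of 0] by (simp add: zero_le_mult_iff)

lemma term_le: "\<bar>(killed ^^ n) \<psi> s\<bar> \<le> C * (killed ^^ n) tail s"
  using killed_funpow_abs_le[OF bb bounded_borel_cmult[OF bounded_borel_tail] dom]
  by (simp add: killed_funpow_cmult)

lemma summable_abs: "summable (\<lambda>n. \<bar>(killed ^^ n) \<psi> s\<bar>)"
  by (rule summable_comparison_test[OF _ summable_mult[OF summable_killed_tail]])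
     (use term_le in auto)

lemma summable_signed:
  assumes "\<bar>\<theta>\<bar> \<le> 1"
  shows "summable (\<lambda>n. \<theta> ^ n * (killed ^^ n) \<psi> s)"
proof (rule summable_comparison_test[OF _ summable_abs], intro exI allI impI)
  fix n
  have "\<bar>\<theta> ^ n\<bar> \<le> 1" using assms by (simp add: power_abs power_le_one)
  then show "norm (\<theta> ^ n * (killed ^^ n) \<psi> s) \<le> \<bar>(killed ^^ n) \<psi> s\<bar>"
    by (simp add: abs_mult mult_left_le_one_le)
qed

lemma partial_sum_le:
  assumes "\<bar>\<theta>\<bar> \<le> 1"
  shows "\<bar>\<Sum>n<m. \<theta> ^ n * (killed ^^ n) \<psi> s\<bar> \<le> C"
proof -
  have "\<bar>\<Sum>n<m. \<theta> ^ n * (killed ^^ n) \<psi> s\<bar> \<le> (\<Sum>n<m. \<bar>\<theta> ^ n * (killed ^^ n) \<psi> s\<bar>)"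
    by (rule sum_abs)
  also have "\<dots> \<le> (\<Sum>n<m. C * (killed ^^ n) tail s)"
  proof (rule sum_mono)
    fix n
    have "\<bar>\<theta> ^ n\<bar> \<le> 1" using assms by (simp add: power_abs power_le_one)
    then have "\<bar>\<theta> ^ n * (killed ^^ n) \<psi> s\<bar> \<le> \<bar>(killed ^^ n) \<psi> s\<bar>"
      by (simp add: abs_mult mult_left_le_one_le)
    then show "\<bar>\<theta> ^ n * (killed ^^ n) \<psi> s\<bar> \<le> C * (killed ^^ n) tail s"
      using term_le by (rule order_trans)
  qed
  also have "\<dots> = C * (\<Sum>n<m. (killed ^^ n) tail s)" by (simp add: sum_distrib_left)
  also have "\<dots> \<le> C" using C_nonneg sum_killed_tail_le_1 by (intro mult_left_le) auto
  finally show ?thesis .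
qed

lemma green_LIMSEQ:
  assumes "\<bar>\<theta>\<bar> \<le> 1"
  shows "(\<lambda>m. \<Sum>n<m. \<theta> ^ n * (killed ^^ n) \<psi> s) \<longlonglongrightarrow> green \<theta> \<psi> s"
  unfolding green_def by (rule summable_LIMSEQ[OF summable_signed[OF assms]])

lemma bounded_borel_partial_sum: "bounded_borel (\<lambda>s. \<Sum>n<m. \<theta> ^ n * (killed ^^ n) \<psi> s)"
  by (induction m) (auto intro!: bounded_borel_add bounded_borel_cmult bb)

lemma green_bound:
  assumes "\<bar>\<theta>\<bar> \<le> 1"
  shows "\<bar>green \<theta> \<psi> s\<bar> \<le> C"
  by (rule LIMSEQ_le_const2[OF tendsto_rabs[OF green_LIMSEQ[OF assms]]])
     (use partial_sum_le[OF assms] in auto)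

lemma bounded_borel_green:
  assumes "\<bar>\<theta>\<bar> \<le> 1"
  shows "bounded_borel (green \<theta> \<psi>)"
proof (rule bounded_borelI[OF _ green_bound[OF assms]])
  show "green \<theta> \<psi> \<in> borel_measurable borel"
    by (rule borel_measurable_LIMSEQ_metric[OF bounded_borel_measurable[OF bounded_borel_partial_sum]])
       (rule green_LIMSEQ[OF assms])
qed

text \<open>The partial sums satisfy the equation up to a shift of the index, and dominated convergence carries it
  to the limit.\<close>
lemma green_equation:
  assumes "\<bar>\<theta>\<bar> \<le> 1"
  shows "green \<theta> \<psi> s = \<psi> s + \<theta> * killed (green \<theta> \<psi>) s"
proof -
  let ?P = "\<lambda>m s. \<Sum>n<m. \<theta> ^ n * (killed ^^ n) \<psi> s"
  have rec: "killed (?P m) s = (\<Sum>n<m. \<theta> ^ n * (killed ^^ Suc n) \<psi> s)" for m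
  proof (induction m)
    case (Suc m)
    have "killed (?P (Suc m)) s = killed (?P m) s + killed (\<lambda>s. \<theta> ^ m * (killed ^^ m) \<psi> s) s"
      unfolding sum.lessThan_Suc
      by (rule killed_add[OF bounded_borel_partial_sum bounded_borel_cmult[OF bounded_borel_funpow[OF bb]]])
    then show ?case using Suc by (simp add: killed_cmult)
  qed simp
  have "?P (Suc m) s = \<psi> s + \<theta> * killed (?P m) s" for m
    unfolding rec by (subst sum.lessThan_Suc_shift) (simp add: sum_distrib_left mult_ac)
  moreover have "(\<lambda>m. \<psi> s + \<theta> * killed (?P m) s) \<longlonglongrightarrow> \<psi> s + \<theta> * killed (green \<theta> \<psi>) s"
    by (intro tendsto_intros killed_tendsto[of _ C] bounded_borel_partial_sum partial_sum_le[OF assms]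
        green_LIMSEQ[OF assms] bounded_borel_measurable[OF bounded_borel_green[OF assms]])
  ultimately have "(\<lambda>m. ?P (Suc m) s) \<longlonglongrightarrow> \<psi> s + \<theta> * killed (green \<theta> \<psi>) s" by simp
  with LIMSEQ_Suc[OF green_LIMSEQ[OF assms, of s]] show ?thesis by (rule LIMSEQ_unique)
qed

end

section \<open>A slowly decreasing supersolution\<close>

abbreviation tower :: real where "tower \<equiv> exp (exp 1)"

text \<open>A supersolution must lose less by its convexity than it gains from the mass lost at the edge. At
  distance \<open>u\<close> the convexity of a slowly varying function enters with the truncated second moment
  of the step, which grows like \<open>ln u\<close>. For an iterated logarithm the second derivative times
  \<open>ln u\<close> is smaller than the function itself divided by \<open>u^2\<close>, whereas the loss at the edge is
  the function times \<open>1 / (4 * u^2)\<close>. The shift by \<open>tower\<close> makes both logarithms at least one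
  on the half-line.\<close>
definition slow :: "real \<Rightarrow> real" where
  "slow u = 1 / ln (ln (max 0 u + tower))"

lemma log_ge_1:
  assumes "0 \<le> x"
  shows "1 \<le> ln (x + tower)" "1 \<le> ln (ln (x + tower))"
proof -
  have "ln tower \<le> ln (x + tower)" using assms by (subst ln_le_cancel_iff) (auto intro: add_nonneg_pos)
  then have *: "exp 1 \<le> ln (x + tower)" by simp
  moreover have "1 \<le> exp (1::real)" by simp
  ultimately show "1 \<le> ln (x + tower)" by linarith
  have "ln (exp 1) \<le> ln (ln (x + tower))"
    using * by (subst ln_le_cancel_iff) (auto intro: less_le_trans[OF exp_gt_zero])
  then show "1 \<le> ln (ln (x + tower))" by simp
qed

lemma slow_pos: "0 < slow u" and slow_le_1: "slow u \<le> 1"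
  using log_ge_1(2)[of "max 0 u"] by (auto simp: slow_def)

lemma slow_antimono:
  assumes "x \<le> y" shows "slow y \<le> slow x"
proof -
  have m: "max 0 x \<le> max 0 y" using assms by auto
  have "ln (max 0 x + tower) \<le> ln (max 0 y + tower)"
    using m by (subst ln_le_cancel_iff) (auto intro: add_nonneg_pos)
  then have "ln (ln (max 0 x + tower)) \<le> ln (ln (max 0 y + tower))"
    using log_ge_1(1)[of "max 0 x"] log_ge_1(1)[of "max 0 y"] by (subst ln_le_cancel_iff) auto
  then show ?thesis unfolding slow_def
    using log_ge_1(2)[of "max 0 x"] by (intro divide_left_mono) auto
qed

lemma bounded_borel_slow [intro]: "bounded_borel slow"
proof (rule bounded_borelI)
  show "slow \<in> borel_measurable borel" unfolding slow_def[abs_def] by measurable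
  show "\<bar>slow x\<bar> \<le> 1" for x using slow_pos[of x] slow_le_1[of x] by simp
qed

lemma slow_tendsto_0: "(slow \<longlongrightarrow> 0) at_top"
proof -
  have "((\<lambda>u. 1 / ln (ln (u + tower))) \<longlongrightarrow> 0) at_top" by real_asymp
  moreover have "\<forall>\<^sub>F u in at_top. 1 / ln (ln (u + tower)) = slow u"
    using eventually_ge_at_top[of 0] by eventually_elim (simp add: slow_def)
  ultimately show ?thesis by (rule Lim_transform_eventually)
qed

text \<open>A bound for the second derivative of \<open>slow\<close> to the right of \<open>u / 2\<close>.\<close>
definition slow_curv :: "real \<Rightarrow> real" where
  "slow_curv u = 4 / ((u / 2 + tower)\<^sup>2 * ln (u / 2 + tower) * (ln (ln (u / 2 + tower)))\<^sup>2)"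

lemma slow_curv_nonneg: "0 \<le> u \<Longrightarrow> 0 \<le> slow_curv u"
  using log_ge_1[of "u / 2"] by (auto simp: slow_curv_def intro!: divide_nonneg_nonneg mult_nonneg_nonneg)

text \<open>Two applications of the mean value theorem to the function and one to its derivative.\<close>
lemma slow_second_difference:
  assumes u: "0 \<le> u" and y: "0 \<le> y" "y \<le> u / 2"
  shows "slow (u - y) + slow (u + y) - 2 * slow u \<le> 2 * slow_curv u * y\<^sup>2"
proof (cases "y = 0")
  case False
  then have y0: "0 < y" using y by simp
  define w where "w x = 1 / ln (ln (x + tower))" for x :: real
  define p where "p x = 1 / ((x + tower) * ln (x + tower) * (ln (ln (x + tower)))\<^sup>2)" for x :: real
  define p' where "p' x = (ln (x + tower) * (ln (ln (x + tower)))\<^sup>2 + (ln (ln (x + tower)))\<^sup>2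
      + 2 * ln (ln (x + tower))) / ((x + tower) * ln (x + tower) * (ln (ln (x + tower)))\<^sup>2)\<^sup>2" for x :: real
  have w: "(w has_real_derivative - p x) (at x)" if "0 \<le> x" for x
  proof -
    have "1 < tower" by simp
    with that have "1 < x + tower" by linarith
    then show ?thesis using log_ge_1[OF that] unfolding w_def p_def
      by (auto intro!: derivative_eq_intros simp: field_simps power2_eq_square)
  qed
  have p: "(p has_real_derivative - p' x) (at x)" if "0 \<le> x" for x
  proof -
    let ?q = "\<lambda>x. (x + tower) * ln (x + tower) * (ln (ln (x + tower)))\<^sup>2"
    let ?q' = "ln (x + tower) * (ln (ln (x + tower)))\<^sup>2 + (ln (ln (x + tower)))\<^sup>2 + 2 * ln (ln (x + tower))"
    have "1 < tower" by simp
    with that have z: "1 < x + tower" by linarith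
    have "(?q has_real_derivative ?q') (at x)"
      using z log_ge_1[OF that]
      by (auto intro!: derivative_eq_intros simp: divide_simps) (simp add: algebra_simps power2_eq_square)
    moreover have "0 < ?q x"
      using z log_ge_1[OF that] by (intro mult_pos_pos zero_less_power) linarith+
    ultimately
    have "((\<lambda>x. inverse (?q x)) has_real_derivative - (inverse (?q x) * ?q' * inverse (?q x))) (at x)"
      by (intro DERIV_inverse') auto
    moreover have "- (inverse (?q x) * ?q' * inverse (?q x)) = - p' x"
      unfolding p'_def divide_inverse power2_eq_square[of "?q x"] inverse_mult_distrib
      by (simp only: mult_ac)
    ultimately show ?thesis unfolding p_def by (simp only: inverse_eq_divide)
  qed
  have p'_le: "p' x \<le> slow_curv u" if "u / 2 \<le> x" for x
  proof -
    have x: "0 \<le> x" using that u by simp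
    define z L N where "z = x + tower" and "L = ln z" and "N = ln L"
    define z0 L0 N0 where "z0 = u / 2 + tower" and "L0 = ln z0" and "N0 = ln L0"
    have LN: "1 \<le> L" "1 \<le> N" using log_ge_1[OF x] by (simp_all add: z_def L_def N_def)
    have LN0: "1 \<le> L0" "1 \<le> N0" using log_ge_1[of "u / 2"] u by (simp_all add: z0_def L0_def N0_def)
    have z0: "0 < z0" "z0 \<le> z" using u that by (auto simp: z0_def z_def add_nonneg_pos)
    have "L0 \<le> L" unfolding L0_def L_def using z0 by (subst ln_le_cancel_iff) auto
    moreover have "N0 \<le> N" unfolding N0_def N_def using \<open>L0 \<le> L\<close> LN LN0 by (subst ln_le_cancel_iff) auto
    ultimately have den: "z0\<^sup>2 * L0 * N0\<^sup>2 \<le> z\<^sup>2 * L * N\<^sup>2"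
      using z0 LN LN0 by (intro mult_mono power_mono) auto
    have "1 * N\<^sup>2 \<le> L * N\<^sup>2" using LN by (intro mult_right_mono) auto
    moreover have "1 * N \<le> (L * N) * N" using mult_mono[OF LN] LN by (intro mult_right_mono) auto
    ultimately have "L * N\<^sup>2 + N\<^sup>2 + 2 * N \<le> 4 * (L * N\<^sup>2)" by (simp add: power2_eq_square)
    then have "p' x \<le> 4 * (L * N\<^sup>2) / (z * L * N\<^sup>2)\<^sup>2"
      unfolding p'_def z_def[symmetric] L_def[symmetric] N_def[symmetric]
      by (intro divide_right_mono) auto
    also have "\<dots> = 4 / (z\<^sup>2 * L * N\<^sup>2)"
      using z0 LN by (simp add: power2_eq_square)
    also have "\<dots> \<le> 4 / (z0\<^sup>2 * L0 * N0\<^sup>2)"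
      using den z0 LN LN0 by (intro divide_left_mono) auto
    finally show ?thesis by (simp add: slow_curv_def z0_def L0_def N0_def)
  qed
  obtain a where a: "u - y < a" "a < u" "w u - w (u - y) = (u - (u - y)) * - p a"
    using MVT2[of "u - y" u w "\<lambda>x. - p x"] w y0 y by auto
  obtain b where b: "u < b" "b < u + y" "w (u + y) - w u = (u + y - u) * - p b"
    using MVT2[of u "u + y" w "\<lambda>x. - p x"] w y0 y by auto
  obtain d where d: "a < d" "d < b" "p b - p a = (b - a) * - p' d"
    using MVT2[of a b p "\<lambda>x. - p' x"] p a b y by auto
  have "p a - p b = (b - a) * p' d" using d(3) by (simp add: algebra_simps)
  also have "\<dots> \<le> (b - a) * slow_curv u"
    using p'_le[of d] a b d y by (intro mult_left_mono) auto
  also have "\<dots> \<le> (2 * y) * slow_curv u"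
    using a b slow_curv_nonneg[OF u] by (intro mult_right_mono) auto
  finally have "y * (p a - p b) \<le> y * (2 * y * slow_curv u)"
    using y by (intro mult_left_mono) auto
  moreover have "slow (u - y) + slow (u + y) - 2 * slow u = w (u - y) + w (u + y) - 2 * w u"
    using y u by (simp add: slow_def w_def)
  ultimately show ?thesis using a(3) b(3) by (simp add: algebra_simps power2_eq_square)
qed simp

text \<open>The density times the square of its argument is at most half the derivative of \<open>arsinh\<close>.\<close>
lemma step_law_truncated_second_moment:
  assumes "0 \<le> z"
  shows "(LINT x|step_law. indicator {0..z} x * x\<^sup>2) \<le> arsinh z / 2"
proof -
  have "(\<integral>\<^sup>+x. ennreal (indicator {0..z} x * x\<^sup>2) \<partial>step_law)
      = (\<integral>\<^sup>+x. ennreal (step_density x) * ennreal (indicator {0..z} x * x\<^sup>2) \<partial>lborel)"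
    unfolding step_law_def by (rule nn_integral_density) auto
  also have "\<dots> \<le> (\<integral>\<^sup>+x. ennreal (1 / (2 * sqrt (x\<^sup>2 + 1))) * indicator {0..z} x \<partial>lborel)"
  proof (rule nn_integral_mono)
    fix x :: real
    have "step_density x * x\<^sup>2 = x\<^sup>2 / (1 + x\<^sup>2) * (1 / (2 * sqrt (x\<^sup>2 + 1)))"
      by (simp add: step_density_def add.commute)
    also have "\<dots> \<le> 1 * (1 / (2 * sqrt (x\<^sup>2 + 1)))"
      using one_plus_square_pos[of x] by (intro mult_right_mono) auto
    finally show "ennreal (step_density x) * ennreal (indicator {0..z} x * x\<^sup>2)
        \<le> ennreal (1 / (2 * sqrt (x\<^sup>2 + 1))) * indicator {0..z} x"
      using less_imp_le[OF step_density_pos[of x]]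
      by (auto simp: indicator_def ennreal_leI simp flip: ennreal_mult')
  qed
  also have "\<dots> = ennreal (arsinh z / 2 - arsinh 0 / 2)"
  proof (rule nn_integral_FTC_Icc[where F = "\<lambda>x. arsinh x / 2"])
    show "((\<lambda>x. arsinh x / 2) has_real_derivative 1 / (2 * sqrt (x\<^sup>2 + 1))) (at x)" for x :: real
      by (auto intro!: derivative_eq_intros)
  qed (use assms in auto)
  finally have "(\<integral>\<^sup>+x. ennreal (indicator {0..z} x * x\<^sup>2) \<partial>step_law) \<le> ennreal (arsinh z / 2)"
    by simp
  moreover have "1 \<le> sqrt (z\<^sup>2 + 1)" by simp
  then have "0 \<le> arsinh z" using assms unfolding arsinh_real_def by (intro ln_ge_zero) linarith
  ultimately have "enn2real (\<integral>\<^sup>+x. ennreal (indicator {0..z} x * x\<^sup>2) \<partial>step_law) \<le> arsinh z / 2"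
    by (intro enn2real_leI) auto
  moreover have "(LINT x|step_law. indicator {0..z} x * x\<^sup>2)
      = enn2real (\<integral>\<^sup>+x. ennreal (indicator {0..z} x * x\<^sup>2) \<partial>step_law)"
    by (rule integral_eq_nn_integral) auto
  ultimately show ?thesis by simp
qed

lemma tail_asymptotics: "((\<lambda>u. u\<^sup>2 * tail u) \<longlongrightarrow> 1 / 4) at_top"
  unfolding tail_def by real_asymp

lemma tail_ratio:
  assumes "0 < c"
  shows "((\<lambda>u. tail (u / c) / tail u) \<longlongrightarrow> c\<^sup>2) at_top"
proof -
  have lim: "filterlim (\<lambda>u. u / c) at_top at_top"
    using assms filterlim_tendsto_pos_mult_at_top[OF tendsto_const, of "1 / c" "\<lambda>u. u" at_top]
    by (simp add: filterlim_ident)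
  have "((\<lambda>u. c\<^sup>2 * ((u / c)\<^sup>2 * tail (u / c)) / (u\<^sup>2 * tail u)) \<longlongrightarrow> c\<^sup>2 * (1 / 4) / (1 / 4)) at_top"
    by (intro tendsto_intros tail_asymptotics filterlim_compose[OF tail_asymptotics lim]) auto
  then have "((\<lambda>u. c\<^sup>2 * ((u / c)\<^sup>2 * tail (u / c)) / (u\<^sup>2 * tail u)) \<longlongrightarrow> c\<^sup>2) at_top" by simp
  moreover have "\<forall>\<^sub>F u in at_top. c\<^sup>2 * ((u / c)\<^sup>2 * tail (u / c)) / (u\<^sup>2 * tail u) = tail (u / c) / tail u"
    using eventually_gt_at_top[of 0] by eventually_elim (use assms in \<open>simp add: power_divide\<close>)
  ultimately show ?thesis by (rule Lim_transform_eventually)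
qed

text \<open>The three terms on the left come from jumps up to half the distance, from longer jumps that stay at
  least \<open>sqrt u\<close> away from the edge, and from jumps that land within \<open>sqrt u\<close> of the edge. After
  multiplication by \<open>u^2 * ln (ln (u + tower))\<close> each of them tends to zero, while the right-hand
  side tends to 1/4.\<close>
lemma slow_drift_margin:
  "\<forall>\<^sub>F u in at_top. slow_curv u * arsinh (u / 2) + (slow (sqrt u) - slow u) * tail (u / 2)
     + (tail (u - sqrt u) - tail u) \<le> slow u * tail u"
proof -
  let ?M = "\<lambda>u. ln (ln (u + tower))"
  have c1: "((\<lambda>u. u\<^sup>2 / (u / 2 + tower)\<^sup>2) \<longlongrightarrow> 4) at_top"
  proof -
    have "((\<lambda>u. u / (u / 2 + tower)) \<longlongrightarrow> 2) at_top" by real_asymp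
    from tendsto_power[OF this, of 2] show ?thesis by (simp add: power_divide)
  qed
  have c2: "((\<lambda>u. ?M u / (?M (u / 2))\<^sup>2) \<longlongrightarrow> 0) at_top" by real_asymp
  have c3: "((\<lambda>u::real. arsinh (u / 2) / ln (u / 2 + tower)) \<longlongrightarrow> 1) at_top"
    unfolding arsinh_real_def by real_asymp
  have "((\<lambda>u. 4 * (u\<^sup>2 / (u / 2 + tower)\<^sup>2) * (?M u / (?M (u / 2))\<^sup>2) * (arsinh (u / 2) / ln (u / 2 + tower)))
      \<longlongrightarrow> 4 * 4 * 0 * 1) at_top"
    by (intro tendsto_intros c1 c2 c3)
  then have t1: "((\<lambda>u. u\<^sup>2 * ?M u * (slow_curv u * arsinh (u / 2))) \<longlongrightarrow> 0) at_top"
    by (simp add: slow_curv_def mult_ac)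
  have d1: "((\<lambda>u. (1 / ?M (sqrt u) - 1 / ?M u) * ?M u) \<longlongrightarrow> 0) at_top" by real_asymp
  have d2: "((\<lambda>u. u\<^sup>2 * tail (u / 2)) \<longlongrightarrow> 4 * (1 / 4)) at_top"
  proof -
    have "filterlim (\<lambda>u::real. u / 2) at_top at_top" by real_asymp
    from tendsto_mult[OF tendsto_const[of 4] filterlim_compose[OF tail_asymptotics this]]
    show ?thesis by (simp add: power_divide)
  qed
  have "((\<lambda>u. (1 / ?M (sqrt u) - 1 / ?M u) * ?M u * (u\<^sup>2 * tail (u / 2))) \<longlongrightarrow> 0 * (4 * (1 / 4))) at_top"
    by (intro tendsto_mult d1 d2)
  then have t2: "((\<lambda>u. u\<^sup>2 * ?M u * ((1 / ?M (sqrt u) - 1 / ?M u) * tail (u / 2))) \<longlongrightarrow> 0) at_top"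
    by (simp add: mult_ac)
  have e1: "((\<lambda>u. u powr (1/4) * u\<^sup>2 * (tail (u - sqrt u) - tail u)) \<longlongrightarrow> 0) at_top"
    unfolding tail_def by real_asymp
  have e2: "((\<lambda>u. ?M u / u powr (1/4)) \<longlongrightarrow> 0) at_top" by real_asymp
  have "((\<lambda>u. ?M u / u powr (1/4) * (u powr (1/4) * u\<^sup>2 * (tail (u - sqrt u) - tail u))) \<longlongrightarrow> 0 * 0) at_top"
    by (intro tendsto_mult e1 e2)
  then have "((\<lambda>u. u\<^sup>2 * ?M u * (slow_curv u * arsinh (u / 2))
      + u\<^sup>2 * ?M u * ((1 / ?M (sqrt u) - 1 / ?M u) * tail (u / 2))
      + ?M u / u powr (1/4) * (u powr (1/4) * u\<^sup>2 * (tail (u - sqrt u) - tail u))) \<longlongrightarrow> 0 + 0 + 0 * 0) at_top"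
    by (intro tendsto_add t1 t2)
  moreover have "0 + 0 + 0 * 0 < (1 / 8 :: real)" by simp
  ultimately have small: "\<forall>\<^sub>F u in at_top. u\<^sup>2 * ?M u * (slow_curv u * arsinh (u / 2))
      + u\<^sup>2 * ?M u * ((1 / ?M (sqrt u) - 1 / ?M u) * tail (u / 2))
      + ?M u / u powr (1/4) * (u powr (1/4) * u\<^sup>2 * (tail (u - sqrt u) - tail u)) < 1 / 8"
    by (rule order_tendstoD)
  have large: "\<forall>\<^sub>F u in at_top. 1 / 8 < u\<^sup>2 * tail u"
    by (rule order_tendstoD[OF tail_asymptotics]) simp
  show ?thesis
    using small large eventually_gt_at_top[of 0]
  proof eventually_elim
    case (elim u)
    define N where "N = ?M u"
    have N: "1 \<le> N" using log_ge_1(2)[of u] elim(3) by (simp add: N_def)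
    have su: "slow u = 1 / N" "slow (sqrt u) = 1 / ?M (sqrt u)"
      using elim(3) by (simp_all add: slow_def N_def)
    let ?lhs = "slow_curv u * arsinh (u / 2) + (slow (sqrt u) - slow u) * tail (u / 2)
     + (tail (u - sqrt u) - tail u)"
    have "N / u powr (1/4) * (u powr (1/4) * u\<^sup>2 * (tail (u - sqrt u) - tail u))
        = u\<^sup>2 * N * (tail (u - sqrt u) - tail u)"
      using elim(3) by simp
    then have "u\<^sup>2 * N * ?lhs < 1 / 8"
      using elim(1) unfolding N_def[symmetric] su by (simp only: distrib_left)
    also have "1 / 8 < u\<^sup>2 * tail u" by (rule elim(2))
    also have "\<dots> = u\<^sup>2 * N * (slow u * tail u)" using N by (simp add: su)
    finally show ?case using elim(3) N by (simp add: mult_less_cancel_left_pos)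
  qed
qed

lemma killed_slow_le: "\<forall>\<^sub>F u in at_top. killed slow u \<le> slow u"
  using slow_drift_margin eventually_ge_at_top[of 1]
proof eventually_elim
  case (elim u)
  then have u: "1 \<le> u" by simp
  have sq: "0 \<le> sqrt u" "sqrt u \<le> u" using u by (auto intro: real_le_lsqrt simp: power2_eq_square)
  define \<delta> where "\<delta> = slow (sqrt u) - slow u"
  have \<delta>: "0 \<le> \<delta>" unfolding \<delta>_def using slow_antimono[OF sq(2)] by simp
  define B where "B = slow_curv u"
  have B: "0 \<le> B" unfolding B_def using slow_curv_nonneg u by simp
  \<comment> \<open>A one-sided lower bound for the symmetric second difference, split at half the distance and at
      distance \<open>sqrt u\<close> from the edge.\<close>
  define h where "h x = indicator {u<..} x * slow u - 2 * B * (indicator {0..u / 2} x * x\<^sup>2)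
      - indicator {u / 2<..} x * \<delta> - indicator {u - sqrt u<..u} x" for x :: real
  let ?g = "\<lambda>x. 2 * slow u - indicator {..u} x * slow (u - x) - indicator {..u} (- x) * slow (u + x)"
  have int_i: "integrable step_law (\<lambda>x. indicator A x * c)" if "A \<in> sets borel" for A and c :: real
    by (rule integrable_step_law_bounded[of _ "\<bar>c\<bar>"]) (use that in \<open>auto simp: indicator_def\<close>)
  have int_q: "integrable step_law (\<lambda>x. 2 * B * (indicator {0..u / 2} x * x\<^sup>2))"
  proof (rule integrable_mult_right, rule integrable_step_law_bounded[of _ "(u / 2)\<^sup>2"])
    show "\<bar>indicator {0..u / 2} x * x\<^sup>2\<bar> \<le> (u / 2)\<^sup>2" for x
      using power_mono[of x "u / 2" 2] by (simp add: indicator_def)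
  qed auto
  have int_3: "integrable step_law (indicator {u - sqrt u<..u} :: real \<Rightarrow> real)"
    by (rule integrable_step_law_bounded[of _ 1]) (auto simp: indicator_def)
  have int_h: "integrable step_law h" unfolding h_def
    by (intro Bochner_Integration.integrable_diff int_i int_q int_3) auto
  have [measurable]: "h \<in> borel_measurable borel" unfolding h_def by measurable
  have int_h': "integrable step_law (\<lambda>x. h (- x))"
  proof -
    have "integrable (distr step_law borel uminus) h" using int_h by (simp only: step_law_symmetric)
    then show ?thesis by (subst (asm) integrable_distr_eq) auto
  qed
  have le_pos: "h x \<le> ?g x" if x: "0 \<le> x" for x
  proof -
    have up: "slow (u + x) \<le> slow u" using slow_antimono[of u "u + x"] x by simp
    consider "u < x" | "x \<le> u / 2" | "u / 2 < x" "x \<le> u - sqrt u" | "u / 2 < x" "u - sqrt u < x" "x \<le> u"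
      by linarith
    then show ?thesis
    proof cases
      case 1
      then show ?thesis using up \<delta> x u by (simp add: h_def indicator_def)
    next
      case 2
      then show ?thesis using slow_second_difference[of u x] x u
        by (simp add: h_def indicator_def B_def)
    next
      case 3
      have "slow (u - x) \<le> slow (sqrt u)" by (rule slow_antimono) (use 3 in simp)
      moreover have "x \<le> u" "\<not> u < x" using 3 sq by linarith+
      ultimately show ?thesis using up 3 x by (simp add: h_def indicator_def \<delta>_def)
    next
      case 4
      then show ?thesis using up \<delta> x slow_le_1[of "u - x"] slow_pos[of u] by (simp add: h_def indicator_def)
    qed
  qed
  have neg: "h x \<le> 0" if "x \<le> 0" for x
    using that u sq B by (auto simp: h_def indicator_def)
  have le: "h x + h (- x) \<le> ?g x" for x
  proof (cases "0 \<le> x")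
    case True
    then show ?thesis using le_pos[of x] neg[of "- x"] by simp
  next
    case False
    then show ?thesis using le_pos[of "- x"] neg[of x] by simp
  qed
  have "(LINT x|step_law. h x) = slow u * tail u - 2 * B * (LINT x|step_law. indicator {0..u / 2} x * x\<^sup>2)
      - \<delta> * tail (u / 2) - (tail (u - sqrt u) - tail u)"
  proof -
    have eq: "measure step_law {u - sqrt u<..u} = tail (u - sqrt u) - tail u"
    proof -
      have "{u - sqrt u<..u} = {u - sqrt u<..} - {u<..}" using sq by auto
      then show ?thesis using sq
        by (simp add: step_law.finite_measure_Diff measure_step_law_greaterThan)
    qed
    have "(LINT x|step_law. h x) = (LINT x|step_law. indicator {u<..} x * slow u)
        - (LINT x|step_law. 2 * B * (indicator {0..u / 2} x * x\<^sup>2))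
        - (LINT x|step_law. indicator {u / 2<..} x * \<delta>) - (LINT x|step_law. indicator {u - sqrt u<..u} x)"
      unfolding h_def
      by (simp only: Bochner_Integration.integral_diff Bochner_Integration.integrable_diff
          int_i int_q int_3 greaterThan_borel)
    then show ?thesis by (simp add: eq measure_step_law_greaterThan mult.commute)
  qed
  moreover have "2 * B * (LINT x|step_law. indicator {0..u / 2} x * x\<^sup>2) \<le> 2 * B * (arsinh (u / 2) / 2)"
    using step_law_truncated_second_moment[of "u / 2"] u B by (intro mult_left_mono) auto
  ultimately have "0 \<le> 2 * (LINT x|step_law. h x)"
    using elim(1) by (simp add: B_def \<delta>_def)
  also have "\<dots> = (LINT x|step_law. h x + h (- x))"
    using int_h int_h' integral_step_law_reflect[of h]
    by (subst Bochner_Integration.integral_add) auto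
  also have "\<dots> \<le> (LINT x|step_law. ?g x)"
    by (rule integral_mono[OF Bochner_Integration.integrable_add[OF int_h int_h']
          integrable_drift[OF bounded_borel_slow] le])
  also have "\<dots> = 2 * (slow u - killed slow u)"
    by (subst killed_drift[OF bounded_borel_slow]) simp
  finally show ?case by simp
qed


section \<open>The walk avoids the neighbourhood of the edge\<close>

text \<open>Beyond \<open>A'\<close> the occupation function is a fixed point of \<open>killed\<close> and a multiple of \<open>slow\<close> is a
  supersolution; up to \<open>A'\<close> the multiple can be chosen to dominate. By
  \<open>bounded_subharmonic_zero\<close> it then dominates everywhere, and \<open>slow\<close> vanishes at infinity.\<close>
lemma green_near_boundary:
  "\<exists>A'\<ge>A. (green 1 (indicator {..A'}) \<longlongrightarrow> 0) at_top \<and> 0 \<le> A'"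
proof -
  obtain A0 where A0: "\<And>u. A0 \<le> u \<Longrightarrow> killed slow u \<le> slow u"
    using killed_slow_le unfolding eventually_at_top_linorder by blast
  define A' where "A' = max 0 (max A A0)"
  define K where "K = 1 / tail A'"
  have K: "0 < K" using tail_pos[of A'] by (simp add: K_def)
  let ?\<psi> = "indicator {..A'} :: real \<Rightarrow> real"
  interpret tail_dominated ?\<psi> K
  proof
    show "bounded_borel ?\<psi>" by auto
    show "\<bar>?\<psi> x\<bar> \<le> K * tail x" for x
      using tail_antimono[of x A'] tail_pos[of A'] tail_pos[of x] by (auto simp: indicator_def K_def divide_simps)
  qed
  let ?g = "green 1 ?\<psi>"
  have g_nonneg: "0 \<le> ?g s" for s
    unfolding green_def by (rule suminf_nonneg[OF summable_signed]) (auto intro!: killed_funpow_nonneg)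
  have bb_g: "bounded_borel ?g" by (rule bounded_borel_green) simp
  define k where "k = K / slow A'"
  have k: "0 < k" using K slow_pos[of A'] by (simp add: k_def)
  let ?e = "\<lambda>u. ?g u - k * slow u"
  have bb_e: "bounded_borel ?e" by (intro bounded_borel_diff bounded_borel_cmult bb_g bounded_borel_slow)
  have le: "?g u \<le> k * slow u" if u: "0 \<le> u" for u
  proof -
    have "max 0 (?e u) = 0"
    proof (rule bounded_subharmonic_zero[of "\<lambda>u. max 0 (?e u)" u])
      show "bounded_borel (\<lambda>u. max 0 (?e u))" by (rule bounded_borel_max0[OF bb_e])
      fix u :: real assume u: "0 \<le> u"
      have kd: "0 \<le> killed (\<lambda>u. max 0 (?e u)) u" by (rule killed_nonneg) auto
      show "max 0 (?e u) \<le> killed (\<lambda>u. max 0 (?e u)) u"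
      proof (cases "u \<le> A'")
        case True
        have "?g u \<le> K" using green_bound[of 1 u] by simp
        also have "K = k * slow A'" using slow_pos[of A'] by (simp add: k_def)
        also have "\<dots> \<le> k * slow u" using slow_antimono[OF True] k by (intro mult_left_mono) auto
        finally show ?thesis using kd by simp
      next
        case False
        then have "killed slow u \<le> slow u" by (intro A0) (simp add: A'_def)
        then have "k * killed slow u \<le> k * slow u" using k by simp
        moreover have "?g u = killed ?g u" using green_equation[of 1 u] False by simp
        ultimately have "?e u \<le> killed ?g u - killed (\<lambda>u. k * slow u) u" by (simp add: killed_cmult)
        also have "\<dots> = killed ?e u"
          by (rule killed_diff[symmetric, OF bb_g bounded_borel_cmult[OF bounded_borel_slow]])
        also have "\<dots> \<le> killed (\<lambda>u. max 0 (?e u)) u"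
          by (rule killed_mono[OF bb_e bounded_borel_max0[OF bb_e]]) auto
        finally show ?thesis using kd by simp
      qed
    qed (use u in auto)
    then show ?thesis by (simp add: max_def split: if_splits)
  qed
  have "(?g \<longlongrightarrow> 0) at_top"
  proof (rule tendsto_sandwich[OF _ _ tendsto_const])
    show "((\<lambda>u. k * slow u) \<longlongrightarrow> 0) at_top"
      using tendsto_mult[OF tendsto_const[of k] slow_tendsto_0] by simp
    show "\<forall>\<^sub>F u in at_top. ?g u \<le> k * slow u"
      using eventually_ge_at_top[of 0] by eventually_elim (rule le)
  qed (simp add: g_nonneg)
  then show ?thesis by (intro exI[of _ A']) (auto simp: A'_def)
qed

text \<open>Split at a distance beyond which the function is at most a small multiple of the tail. The far part
  contributes at most that multiple, the near part is controlled by \<open>green_near_boundary\<close>.\<close>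
lemma green_small_relative_to_tail:
  assumes "tail_dominated \<rho> C" and small: "((\<lambda>u. \<rho> u / tail u) \<longlongrightarrow> 0) at_top"
  shows "(green 1 \<rho> \<longlongrightarrow> 0) at_top"
proof (rule tendstoI)
  interpret tail_dominated \<rho> C by fact
  fix \<epsilon> :: real assume \<epsilon>: "0 < \<epsilon>"
  have "\<forall>\<^sub>F u in at_top. \<bar>\<rho> u / tail u\<bar> < \<epsilon> / 2"
    using tendstoD[OF small, of "\<epsilon> / 2"] \<epsilon> by (simp add: dist_real_def)
  then obtain A where A: "\<And>u. A \<le> u \<Longrightarrow> \<bar>\<rho> u / tail u\<bar> < \<epsilon> / 2"
    unfolding eventually_at_top_linorder by blast
  obtain A' where A': "A \<le> A'" "(green 1 (indicator {..A'}) \<longlongrightarrow> 0) at_top" "0 \<le> A'"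
    using green_near_boundary[of A] by blast
  let ?i = "indicator {..A'} :: real \<Rightarrow> real"
  interpret I: tail_dominated ?i "1 / tail A'"
  proof
    show "\<bar>?i x\<bar> \<le> 1 / tail A' * tail x" for x
      using tail_antimono[of x A'] tail_pos[of A'] tail_pos[of x] by (auto simp: indicator_def divide_simps)
  qed auto
  have dom: "\<bar>\<rho> x\<bar> \<le> \<epsilon> / 2 * tail x + C * ?i x" for x
  proof (cases "x \<le> A'")
    case True
    have "\<bar>\<rho> x\<bar> \<le> C * tail x" by (rule local.dom)
    also have "\<dots> \<le> C" using C_nonneg tail_le_1[of x] by (simp add: mult_left_le)
    finally show ?thesis using True \<epsilon> tail_pos[of x] by (simp add: indicator_def add_increasing)
  next
    case False
    then have "\<bar>\<rho> x / tail x\<bar> < \<epsilon> / 2" using A' by (intro A) auto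
    then show ?thesis using False tail_pos[of x] by (simp add: indicator_def abs_divide divide_less_eq)
  qed
  have bound: "\<bar>green 1 \<rho> s\<bar> \<le> \<epsilon> / 2 + C * green 1 ?i s" for s
  proof -
    have t: "\<bar>(killed ^^ n) \<rho> s\<bar> \<le> \<epsilon> / 2 * (killed ^^ n) tail s + C * (killed ^^ n) ?i s" for n
    proof -
      have b1: "bounded_borel (\<lambda>x. \<epsilon> / 2 * tail x)" and b2: "bounded_borel (\<lambda>x. C * ?i x)"
        by (intro bounded_borel_cmult bounded_borel_tail bounded_borel_indicator; simp)+
      have "\<bar>(killed ^^ n) \<rho> s\<bar> \<le> (killed ^^ n) (\<lambda>x. \<epsilon> / 2 * tail x + C * ?i x) s"
        by (rule killed_funpow_abs_le[OF bb bounded_borel_add[OF b1 b2] dom])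
      then show ?thesis
        by (simp only: killed_funpow_add[OF b1 b2] killed_funpow_cmult)
    qed
    have sI: "summable (\<lambda>n. (killed ^^ n) ?i s)" using I.summable_signed[of 1 s] by simp
    have "\<bar>green 1 \<rho> s\<bar> \<le> (\<Sum>n. \<bar>(killed ^^ n) \<rho> s\<bar>)"
      unfolding green_def using summable_rabs[OF summable_abs] by simp
    also have "\<dots> \<le> (\<Sum>n. \<epsilon> / 2 * (killed ^^ n) tail s + C * (killed ^^ n) ?i s)"
      by (intro suminf_le t summable_abs summable_add summable_mult summable_killed_tail sI)
    also have "\<dots> = \<epsilon> / 2 * (\<Sum>n. (killed ^^ n) tail s) + C * (\<Sum>n. (killed ^^ n) ?i s)"
      by (subst suminf_add[symmetric])
         (intro summable_mult summable_killed_tail sI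
           | simp only: suminf_mult[OF summable_killed_tail] suminf_mult[OF sI])+
    also have "\<dots> \<le> \<epsilon> / 2 * 1 + C * (\<Sum>n. (killed ^^ n) ?i s)"
      using suminf_killed_tail_le_1[of s] \<epsilon> by (intro add_right_mono mult_left_mono) auto
    finally show ?thesis by (simp add: green_def)
  qed
  have "((\<lambda>s. C * green 1 ?i s) \<longlongrightarrow> C * 0) at_top"
    by (intro tendsto_intros A'(2))
  then have "\<forall>\<^sub>F s in at_top. C * green 1 ?i s < \<epsilon> / 2"
    by (rule order_tendstoD) (use \<epsilon> in simp)
  then show "\<forall>\<^sub>F s in at_top. dist (green 1 \<rho> s) 0 < \<epsilon>"
  proof eventually_elim
    case (elim s)
    then show ?case using bound[of s] by (simp add: dist_real_def)
  qed
qed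

section \<open>Asymptotic independence of the parity\<close>

text \<open>The common part of one and two steps contains a multiple of the uniform law on the window between \<open>s\<close> and
  \<open>s + 1\<close>, which is reachable in either number of steps because the density is bounded below near 0.\<close>
definition window :: "(real \<Rightarrow> real) \<Rightarrow> real \<Rightarrow> real" where
  "window \<phi> s = (LINT x|lborel. indicator {s..s + 1} x * \<phi> x)"

lemma integrable_window:
  assumes "bounded_borel \<phi>"
  shows "integrable lborel (\<lambda>x. indicator {s..s + 1} x * \<phi> x)"
proof -
  note [measurable] = assms[THEN bounded_borel_measurable]
  obtain C where C: "0 \<le> C" "\<And>x. \<bar>\<phi> x\<bar> \<le> C" using assms by (meson bounded_borelE)
  have "integrable lborel (\<lambda>x. indicator {s..s + 1} x *\<^sub>R C)" by (rule integrable_scaleR_left) simp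
  then show ?thesis
    by (rule Bochner_Integration.integrable_bound) (use C in \<open>auto simp: indicator_def\<close>)
qed

lemma killed_ge_window:
  assumes \<phi>: "bounded_borel \<phi>" and nonneg: "\<And>x. 0 \<le> x \<Longrightarrow> 0 \<le> \<phi> x"
    and s: "0 \<le> s" and z: "z \<in> {s..s + 1}"
  shows "step_density 1 * window \<phi> s \<le> killed \<phi> z"
proof -
  note [measurable] = \<phi>[THEN bounded_borel_measurable]
  obtain C where C: "0 \<le> C" "\<And>x. \<bar>\<phi> x\<bar> \<le> C" using \<phi> by (meson bounded_borelE)
  let ?f = "\<lambda>x. step_density x * (indicator {..z} x * \<phi> (z - x))"
  have [measurable]: "?f \<in> borel_measurable borel" by measurable
  have int: "integrable lborel ?f"
    using integrable_killed[OF \<phi>, of z] less_imp_le[OF step_density_pos] unfolding step_law_def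
    by (subst (asm) integrable_density) auto
  have "integrable lborel (\<lambda>y. ?f (z + (- 1) * y))"
    by (rule lborel_integrable_real_affine[OF int]) simp
  moreover have eq: "?f (z + (- 1) * y) = step_density (z - y) * (indicator {0..} y * \<phi> y)" for y
    by (auto simp: indicator_def)
  ultimately have int': "integrable lborel (\<lambda>y. step_density (z - y) * (indicator {0..} y * \<phi> y))"
    by (simp only: eq)
  have int'': "integrable lborel (\<lambda>x. step_density 1 * (indicator {s..s + 1} x * \<phi> x))"
    by (intro integrable_mult_right integrable_window \<phi>)
  have "step_density 1 * window \<phi> s
      = (LINT x|lborel. step_density 1 * (indicator {s..s + 1} x * \<phi> x))" by (simp add: window_def)
  also have "\<dots> \<le> (LINT y|lborel. step_density (z - y) * (indicator {0..} y * \<phi> y))"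
  proof (rule integral_mono[OF int'' int'])
    fix y :: real
    show "step_density 1 * (indicator {s..s + 1} y * \<phi> y) \<le> step_density (z - y) * (indicator {0..} y * \<phi> y)"
    proof (cases "y \<in> {s..s + 1}")
      case True
      then have "\<bar>z - y\<bar> \<le> 1" "0 \<le> y" using s z by auto
      then show ?thesis using step_density_ge_near_0[of "z - y"] nonneg[of y] True
        by (auto intro!: mult_right_mono)
    next
      case False
      then show ?thesis using nonneg[of y] less_imp_le[OF step_density_pos[of "z - y"]]
        by (auto simp: indicator_def)
    qed
  qed
  also have "\<dots> = (LINT x|lborel. ?f x)"
    using lborel_integral_real_affine[of "- 1" ?f z] by (simp only: eq) simp
  also have "\<dots> = killed \<phi> z"
    unfolding killed_def step_law_def using less_imp_le[OF step_density_pos]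
    by (subst integral_density) auto
  finally show ?thesis .
qed


lemma window_add:
  assumes "bounded_borel \<phi>" "bounded_borel \<psi>"
  shows "window (\<lambda>x. \<phi> x + \<psi> x) s = window \<phi> s + window \<psi> s"
  unfolding window_def distrib_left
  by (intro Bochner_Integration.integral_add integrable_window assms)

lemma window_diff:
  assumes "bounded_borel \<phi>" "bounded_borel \<psi>"
  shows "window (\<lambda>x. \<phi> x - \<psi> x) s = window \<phi> s - window \<psi> s"
  unfolding window_def right_diff_distrib
  by (intro Bochner_Integration.integral_diff integrable_window assms)

lemma window_ge_const:
  assumes "bounded_borel \<phi>" "\<And>x. s \<le> x \<Longrightarrow> L \<le> \<phi> x"
  shows "L \<le> window \<phi> s"
proof -
  have "(LINT x|lborel. indicator {s..s + 1} x * L) \<le> window \<phi> s"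
    unfolding window_def
    by (intro integral_mono integrable_window assms) (auto simp: indicator_def assms(2))
  then show ?thesis by simp
qed

lemma step_density_1_le_1: "step_density 1 \<le> 1"
proof -
  have "1 \<le> 4 * sqrt (2 :: real)" using real_sqrt_ge_1_iff[of 2] by linarith
  then show ?thesis by (simp add: step_density_def)
qed

lemma killed2_ge_window:
  assumes \<phi>: "bounded_borel \<phi>" and nonneg: "\<And>x. 0 \<le> x \<Longrightarrow> 0 \<le> \<phi> x" and s: "0 \<le> s"
  shows "(step_density 1)\<^sup>2 * window \<phi> s \<le> killed (killed \<phi>) s"
proof -
  have d: "0 < step_density 1" by (rule step_density_pos)
  let ?m = "step_density 1 * window \<phi> s"
  have "0 \<le> killed \<phi> x" for x by (rule killed_nonneg[OF nonneg])
  then have "step_density 1 * window (killed \<phi>) s \<le> killed (killed \<phi>) s"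
    by (intro killed_ge_window bounded_borel_killed \<phi>) (use s in auto)
  moreover have "?m \<le> window (killed \<phi>) s"
  proof -
    have "(LINT x|lborel. indicator {s..s + 1} x * ?m) \<le> window (killed \<phi>) s"
      unfolding window_def[of "killed \<phi>"]
      by (intro integral_mono integrable_window[of "\<lambda>_. ?m"] integrable_window bounded_borel_killed \<phi>)
         (use killed_ge_window[OF \<phi> nonneg s] in \<open>auto simp: indicator_def\<close>)
    then show ?thesis by simp
  qed
  then have "step_density 1 * ?m \<le> step_density 1 * window (killed \<phi>) s"
    using d by (intro mult_left_mono) auto
  ultimately show ?thesis by (simp add: power2_eq_square mult.assoc)
qed

text \<open>A positive operator dominating \<open>c\<close> times the window average leaves a positive operator after
  subtraction of it, so \<open>\<psi>\<close> still controls \<open>\<phi>\<close>.\<close>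
lemma dominated_difference:
  assumes \<phi>: "bounded_borel \<phi>" and \<psi>: "bounded_borel \<psi>" and dom: "\<And>x. 0 \<le> x \<Longrightarrow> \<bar>\<phi> x\<bar> \<le> \<psi> x"
    and add: "K (\<lambda>x. \<psi> x + \<phi> x) s = K \<psi> s + K \<phi> s"
    and diff: "K (\<lambda>x. \<psi> x - \<phi> x) s = K \<psi> s - K \<phi> s"
    and minor: "\<And>\<eta>. bounded_borel \<eta> \<Longrightarrow> (\<And>x. 0 \<le> x \<Longrightarrow> 0 \<le> \<eta> x) \<Longrightarrow> c * window \<eta> s \<le> K \<eta> s"
  shows "\<bar>K \<phi> s - c * window \<phi> s\<bar> \<le> K \<psi> s - c * window \<psi> s"
proof -
  have "c * window (\<lambda>x. \<psi> x + \<phi> x) s \<le> K (\<lambda>x. \<psi> x + \<phi> x) s"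
  proof (rule minor[OF bounded_borel_add[OF \<psi> \<phi>]])
    show "0 \<le> \<psi> x + \<phi> x" if "0 \<le> x" for x using dom[OF that] by linarith
  qed
  moreover have "c * window (\<lambda>x. \<psi> x - \<phi> x) s \<le> K (\<lambda>x. \<psi> x - \<phi> x) s"
  proof (rule minor[OF bounded_borel_diff[OF \<psi> \<phi>]])
    show "0 \<le> \<psi> x - \<phi> x" if "0 \<le> x" for x using dom[OF that] by linarith
  qed
  ultimately show ?thesis
    unfolding add diff window_add[OF \<psi> \<phi>] window_diff[OF \<psi> \<phi>]
    by (simp add: abs_le_iff algebra_simps)
qed

text \<open>The window averages in one and in two steps cancel, which saves the factor
  \<open>1 - (step_density 1)^2\<close>. The function \<open>\<eta>\<close> is an error that vanishes at infinity in the
  application.\<close>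
lemma alternating_contraction:
  assumes \<Phi>: "bounded_borel \<Phi>" and L: "0 \<le> L" and \<eta>: "bounded_borel \<eta>" "\<And>x. 0 \<le> \<eta> x"
    and dom: "\<And>x. 0 \<le> x \<Longrightarrow> \<bar>\<Phi> x\<bar> \<le> L + \<eta> x" and s: "0 \<le> s"
  shows "\<bar>killed (killed \<Phi>) s - killed \<Phi> s\<bar>
    \<le> 2 * (1 - (step_density 1)\<^sup>2) * L + killed \<eta> s + killed (killed \<eta>) s"
proof -
  let ?c = "(step_density 1)\<^sup>2" and ?\<psi> = "\<lambda>x. L + \<eta> x"
  have \<psi>: "bounded_borel ?\<psi>" using \<eta>(1) by auto
  have d: "0 \<le> step_density 1" "step_density 1 \<le> 1"
    using less_imp_le[OF step_density_pos] step_density_1_le_1 by auto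
  have c: "0 \<le> ?c" "?c \<le> step_density 1" using d by (auto simp: power2_eq_square mult_left_le)
  have "\<bar>killed \<Phi> s - ?c * window \<Phi> s\<bar> \<le> killed ?\<psi> s - ?c * window ?\<psi> s"
  proof (rule dominated_difference[OF \<Phi> \<psi> dom])
    fix \<eta> :: "real \<Rightarrow> real" assume \<eta>: "bounded_borel \<eta>" "\<And>x. 0 \<le> x \<Longrightarrow> 0 \<le> \<eta> x"
    have "0 \<le> window \<eta> s" by (rule window_ge_const[OF \<eta>(1)]) (use \<eta>(2) s in auto)
    then have "?c * window \<eta> s \<le> step_density 1 * window \<eta> s" using c by (intro mult_right_mono) auto
    also have "\<dots> \<le> killed \<eta> s" by (rule killed_ge_window[OF \<eta> s]) auto
    finally show "?c * window \<eta> s \<le> killed \<eta> s" .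
  qed (use \<Phi> \<psi> in \<open>auto simp: killed_add killed_diff\<close>)
  moreover have "\<bar>killed (killed \<Phi>) s - ?c * window \<Phi> s\<bar> \<le> killed (killed ?\<psi>) s - ?c * window ?\<psi> s"
  proof (rule dominated_difference[where K = "\<lambda>\<phi>. killed (killed \<phi>)", OF \<Phi> \<psi> dom])
    have *: "killed (\<lambda>x. ?\<psi> x + \<Phi> x) = (\<lambda>x. killed ?\<psi> x + killed \<Phi> x)"
      "killed (\<lambda>x. ?\<psi> x - \<Phi> x) = (\<lambda>x. killed ?\<psi> x - killed \<Phi> x)"
      using killed_add[OF \<psi> \<Phi>] killed_diff[OF \<psi> \<Phi>] by blast+
    show "killed (killed (\<lambda>x. ?\<psi> x + \<Phi> x)) s = killed (killed ?\<psi>) s + killed (killed \<Phi>) s"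
      "killed (killed (\<lambda>x. ?\<psi> x - \<Phi> x)) s = killed (killed ?\<psi>) s - killed (killed \<Phi>) s"
      unfolding * using \<Phi> \<psi> by (simp_all add: killed_add killed_diff bounded_borel_killed)
  qed (use killed2_ge_window[OF _ _ s] in auto)
  moreover have "?c * L \<le> ?c * window ?\<psi> s"
    by (intro mult_left_mono window_ge_const \<psi> c(1)) (simp add: \<eta>(2))
  moreover have k1: "killed ?\<psi> x \<le> L + killed \<eta> x" for x
    using killed_add[OF bounded_borel_const \<eta>(1), of L x] L tail_pos[of x]
    by (simp add: killed_const mult_left_le)
  moreover have "killed (killed ?\<psi>) s \<le> L + killed (killed \<eta>) s"
  proof -
    have "killed (killed ?\<psi>) s \<le> killed (\<lambda>x. L + killed \<eta> x) s"
      by (rule killed_mono) (use \<psi> \<eta> k1 in auto)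
    also have "\<dots> \<le> L + killed (killed \<eta>) s"
      using killed_add[OF bounded_borel_const bounded_borel_killed[OF \<eta>(1)], of L s] L tail_pos[of s]
      by (simp add: killed_const mult_left_le)
    finally show ?thesis .
  qed
  moreover have "\<bar>killed (killed \<Phi>) s - killed \<Phi> s\<bar>
      \<le> \<bar>killed (killed \<Phi>) s - ?c * window \<Phi> s\<bar> + \<bar>killed \<Phi> s - ?c * window \<Phi> s\<bar>" by linarith
  ultimately have "\<bar>killed (killed \<Phi>) s - killed \<Phi> s\<bar>
      \<le> 2 * L - 2 * (?c * L) + killed \<eta> s + killed (killed \<eta>) s" using k1[of s] by linarith
  then show ?thesis by (simp add: algebra_simps)
qed

text \<open>The signed potential changes sign under \<open>killed\<close> up to the error \<open>r\<close>. It is therefore the average of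
  minus its first and plus its second image, again up to an error that vanishes at infinity, and
  \<open>alternating_contraction\<close> shrinks any asymptotic bound by a fixed factor below one.\<close>
lemma alternating_green_tendsto_0:
  assumes "tail_dominated r C"
  shows "(green (- 1) r \<longlongrightarrow> 0) at_top"
proof -
  interpret tail_dominated r C by fact
  define \<Phi> where "\<Phi> = green (- 1) r"
  have bb_\<Phi>: "bounded_borel \<Phi>" unfolding \<Phi>_def by (rule bounded_borel_green) simp
  have eq: "\<Phi> s = r s - killed \<Phi> s" for s
    unfolding \<Phi>_def using green_equation[of "- 1" s] by simp
  have eq2: "2 * \<Phi> s = 2 * r s - killed r s + (killed (killed \<Phi>) s - killed \<Phi> s)" for s
  proof -
    have "killed \<Phi> s = killed (\<lambda>x. r x - killed \<Phi> x) s"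
      by (rule arg_cong[where f = "\<lambda>\<phi>. killed \<phi> s"]) (use eq in blast)
    also have "\<dots> = killed r s - killed (killed \<Phi>) s"
      by (rule killed_diff) (use bb bb_\<Phi> in auto)
    finally show ?thesis using eq[of s] by simp
  qed
  define q where "q = 1 - (step_density 1)\<^sup>2"
  have d: "0 < step_density 1" "step_density 1 \<le> 1"
    using step_density_pos step_density_1_le_1 by auto
  then have q: "0 \<le> q" "q < 1" using power_le_one[of "step_density 1" 2] by (auto simp: q_def)
  have r0: "(r \<longlongrightarrow> 0) at_top"
  proof (rule Lim_null_comparison)
    show "\<forall>\<^sub>F x in at_top. norm (r x) \<le> C * tail x" using dom by simp
    show "((\<lambda>x. C * tail x) \<longlongrightarrow> 0) at_top" using tendsto_mult[OF tendsto_const[of C] tail_tendsto_0] by simp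
  qed
  \<comment> \<open>The asymptotic bound after \<open>n\<close> rounds, with an error that vanishes at infinity.\<close>
  have claim: "\<exists>\<eta>. bounded_borel \<eta> \<and> (\<forall>x. 0 \<le> \<eta> x) \<and> (\<eta> \<longlongrightarrow> 0) at_top \<and> (\<forall>x\<ge>0. \<bar>\<Phi> x\<bar> \<le> q ^ n * C + \<eta> x)" for n
  proof (induction n)
    case 0
    show ?case
      by (rule exI[of _ "\<lambda>_. 0"]) (use green_bound[of "- 1"] in \<open>auto simp: \<Phi>_def\<close>)
  next
    case (Suc n)
    then obtain \<eta> where \<eta>: "bounded_borel \<eta>" "\<And>x. 0 \<le> \<eta> x" "(\<eta> \<longlongrightarrow> 0) at_top"
      "\<And>x. 0 \<le> x \<Longrightarrow> \<bar>\<Phi> x\<bar> \<le> q ^ n * C + \<eta> x" by blast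
    let ?\<eta>' = "\<lambda>x. \<bar>r x\<bar> + 1 / 2 * \<bar>killed r x\<bar> + 1 / 2 * (killed \<eta> x + killed (killed \<eta>) x)"
    have L: "0 \<le> q ^ n * C" using q C_nonneg by simp
    have "bounded_borel ?\<eta>'"
      by (intro bounded_borel_add bounded_borel_cmult bounded_borel_abs bounded_borel_killed bb \<eta>(1))
    moreover have "\<forall>x. 0 \<le> ?\<eta>' x"
      using \<eta>(2) by (auto intro!: add_nonneg_nonneg killed_nonneg)
    moreover have "(?\<eta>' \<longlongrightarrow> \<bar>0\<bar> + 1 / 2 * \<bar>0\<bar> + 1 / 2 * (0 + 0)) at_top"
      by (intro tendsto_intros r0 killed_tendsto_0_at_top bounded_borel_killed bb \<eta>)
    moreover have "\<bar>\<Phi> x\<bar> \<le> q ^ Suc n * C + ?\<eta>' x" if "0 \<le> x" for x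
    proof -
      have "\<bar>killed (killed \<Phi>) x - killed \<Phi> x\<bar> \<le> 2 * q * (q ^ n * C) + killed \<eta> x + killed (killed \<eta>) x"
        unfolding q_def by (rule alternating_contraction[OF bb_\<Phi> _ \<eta>(1,2) _ that])
          (use L \<eta>(4) in \<open>simp_all add: q_def\<close>)
      then have "\<bar>2 * \<Phi> x\<bar> \<le> 2 * \<bar>r x\<bar> + \<bar>killed r x\<bar> + 2 * q * (q ^ n * C) + killed \<eta> x + killed (killed \<eta>) x"
        unfolding eq2 by linarith
      then show ?thesis by (simp add: abs_mult field_simps)
    qed
    ultimately show ?case by (intro exI[of _ ?\<eta>']) simp
  qed
  have "(\<Phi> \<longlongrightarrow> 0) at_top"
  proof (rule tendstoI)
    fix \<epsilon> :: real assume \<epsilon>: "0 < \<epsilon>"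
    have "(\<lambda>n. q ^ n * C) \<longlonglongrightarrow> 0 * C"
      by (intro tendsto_mult tendsto_const LIMSEQ_power_zero) (use q in auto)
    then have "\<forall>\<^sub>F n in sequentially. q ^ n * C < \<epsilon> / 2"
      by (rule order_tendstoD) (use \<epsilon> in simp)
    then obtain n where n: "q ^ n * C < \<epsilon> / 2" by (auto simp: eventually_sequentially)
    obtain \<eta> where \<eta>: "(\<eta> \<longlongrightarrow> 0) at_top" "\<And>x. 0 \<le> x \<Longrightarrow> \<bar>\<Phi> x\<bar> \<le> q ^ n * C + \<eta> x"
      using claim[of n] by blast
    have "\<forall>\<^sub>F x in at_top. \<eta> x < \<epsilon> / 2"
      by (rule order_tendstoD[OF \<eta>(1)]) (use \<epsilon> in simp)
    then show "\<forall>\<^sub>F x in at_top. dist (\<Phi> x) 0 < \<epsilon>"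
      using eventually_ge_at_top[of 0]
    proof eventually_elim
      case (elim x)
      then show ?case using \<eta>(2)[of x] n by (simp add: dist_real_def)
    qed
  qed
  then show ?thesis by (simp add: \<Phi>_def)
qed

section \<open>The walk and its passage\<close>

definition alive :: "(nat \<Rightarrow> 'a \<Rightarrow> real) \<Rightarrow> real \<Rightarrow> nat \<Rightarrow> 'a \<Rightarrow> bool" where
  "alive \<Theta> s n \<omega> \<longleftrightarrow> (\<forall>k\<in>{1..n}. walk \<Theta> k \<omega> \<le> s)"

text \<open>The exiting step is the one with index \<open>Suc n\<close>, so an even \<open>n\<close> means an upward exit.\<close>
definition exits :: "(nat \<Rightarrow> 'a \<Rightarrow> real) \<Rightarrow> real \<Rightarrow> nat \<Rightarrow> 'a \<Rightarrow> bool" where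
  "exits \<Theta> s n \<omega> \<longleftrightarrow> alive \<Theta> s n \<omega> \<and> s < walk \<Theta> (Suc n) \<omega>"

lemma walk_0 [simp]: "walk \<Theta> 0 \<omega> = 0"
  by (simp add: walk_def)

lemma walk_Suc: "walk \<Theta> (Suc n) \<omega> = walk \<Theta> n \<omega> + step \<Theta> (Suc n) \<omega>"
  by (simp add: walk_def)

lemma alive_0 [simp]: "alive \<Theta> s 0 \<omega>"
  by (simp add: alive_def)

lemma alive_Suc: "alive \<Theta> s (Suc n) \<omega> \<longleftrightarrow> alive \<Theta> s n \<omega> \<and> walk \<Theta> (Suc n) \<omega> \<le> s"
  by (auto simp: alive_def le_Suc_eq)

lemma alive_walk_le: "alive \<Theta> s n \<omega> \<Longrightarrow> 0 \<le> s \<Longrightarrow> walk \<Theta> n \<omega> \<le> s"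
  by (cases n) (auto simp: alive_def)

lemma exits_passage_time:
  assumes "exits \<Theta> s n \<omega>"
  shows "passage_time \<Theta> s \<omega> = Suc n"
proof -
  have "(LEAST m. m \<in> {m. 0 < m \<and> s < walk \<Theta> m \<omega>}) = Suc n"
  proof (rule Least_equality)
    show "Suc n \<in> {m. 0 < m \<and> s < walk \<Theta> m \<omega>}" using assms by (simp add: exits_def)
    fix m assume m: "m \<in> {m. 0 < m \<and> s < walk \<Theta> m \<omega>}"
    show "Suc n \<le> m"
    proof (rule ccontr)
      assume "\<not> Suc n \<le> m"
      then have "m \<in> {1..n}" using m by auto
      with assms have "walk \<Theta> m \<omega> \<le> s" by (simp only: exits_def alive_def)
      with m show False by simp
    qed
  qed
  then show ?thesis by (simp add: passage_time_def Inf_nat_def)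
qed

lemma exits_unique: "exits \<Theta> s n \<omega> \<Longrightarrow> exits \<Theta> s m \<omega> \<Longrightarrow> n = m"
  using exits_passage_time[of \<Theta> s n \<omega>] exits_passage_time[of \<Theta> s m \<omega>] by simp

lemma exits_crosses: "exits \<Theta> s n \<omega> \<Longrightarrow> \<exists>n>0. s < walk \<Theta> n \<omega>"
  by (auto simp: exits_def)

text \<open>The unspecified values outside the crossing case do not depend on the endpoints, which is
  what measurability on the exceptional null set relies on.\<close>
lemma crossing_height:
  fixes a b c d :: real
  shows "(THE y. (0, y) \<in> closed_segment (a, c) (b, d)) =
    (if a = b then (if a = 0 then THE y. (0, y) \<in> closed_segment (0, c) (0 :: real, d) else THE y. False)
     else if 0 \<le> - a / (b - a) \<and> - a / (b - a) \<le> 1 then (1 - - a / (b - a)) * c + - a / (b - a) * d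
     else THE y. False)"
proof -
  have *: "(0, y) \<in> closed_segment (a, c) (b, d) \<longleftrightarrow>
      (\<exists>u. 0 \<le> u \<and> u \<le> 1 \<and> (1 - u) * a + u * b = 0 \<and> y = (1 - u) * c + u * d)" for y
    by (auto simp: closed_segment_def)
  let ?P = "\<lambda>y. (0, y) \<in> closed_segment (a, c) (b, d)" and ?u = "- a / (b - a)"
  consider "a = b" "a = 0" | "a = b" "a \<noteq> 0" | "a \<noteq> b" "0 \<le> ?u \<and> ?u \<le> 1" | "a \<noteq> b" "\<not> (0 \<le> ?u \<and> ?u \<le> 1)"
    by blast
  then show ?thesis
  proof cases
    case 1
    then have "a = 0" "b = 0" by auto
    then show ?thesis by (simp only: if_True simp_thms)
  next
    case 2
    have "?P = (\<lambda>_. False)"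
    proof
      fix y
      have "(1 - u) * a + u * b = a" for u using 2 by (simp add: algebra_simps)
      then show "?P y = False" unfolding * using 2(2) by simp
    qed
    then show ?thesis using 2 by (simp only: if_True if_False simp_thms)
  next
    case 3
    have root: "(1 - u) * a + u * b = 0 \<longleftrightarrow> u = ?u" for u
      using 3(1) by (auto simp: field_simps)
    have "?P = (\<lambda>y. y = (1 - ?u) * c + ?u * d)"
      unfolding * root using 3(2) by blast
    then have "(THE y. ?P y) = (1 - ?u) * c + ?u * d" by (simp only: the_eq_trivial)
    then show ?thesis using 3 by (simp only: if_True if_False simp_thms)
  next
    case 4
    have root: "(1 - u) * a + u * b = 0 \<longleftrightarrow> u = ?u" for u
      using 4(1) by (auto simp: field_simps)
    have "?P = (\<lambda>_. False)"
      unfolding * root using 4(2) by blast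
    then show ?thesis using 4 by (simp only: if_False simp_thms)
  qed
qed

lemma exits_exit_height:
  assumes e: "exits \<Theta> s n \<omega>" and s: "0 < s"
  shows "exit_height \<Theta> s \<omega> = (if even n then (s - walk \<Theta> n \<omega>) / step \<Theta> (Suc n) \<omega>
      else 1 - (s - walk \<Theta> n \<omega>) / step \<Theta> (Suc n) \<omega>)"
    and "exit_height \<Theta> s \<omega> \<in> {0..1}"
    and "step \<Theta> (Suc n) \<omega> > s - walk \<Theta> n \<omega>" "s - walk \<Theta> n \<omega> \<ge> 0"
proof -
  define U X where "U = s - walk \<Theta> n \<omega>" and "X = step \<Theta> (Suc n) \<omega>"
  have U: "0 \<le> U" using alive_walk_le[of \<Theta> s n \<omega>] e s by (simp add: U_def exits_def)
  have X: "U < X" using e by (simp add: exits_def walk_Suc U_def X_def)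
  have ratio: "0 \<le> U / X" "U / X \<le> 1" using U X by auto
  have "exit_height \<Theta> s \<omega> = (THE y. (0, y) \<in> closed_segment (- U, (1 - (-1) ^ n) / 2) (X - U, (1 - (-1) ^ Suc n) / 2))"
    unfolding exit_height_def Let_def exits_passage_time[OF e] diff_Suc_1 ray_vertex_def walk_Suc
    by (simp add: U_def X_def algebra_simps)
  also have "\<dots> = (1 - U / X) * ((1 - (-1) ^ n) / 2) + U / X * ((1 - (-1) ^ Suc n) / 2)"
    by (subst crossing_height) (use U X ratio in simp)
  also have "\<dots> = (if even n then U / X else 1 - U / X)" by simp
  finally have eq: "exit_height \<Theta> s \<omega> = (if even n then U / X else 1 - U / X)" .
  then show "exit_height \<Theta> s \<omega> = (if even n then (s - walk \<Theta> n \<omega>) / step \<Theta> (Suc n) \<omega>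
      else 1 - (s - walk \<Theta> n \<omega>) / step \<Theta> (Suc n) \<omega>)"
    by (simp add: U_def X_def)
  show "exit_height \<Theta> s \<omega> \<in> {0..1}" using eq ratio by simp
  show "step \<Theta> (Suc n) \<omega> > s - walk \<Theta> n \<omega>" "s - walk \<Theta> n \<omega> \<ge> 0"
    using U X by (simp_all add: U_def X_def)
qed

locale lambertian_ray = prob_space M for M :: "'a measure" +
  fixes \<Theta> :: "nat \<Rightarrow> 'a \<Rightarrow> real"
  assumes indep: "indep_vars (\<lambda>_. borel) \<Theta> {1..}"
    and angle_law: "\<And>n. n \<ge> 1 \<Longrightarrow>
           distributed M lborel (\<Theta> n)
             (\<lambda>\<theta>. ennreal (indicator {- (pi / 2) <..< pi / 2} \<theta> * (cos \<theta> / 2)))"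
begin

lemma angle_measurable: "n \<ge> 1 \<Longrightarrow> \<Theta> n \<in> borel_measurable M"
  using distributed_measurable[OF angle_law] by simp

lemma tan_measurable [measurable]: "(tan :: real \<Rightarrow> real) \<in> borel_measurable borel"
  unfolding tan_def[abs_def] by measurable

lemma step_measurable: "n \<ge> 1 \<Longrightarrow> step \<Theta> n \<in> borel_measurable M"
  using measurable_compose[OF angle_measurable tan_measurable] by (simp add: step_def[abs_def])

lemma step_Suc_measurable [measurable]: "step \<Theta> (Suc n) \<in> borel_measurable M"
  by (rule step_measurable) simp

lemma walk_measurable [measurable]: "walk \<Theta> n \<in> borel_measurable M"
proof (induction n)
  case (Suc n)
  then have "(\<lambda>\<omega>. walk \<Theta> n \<omega> + step \<Theta> (Suc n) \<omega>) \<in> borel_measurable M" by measurable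
  then show ?case by (simp add: walk_Suc[abs_def] cong: measurable_cong)
qed (simp add: walk_def[abs_def])

lemma alive_measurable [measurable]: "Measurable.pred M (alive \<Theta> s n)"
  unfolding alive_def[abs_def] by measurable

lemma exits_measurable [measurable]: "Measurable.pred M (exits \<Theta> s n)"
  unfolding exits_def[abs_def] by measurable

lemma distr_step: "distr M borel (step \<Theta> (Suc n)) = step_law"
  unfolding step_def[abs_def] by (rule distr_tan_angle[OF angle_law]) simp

text \<open>The indicator of survival and the position after \<open>n\<close> steps are functions of the first \<open>n\<close> angles,
  so they are independent of the next step.\<close>
lemma next_step_independent:
  "distr M (borel \<Otimes>\<^sub>M borel) (\<lambda>\<omega>. (if alive \<Theta> s n \<omega> then 1 else 0 :: real, walk \<Theta> n \<omega>)) \<Otimes>\<^sub>M step_law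
    = distr M ((borel \<Otimes>\<^sub>M borel) \<Otimes>\<^sub>M borel)
        (\<lambda>\<omega>. ((if alive \<Theta> s n \<omega> then 1 else 0, walk \<Theta> n \<omega>), step \<Theta> (Suc n) \<omega>))"
proof -
  let ?P = "PiM {1..n} (\<lambda>_. borel) :: (nat \<Rightarrow> real) measure" and ?Q = "PiM {Suc n} (\<lambda>_. borel) :: (nat \<Rightarrow> real) measure"
  let ?A = "\<lambda>\<omega>. restrict (\<lambda>i. \<Theta> i \<omega>) {1..n}" and ?B = "\<lambda>\<omega>. restrict (\<lambda>i. \<Theta> i \<omega>) {Suc n}"
  have ind: "indep_var ?P ?A ?Q ?B"
    by (rule indep_var_restrict[OF indep]) auto
  let ?E = "\<lambda>i (a :: nat \<Rightarrow> real). a i"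
  have walk_E: "walk ?E k \<in> borel_measurable ?P" if "k \<le> n" for k
    unfolding walk_def[abs_def] step_def
  proof (rule borel_measurable_sum)
    fix j assume "j \<in> {1..k}"
    then have "(\<lambda>a. a j) \<in> ?P \<rightarrow>\<^sub>M borel"
      using that by (intro measurable_component_singleton) auto
    then show "(\<lambda>a. tan (a j)) \<in> borel_measurable ?P"
      by (rule measurable_compose[OF _ tan_measurable])
  qed
  have walk_A: "walk ?E k (?A \<omega>) = walk \<Theta> k \<omega>" if "k \<le> n" for k \<omega>
    unfolding walk_def step_def using that by (intro sum.cong) auto
  let ?f = "\<lambda>a. (if \<forall>k\<in>{1..n}. walk ?E k a \<le> s then 1 else 0 :: real, walk ?E n a)"
  have f: "?f \<in> ?P \<rightarrow>\<^sub>M borel \<Otimes>\<^sub>M borel"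
  proof -
    have pred: "Measurable.pred ?P (\<lambda>a. walk ?E k a \<le> s)" if "k \<in> {1..n}" for k
      unfolding pred_def by (intro borel_measurable_le walk_E borel_measurable_const) (use that in simp)
    have "Measurable.pred ?P (\<lambda>a. \<forall>k\<in>{1..n}. walk ?E k a \<le> s)"
      by (intro pred_intros_finite finite_atLeastAtMost pred)
    then show ?thesis using walk_E[of n] by (intro measurable_Pair measurable_If) auto
  qed
  let ?g = "\<lambda>b :: nat \<Rightarrow> real. tan (b (Suc n))"
  have g: "?g \<in> ?Q \<rightarrow>\<^sub>M borel"
    by (rule measurable_compose[where f = "\<lambda>b. b (Suc n)", OF _ tan_measurable])
       (rule measurable_component_singleton, simp)
  have AB: "?A \<in> M \<rightarrow>\<^sub>M ?P" "?B \<in> M \<rightarrow>\<^sub>M ?Q"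
    "distr M ?P ?A \<Otimes>\<^sub>M distr M ?Q ?B = distr M (?P \<Otimes>\<^sub>M ?Q) (\<lambda>\<omega>. (?A \<omega>, ?B \<omega>))"
    using ind unfolding indep_var_distribution_eq by auto
  have fA: "?f (?A \<omega>) = (if alive \<Theta> s n \<omega> then 1 else 0 :: real, walk \<Theta> n \<omega>)" for \<omega>
  proof -
    have "(\<forall>k\<in>{1..n}. walk ?E k (?A \<omega>) \<le> s) = alive \<Theta> s n \<omega>"
      unfolding alive_def by (intro ball_cong refl) (simp only: walk_A atLeastAtMost_iff)
    then show ?thesis by (simp only: walk_A[OF order_refl])
  qed
  have gB: "?g (?B \<omega>) = step \<Theta> (Suc n) \<omega>" for \<omega>
    by (simp add: step_def)
  have D1: "distr M (borel \<Otimes>\<^sub>M borel) (\<lambda>\<omega>. ?f (?A \<omega>)) = distr (distr M ?P ?A) (borel \<Otimes>\<^sub>M borel) ?f"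
    using distr_distr[OF f AB(1)] by (simp only: o_def)
  have D2: "step_law = distr (distr M ?Q ?B) borel ?g"
    using distr_distr[OF g AB(2)] by (simp only: o_def gB distr_step[of n])
  interpret Q: prob_space "distr M ?Q ?B" by (rule prob_space_distr[OF AB(2)])
  have fD: "?f \<in> distr M ?P ?A \<rightarrow>\<^sub>M borel \<Otimes>\<^sub>M borel" and gD: "?g \<in> distr M ?Q ?B \<rightarrow>\<^sub>M borel"
    using f g by simp_all
  have fg: "(\<lambda>(a, b). (?f a, ?g b)) \<in> ?P \<Otimes>\<^sub>M ?Q \<rightarrow>\<^sub>M (borel \<Otimes>\<^sub>M borel) \<Otimes>\<^sub>M borel"
    unfolding case_prod_beta
    by (intro measurable_Pair[of "\<lambda>x. ?f (fst x)"] measurable_compose[OF measurable_fst f] measurable_compose[OF measurable_snd g])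
  have "distr M (borel \<Otimes>\<^sub>M borel) (\<lambda>\<omega>. ?f (?A \<omega>)) \<Otimes>\<^sub>M step_law
      = distr (distr M ?P ?A \<Otimes>\<^sub>M distr M ?Q ?B) ((borel \<Otimes>\<^sub>M borel) \<Otimes>\<^sub>M borel) (\<lambda>(a, b). (?f a, ?g b))"
    unfolding D1 by (subst D2, rule pair_measure_distr[OF fD gD])
      (use D2 step_law.sigma_finite_measure_axioms in simp)
  also have "\<dots> = distr M ((borel \<Otimes>\<^sub>M borel) \<Otimes>\<^sub>M borel) (\<lambda>\<omega>. (?f (?A \<omega>), ?g (?B \<omega>)))"
    unfolding AB(3) by (subst distr_distr[OF fg measurable_Pair[OF AB(1,2)]]) (simp add: o_def)
  finally show ?thesis by (simp only: fA gB)
qed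

lemma average_next_step:
  fixes H :: "real \<Rightarrow> real \<Rightarrow> real"
  assumes H [measurable]: "(\<lambda>(w, x). H w x) \<in> borel_measurable (borel \<Otimes>\<^sub>M borel)"
    and bound: "\<And>w x. \<bar>H w x\<bar> \<le> C"
  shows "(LINT \<omega>|M. (if alive \<Theta> s n \<omega> then 1 else 0) * H (walk \<Theta> n \<omega>) (step \<Theta> (Suc n) \<omega>))
    = (LINT \<omega>|M. (if alive \<Theta> s n \<omega> then 1 else 0) * (LINT x|step_law. H (walk \<Theta> n \<omega>) x))"
proof -
  let ?Z = "\<lambda>\<omega>. (if alive \<Theta> s n \<omega> then 1 else 0 :: real, walk \<Theta> n \<omega>)"
  let ?D = "distr M (borel \<Otimes>\<^sub>M borel) ?Z"
  have [measurable]: "?Z \<in> M \<rightarrow>\<^sub>M borel \<Otimes>\<^sub>M borel" by measurable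
  interpret D: prob_space ?D by (rule prob_space_distr) measurable
  interpret pair_sigma_finite ?D step_law ..
  interpret P: pair_prob_space ?D step_law ..
  have C: "0 \<le> C" using bound[of 0 0] by simp
  have joint: "?D \<Otimes>\<^sub>M step_law = distr M ((borel \<Otimes>\<^sub>M borel) \<Otimes>\<^sub>M borel) (\<lambda>\<omega>. (?Z \<omega>, step \<Theta> (Suc n) \<omega>))"
    by (rule next_step_independent)
  \<comment> \<open>The indicator is clamped to the unit interval to make the integrand bounded on the whole product
      space.\<close>
  let ?F = "\<lambda>z. max 0 (min 1 (fst (fst z))) * H (snd (fst z)) (snd z)"
  have H': "(\<lambda>z::(real \<times> real) \<times> real. H (snd (fst z)) (snd z)) \<in> borel_measurable ((borel \<Otimes>\<^sub>M borel) \<Otimes>\<^sub>M borel)"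
  proof -
    have "(\<lambda>z::(real \<times> real) \<times> real. (snd (fst z), snd z)) \<in> (borel \<Otimes>\<^sub>M borel) \<Otimes>\<^sub>M borel \<rightarrow>\<^sub>M borel \<Otimes>\<^sub>M borel"
      by measurable
    from measurable_compose[OF this H] show ?thesis by simp
  qed
  have F [measurable]: "?F \<in> borel_measurable ((borel \<Otimes>\<^sub>M borel) \<Otimes>\<^sub>M borel)"
    using H' by measurable
  have sets_D: "sets (?D \<Otimes>\<^sub>M step_law) = sets ((borel \<Otimes>\<^sub>M borel) \<Otimes>\<^sub>M borel)"
    by (intro sets_pair_measure_cong) auto
  have F_bound: "\<bar>?F z\<bar> \<le> C" for z
  proof -
    have "\<bar>?F z\<bar> \<le> 1 * C" unfolding abs_mult using bound C by (intro mult_mono) auto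
    then show ?thesis by simp
  qed
  have int: "integrable (?D \<Otimes>\<^sub>M step_law) ?F"
    by (rule P.integrable_const_bound[of _ C])
       (use F_bound F in \<open>auto simp: measurable_cong_sets[OF sets_D refl]\<close>)
  have "(LINT \<omega>|M. (if alive \<Theta> s n \<omega> then 1 else 0) * H (walk \<Theta> n \<omega>) (step \<Theta> (Suc n) \<omega>))
      = (LINT \<omega>|M. ?F (?Z \<omega>, step \<Theta> (Suc n) \<omega>))"
    by (rule Bochner_Integration.integral_cong) auto
  also have "\<dots> = (LINT z|(?D \<Otimes>\<^sub>M step_law). ?F z)"
    unfolding joint by (rule integral_distr[symmetric]) (auto intro: F)
  also have "\<dots> = (LINT z|?D. LINT x|step_law. ?F (z, x))"
    by (rule integral_fst'[OF int, symmetric])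
  also have "\<dots> = (LINT \<omega>|M. LINT x|step_law. ?F (?Z \<omega>, x))"
    by (rule integral_distr) (auto intro!: step_law.borel_measurable_lebesgue_integral F
        simp: measurable_cong_sets[OF sets_pair_measure_cong[OF refl sets_step_law] refl])
  also have "\<dots> = (LINT \<omega>|M. (if alive \<Theta> s n \<omega> then 1 else 0) * (LINT x|step_law. H (walk \<Theta> n \<omega>) x))"
    by (rule Bochner_Integration.integral_cong) auto
  finally show ?thesis .
qed

text \<open>Averaging over the last of the steps turns \<open>\<phi>\<close> into \<open>killed \<phi>\<close> and shortens the walk by one.\<close>
lemma survival_expectation:
  assumes "bounded_borel \<phi>"
  shows "(LINT \<omega>|M. (if alive \<Theta> s n \<omega> then 1 else 0) * \<phi> (s - walk \<Theta> n \<omega>)) = (killed ^^ n) \<phi> s"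
  using assms
proof (induction n arbitrary: \<phi>)
  case 0
  then show ?case by (simp add: prob_space)
next
  case (Suc n)
  note [measurable] = Suc.prems[THEN bounded_borel_measurable]
  obtain C where C: "0 \<le> C" "\<And>x. \<bar>\<phi> x\<bar> \<le> C" using Suc.prems by (meson bounded_borelE)
  let ?H = "\<lambda>w x. (if x \<le> s - w then 1 else 0) * \<phi> (s - w - x)"
  have "(LINT \<omega>|M. (if alive \<Theta> s (Suc n) \<omega> then 1 else 0) * \<phi> (s - walk \<Theta> (Suc n) \<omega>))
      = (LINT \<omega>|M. (if alive \<Theta> s n \<omega> then 1 else 0) * ?H (walk \<Theta> n \<omega>) (step \<Theta> (Suc n) \<omega>))"
    by (rule Bochner_Integration.integral_cong) (auto simp: alive_Suc walk_Suc algebra_simps)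
  also have "\<dots> = (LINT \<omega>|M. (if alive \<Theta> s n \<omega> then 1 else 0) * (LINT x|step_law. ?H (walk \<Theta> n \<omega>) x))"
    by (rule average_next_step[of ?H C]) (use C in auto)
  also have "\<dots> = (LINT \<omega>|M. (if alive \<Theta> s n \<omega> then 1 else 0) * killed \<phi> (s - walk \<Theta> n \<omega>))"
    by (simp add: killed_def indicator_def of_bool_def)
  also have "\<dots> = (killed ^^ n) (killed \<phi>) s"
    by (rule Suc.IH) (use Suc.prems in auto)
  finally show ?case by (simp add: funpow_swap1)
qed

end

text \<open>Here \<open>u\<close> is the distance before the exiting step and \<open>x\<close> its length.\<close>
definition exit_mass :: "(real \<Rightarrow> real \<Rightarrow> bool) \<Rightarrow> real \<Rightarrow> real" where
  "exit_mass k u = (LINT x|step_law. indicator {x. u < x \<and> k u x} x)"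

lemma exit_mass_tail_dominated:
  assumes k [measurable]: "Measurable.pred (borel \<Otimes>\<^sub>M borel) (\<lambda>(u, x). k u x)"
  shows "tail_dominated (exit_mass k) 1"
proof
  have ku: "Measurable.pred borel (k u)" for u
    using measurable_compose[OF measurable_Pair1'[of u borel borel] k] by simp
  have "Measurable.pred (borel \<Otimes>\<^sub>M step_law) (\<lambda>(u, x). k u x)"
    using k by (simp add: measurable_cong_sets[OF sets_pair_measure_cong[OF refl sets_step_law] refl])
  then have "Measurable.pred (borel \<Otimes>\<^sub>M step_law) (\<lambda>z. fst z < snd z \<and> k (fst z) (snd z))"
    by (intro pred_intros_logic) (auto simp: case_prod_beta)
  then have "(\<lambda>(u, x). indicator {x. u < x \<and> k u x} x :: real) \<in> borel_measurable (borel \<Otimes>\<^sub>M step_law)"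
    by (simp add: indicator_def case_prod_beta)
  then have [measurable]: "exit_mass k \<in> borel_measurable borel"
    unfolding exit_mass_def[abs_def] by (rule step_law.borel_measurable_lebesgue_integral)
  have dom: "\<bar>exit_mass k u\<bar> \<le> 1 * tail u" for u
  proof -
    have [measurable]: "{x. u < x \<and> k u x} \<in> sets borel"
      using ku[of u] by (simp add: pred_def)
    have "exit_mass k u = measure step_law {x. u < x \<and> k u x}" by (simp add: exit_mass_def)
    also have "\<dots> \<le> measure step_law {u<..}"
      by (rule step_law.finite_measure_mono) auto
    finally show ?thesis by (simp add: exit_mass_def measure_step_law_greaterThan)
  qed
  then show "\<bar>exit_mass k u\<bar> \<le> 1 * tail u" for u .
  show "bounded_borel (exit_mass k)"
  proof (rule bounded_borelI)
    show "\<bar>exit_mass k x\<bar> \<le> 1" for x using dom[of x] tail_le_1[of x] by linarith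
  qed measurable
qed

context lambertian_ray
begin

text \<open>The walk survives \<open>n\<close> steps, and the next step is averaged over the lengths that pass the edge.\<close>
lemma prob_exit_at:
  assumes k [measurable]: "Measurable.pred (borel \<Otimes>\<^sub>M borel) (\<lambda>(u, x). k u x)"
  shows "prob {\<omega> \<in> space M. exits \<Theta> s n \<omega> \<and> k (s - walk \<Theta> n \<omega>) (step \<Theta> (Suc n) \<omega>)} = (killed ^^ n) (exit_mass k) s"
    and "{\<omega> \<in> space M. exits \<Theta> s n \<omega> \<and> k (s - walk \<Theta> n \<omega>) (step \<Theta> (Suc n) \<omega>)} \<in> sets M"
proof -
  interpret tail_dominated "exit_mass k" 1 by (rule exit_mass_tail_dominated[OF k])
  let ?H = "\<lambda>w x. (if s - w < x \<and> k (s - w) x then 1 else 0 :: real)"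
  have kw: "Measurable.pred (borel \<Otimes>\<^sub>M borel) (\<lambda>z. k (s - fst z) (snd z))"
  proof -
    have "(\<lambda>z::real \<times> real. (s - fst z, snd z)) \<in> borel \<Otimes>\<^sub>M borel \<rightarrow>\<^sub>M borel \<Otimes>\<^sub>M borel" by measurable
    from measurable_compose[OF this k] show ?thesis by simp
  qed
  have H: "(\<lambda>(w, x). ?H w x) \<in> borel_measurable (borel \<Otimes>\<^sub>M borel)"
    using kw by (simp add: case_prod_beta)
  have km: "Measurable.pred M (\<lambda>\<omega>. k (s - walk \<Theta> n \<omega>) (step \<Theta> (Suc n) \<omega>))"
  proof -
    have "(\<lambda>\<omega>. (s - walk \<Theta> n \<omega>, step \<Theta> (Suc n) \<omega>)) \<in> M \<rightarrow>\<^sub>M borel \<Otimes>\<^sub>M borel" by measurable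
    from measurable_compose[OF this k] show ?thesis by simp
  qed
  then show ev: "{\<omega> \<in> space M. exits \<Theta> s n \<omega> \<and> k (s - walk \<Theta> n \<omega>) (step \<Theta> (Suc n) \<omega>)} \<in> sets M"
    by measurable
  have "prob {\<omega> \<in> space M. exits \<Theta> s n \<omega> \<and> k (s - walk \<Theta> n \<omega>) (step \<Theta> (Suc n) \<omega>)}
      = (LINT \<omega>|M. indicator {\<omega> \<in> space M. exits \<Theta> s n \<omega> \<and> k (s - walk \<Theta> n \<omega>) (step \<Theta> (Suc n) \<omega>)} \<omega>)"
    using ev by simp
  also have "\<dots> = (LINT \<omega>|M. (if alive \<Theta> s n \<omega> then 1 else 0) * ?H (walk \<Theta> n \<omega>) (step \<Theta> (Suc n) \<omega>))"
    by (rule Bochner_Integration.integral_cong) (auto simp: exits_def walk_Suc indicator_def)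
  also have "\<dots> = (LINT \<omega>|M. (if alive \<Theta> s n \<omega> then 1 else 0) * (LINT x|step_law. ?H (walk \<Theta> n \<omega>) x))"
    by (rule average_next_step[of ?H 1, OF H]) auto
  also have "\<dots> = (LINT \<omega>|M. (if alive \<Theta> s n \<omega> then 1 else 0) * exit_mass k (s - walk \<Theta> n \<omega>))"
    by (simp add: exit_mass_def indicator_def of_bool_def)
  also have "\<dots> = (killed ^^ n) (exit_mass k) s"
    by (rule survival_expectation[OF bb])
  finally show "prob {\<omega> \<in> space M. exits \<Theta> s n \<omega> \<and> k (s - walk \<Theta> n \<omega>) (step \<Theta> (Suc n) \<omega>)} = (killed ^^ n) (exit_mass k) s" .
qed

text \<open>The condition may vary with the index, so that upward and downward exits are treated at once.\<close>
lemma prob_exit_sums: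
  assumes k: "\<And>n. Measurable.pred (borel \<Otimes>\<^sub>M borel) (\<lambda>(u, x). k n u x)"
  shows "(\<lambda>n. (killed ^^ n) (exit_mass (k n)) s) sums
      prob {\<omega> \<in> space M. \<exists>n. exits \<Theta> s n \<omega> \<and> k n (s - walk \<Theta> n \<omega>) (step \<Theta> (Suc n) \<omega>)}"
proof -
  let ?A = "\<lambda>n. {\<omega> \<in> space M. exits \<Theta> s n \<omega> \<and> k n (s - walk \<Theta> n \<omega>) (step \<Theta> (Suc n) \<omega>)}"
  have "(\<lambda>n. prob (?A n)) sums prob (\<Union>n. ?A n)"
    by (rule finite_measure_UNION)
       (auto simp: disjoint_family_on_def dest: exits_unique intro!: prob_exit_at(2)[OF k])
  also have "(\<Union>n. ?A n) = {\<omega> \<in> space M. \<exists>n. exits \<Theta> s n \<omega> \<and> k n (s - walk \<Theta> n \<omega>) (step \<Theta> (Suc n) \<omega>)}"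
    by auto
  finally show ?thesis by (simp only: prob_exit_at(1)[OF k])
qed

lemma AE_exits:
  assumes "0 \<le> s"
  shows "AE \<omega> in M. \<exists>n. exits \<Theta> s n \<omega>"
proof -
  have "exit_mass (\<lambda>_ _. True) = tail"
  proof
    fix u
    have "exit_mass (\<lambda>_ _. True) u = measure step_law {x. u < x}" by (simp add: exit_mass_def)
    then show "exit_mass (\<lambda>_ _. True) u = tail u"
      using measure_step_law_greaterThan[of u] by (simp add: greaterThan_def)
  qed
  then have "prob {\<omega> \<in> space M. \<exists>n. exits \<Theta> s n \<omega>} = 1"
    using sums_unique2[OF prob_exit_sums[of "\<lambda>_ _ _. True" s]] tail_series_sums_1[OF assms] by simp
  then show ?thesis
    by (subst prob_Collect_eq_1[symmetric]) measurable
qed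

end

section \<open>The exit height is asymptotically uniform\<close>

lemma exit_mass_near_entry:
  assumes t: "0 < t" "t < 1" and u: "0 < u"
  shows "exit_mass (\<lambda>u x. u / x \<le> t) u = tail (u / t)"
proof -
  have "u * t < u" using t u by simp
  then have below: "u < u / t" using t(1) by (simp only: pos_less_divide_eq)
  have "u < x \<and> u / x \<le> t \<longleftrightarrow> u / t \<le> x" for x
  proof (cases "u < x")
    case True
    then have "u / x \<le> t \<longleftrightarrow> u \<le> t * x" using u by (intro pos_divide_le_eq) simp
    also have "\<dots> \<longleftrightarrow> u / t \<le> x" using t(1) by (simp only: pos_divide_le_eq mult.commute)
    finally show ?thesis using True by simp
  next
    case False
    then show ?thesis using below by linarith
  qed
  then have "{x. u < x \<and> u / x \<le> t} = {u / t..}" by auto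
  then show ?thesis by (simp add: exit_mass_def measure_step_law_atLeast)
qed

lemma exit_mass_near_arrival:
  assumes t: "0 < t" "t < 1" and u: "0 < u"
  shows "exit_mass (\<lambda>u x. 1 - u / x \<le> t) u = tail u - tail (u / (1 - t))"
proof -
  have t1: "0 < 1 - t" using t by simp
  have "u < x \<and> 1 - u / x \<le> t \<longleftrightarrow> u < x \<and> x \<le> u / (1 - t)" for x
  proof (cases "u < x")
    case True
    have "1 - u / x \<le> t \<longleftrightarrow> 1 - t \<le> u / x" by linarith
    also have "\<dots> \<longleftrightarrow> (1 - t) * x \<le> u" using True u by (intro pos_le_divide_eq) simp
    also have "\<dots> \<longleftrightarrow> x \<le> u / (1 - t)" using t1 by (simp only: pos_le_divide_eq mult.commute)
    finally show ?thesis by (rule conj_cong[OF refl])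
  next
    case False
    then show ?thesis by blast
  qed
  then have "{x. u < x \<and> 1 - u / x \<le> t} = {x. u < x \<and> x \<le> u / (1 - t)}"
    by (rule Collect_cong)
  also have "\<dots> = {u<..} - {u / (1 - t)<..}" by auto
  finally have eq: "{x. u < x \<and> 1 - u / x \<le> t} = {u<..} - {u / (1 - t)<..}" .
  have "u * (1 - t) \<le> u" using t u by (intro mult_left_le) auto
  then have "u \<le> u / (1 - t)" using t1 by (simp only: pos_le_divide_eq)
  then have "{u / (1 - t)<..} \<subseteq> {u<..}" by auto
  then have "measure step_law ({u<..} - {u / (1 - t)<..}) = measure step_law {u<..} - measure step_law {u / (1 - t)<..}"
    by (intro step_law.finite_measure_Diff) auto
  then show ?thesis unfolding exit_mass_def eq by (simp add: measure_step_law_greaterThan)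
qed

text \<open>Here the inverse square decay of the tail produces the uniform law: the ratios of the two masses to the
  tail tend to \<open>t^2\<close> and \<open>1 - (1 - t)^2\<close>, and these add up to \<open>2 * t\<close>.\<close>
lemma symmetrised_exit_mass_negligible:
  assumes t: "0 < t" "t < 1"
  shows "((\<lambda>u. (exit_mass (\<lambda>u x. u / x \<le> t) u + exit_mass (\<lambda>u x. 1 - u / x \<le> t) u - 2 * t * tail u) / tail u)
    \<longlongrightarrow> 0) at_top"
proof -
  have "((\<lambda>u. tail (u / t) / tail u + 1 - tail (u / (1 - t)) / tail u - 2 * t) \<longlongrightarrow> t\<^sup>2 + 1 - (1 - t)\<^sup>2 - 2 * t) at_top"
    by (intro tendsto_add tendsto_diff tendsto_const tail_ratio) (use t in auto)
  also have "t\<^sup>2 + 1 - (1 - t)\<^sup>2 - 2 * t = 0" by (simp add: power2_eq_square algebra_simps)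
  finally have lim: "((\<lambda>u. tail (u / t) / tail u + 1 - tail (u / (1 - t)) / tail u - 2 * t) \<longlongrightarrow> 0) at_top" .
  show ?thesis
  proof (rule Lim_transform_eventually[OF lim])
    show "\<forall>\<^sub>F u in at_top. tail (u / t) / tail u + 1 - tail (u / (1 - t)) / tail u - 2 * t
        = (exit_mass (\<lambda>u x. u / x \<le> t) u + exit_mass (\<lambda>u x. 1 - u / x \<le> t) u - 2 * t * tail u) / tail u"
      using eventually_gt_at_top[of 0]
    proof eventually_elim
      case (elim u)
      then show ?case using tail_pos[of u]
        by (simp add: exit_mass_near_entry[OF t] exit_mass_near_arrival[OF t] add_divide_distrib diff_divide_distrib)
    qed
  qed
qed

lemma tail_dominated_lincomb:
  assumes "tail_dominated \<phi> C" "tail_dominated \<psi> D"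
  shows "tail_dominated (\<lambda>x. a * \<phi> x + b * \<psi> x) (\<bar>a\<bar> * C + \<bar>b\<bar> * D)"
proof -
  interpret P: tail_dominated \<phi> C by fact
  interpret Q: tail_dominated \<psi> D by fact
  show ?thesis
  proof
    show "bounded_borel (\<lambda>x. a * \<phi> x + b * \<psi> x)"
      by (intro bounded_borel_add bounded_borel_cmult P.bb Q.bb)
    fix x
    have "\<bar>a * \<phi> x + b * \<psi> x\<bar> \<le> \<bar>a\<bar> * \<bar>\<phi> x\<bar> + \<bar>b\<bar> * \<bar>\<psi> x\<bar>"
      by (metis abs_mult abs_triangle_ineq)
    also have "\<dots> \<le> \<bar>a\<bar> * (C * tail x) + \<bar>b\<bar> * (D * tail x)"
      by (intro add_mono mult_left_mono P.dom Q.dom) auto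
    finally show "\<bar>a * \<phi> x + b * \<psi> x\<bar> \<le> (\<bar>a\<bar> * C + \<bar>b\<bar> * D) * tail x"
      by (simp add: algebra_simps)
  qed
qed

lemma tail_dominated_tail: "tail_dominated tail 1"
  by standard (use tail_pos in \<open>auto simp: abs_of_pos\<close>)

context lambertian_ray
begin

lemma passage_time_measurable [measurable]: "passage_time \<Theta> s \<in> M \<rightarrow>\<^sub>M count_space UNIV"
  unfolding passage_time_def[abs_def] Inf_nat_def mem_Collect_eq by measurable

text \<open>The value of the unspecified choice for a degenerate segment is constant in \<open>\<omega>\<close> once the index of
  the step is fixed.\<close>
lemma exit_height_measurable:
  assumes s: "0 < s"
  shows "exit_height \<Theta> s \<in> borel_measurable M"
proof -
  let ?h = "\<lambda>n \<omega>. THE y. (0, y) \<in> closed_segment (ray_vertex \<Theta> s (n - 1) \<omega>) (ray_vertex \<Theta> s n \<omega>)"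
  have "?h n \<in> borel_measurable M" for n
  proof (cases n)
    case 0
    have "?h n = (\<lambda>_. THE y. False)"
      using s by (simp add: 0 ray_vertex_def)
    then show ?thesis by simp
  next
    case (Suc m)
    define a b where "a \<omega> = - s + walk \<Theta> m \<omega>" and "b \<omega> = - s + walk \<Theta> (Suc m) \<omega>" for \<omega>
    define c d :: real where "c = (1 - (-1) ^ m) / 2" and "d = (1 - (-1) ^ Suc m) / 2"
    have [measurable]: "a \<in> borel_measurable M" "b \<in> borel_measurable M"
      unfolding a_def b_def by measurable
    define junk where "junk = (THE y. (0, y) \<in> closed_segment (0, c) (0 :: real, d))"
    have "?h n = (\<lambda>\<omega>. if a \<omega> = b \<omega> then (if a \<omega> = 0 then junk else THE y. False)
        else if 0 \<le> - a \<omega> / (b \<omega> - a \<omega>) \<and> - a \<omega> / (b \<omega> - a \<omega>) \<le> 1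
          then (1 - - a \<omega> / (b \<omega> - a \<omega>)) * c + - a \<omega> / (b \<omega> - a \<omega>) * d else THE y. False)"
      unfolding Suc diff_Suc_1 ray_vertex_def a_def b_def c_def d_def junk_def
      by (rule ext) (rule crossing_height)
    also have "\<dots> \<in> borel_measurable M" by measurable
    finally show ?thesis .
  qed
  then have "(\<lambda>\<omega>. ?h (passage_time \<Theta> s \<omega>) \<omega>) \<in> borel_measurable M"
    by (rule measurable_compose_countable[OF _ passage_time_measurable])
  then show ?thesis by (simp add: exit_height_def[abs_def] Let_def)
qed

text \<open>For a fixed positive index the vertical component of the segment is a constant of modulus one, so its direction
  avoids the branch cut of the argument.\<close>
lemma exit_angle_measurable: "exit_angle \<Theta> s \<in> borel_measurable M"
proof -
  let ?a = "\<lambda>n \<omega>. Arg (Complex (fst (ray_vertex \<Theta> s n \<omega> - ray_vertex \<Theta> s (n - 1) \<omega>))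
      (snd (ray_vertex \<Theta> s n \<omega> - ray_vertex \<Theta> s (n - 1) \<omega>)))"
  have "?a n \<in> borel_measurable M" for n
  proof (cases n)
    case 0
    then show ?thesis by simp
  next
    case (Suc m)
    define e :: real where "e = (-1) ^ m"
    have e: "e \<noteq> 0" by (simp add: e_def)
    have "continuous_on UNIV (\<lambda>x. Arg (Complex x e))"
      unfolding Complex_eq
      by (intro continuous_intros) (use e in \<open>auto simp: complex_nonpos_Reals_iff\<close>)
    then have "(\<lambda>x. Arg (Complex x e)) \<in> borel_measurable borel"
      by (rule borel_measurable_continuous_onI)
    then have "(\<lambda>\<omega>. Arg (Complex (step \<Theta> (Suc m) \<omega>) e)) \<in> borel_measurable M"
      by (rule measurable_compose[OF step_Suc_measurable])
    moreover have "?a n = (\<lambda>\<omega>. Arg (Complex (step \<Theta> (Suc m) \<omega>) e))"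
      by (simp add: fun_eq_iff Suc ray_vertex_def walk_Suc e_def add_divide_distrib diff_divide_distrib)
    ultimately show ?thesis by simp
  qed
  then have "(\<lambda>\<omega>. ?a (passage_time \<Theta> s \<omega>) \<omega>) \<in> borel_measurable M"
    by (rule measurable_compose_countable[OF _ passage_time_measurable])
  then show ?thesis by (simp add: exit_angle_def[abs_def] Let_def)
qed

lemma exit_event_measurable:
  assumes "\<And>n. Measurable.pred (borel \<Otimes>\<^sub>M borel) (\<lambda>(u, x). k n u x)"
  shows "{\<omega> \<in> space M. \<exists>n. exits \<Theta> s n \<omega> \<and> k n (s - walk \<Theta> n \<omega>) (step \<Theta> (Suc n) \<omega>)} \<in> sets M"
proof -
  have "{\<omega> \<in> space M. \<exists>n. exits \<Theta> s n \<omega> \<and> k n (s - walk \<Theta> n \<omega>) (step \<Theta> (Suc n) \<omega>)}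
      = (\<Union>n. {\<omega> \<in> space M. exits \<Theta> s n \<omega> \<and> k n (s - walk \<Theta> n \<omega>) (step \<Theta> (Suc n) \<omega>)})" by auto
  also have "\<dots> \<in> sets M" by (intro sets.countable_UN) (auto intro: prob_exit_at(2)[OF assms])
  finally show ?thesis .
qed

text \<open>The event is a union over the index of the exiting step of conditions that alternate with the parity.
  Half their sum and half their alternating difference separate the two kinds of Green potential:
  the sum is \<open>2 * t\<close> times the tail up to a negligible function, and the alternating part
  vanishes at infinity.\<close>
lemma prob_exit_height_le:
  assumes t: "0 < t" "t < 1"
  shows "((\<lambda>s. prob {\<omega> \<in> space M. exit_height \<Theta> s \<omega> \<le> t}) \<longlongrightarrow> t) at_top"
proof -
  define k where "k n u x \<longleftrightarrow> (if even n then u / x \<le> t else 1 - u / x \<le> t)" for n :: nat and u x :: real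
  have pred1: "Measurable.pred (borel \<Otimes>\<^sub>M borel) (\<lambda>(u, x). u / x \<le> t)"
    and pred2: "Measurable.pred (borel \<Otimes>\<^sub>M borel) (\<lambda>(u, x). 1 - u / x \<le> t)"
    unfolding case_prod_beta by measurable
  have pred: "Measurable.pred (borel \<Otimes>\<^sub>M borel) (\<lambda>(u, x). k n u x)" for n
    unfolding k_def using pred1 pred2 by (cases "even n") (simp_all only: if_True if_False)
  define r1 r2 where "r1 = exit_mass (\<lambda>u x. u / x \<le> t)" and "r2 = exit_mass (\<lambda>u x. 1 - u / x \<le> t)"
  interpret R1: tail_dominated r1 1 unfolding r1_def by (rule exit_mass_tail_dominated[OF pred1])
  interpret R2: tail_dominated r2 1 unfolding r2_def by (rule exit_mass_tail_dominated[OF pred2])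
  define \<rho> where "\<rho> u = 1 * (1 * r1 u + 1 * r2 u) + (- 2 * t) * tail u" for u
  define \<sigma> where "\<sigma> u = 1 * r1 u + (- 1) * r2 u" for u
  have \<rho>: "tail_dominated \<rho> (\<bar>1\<bar> * (\<bar>1\<bar> * 1 + \<bar>1\<bar> * 1) + \<bar>- 2 * t\<bar> * 1)" unfolding \<rho>_def
    by (intro tail_dominated_lincomb tail_dominated_tail R1.tail_dominated_axioms R2.tail_dominated_axioms)
  have \<sigma>: "tail_dominated \<sigma> (\<bar>1\<bar> * 1 + \<bar>- 1\<bar> * 1)" unfolding \<sigma>_def
    by (intro tail_dominated_lincomb R1.tail_dominated_axioms R2.tail_dominated_axioms)
  have Tk: "(killed ^^ n) (exit_mass (k n)) s
      = 1 / 2 * (1 ^ n * (killed ^^ n) \<rho> s) + 1 / 2 * ((- 1) ^ n * (killed ^^ n) \<sigma> s) + t * (killed ^^ n) tail s" for n s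
  proof -
    define a b c where "a = (killed ^^ n) r1 s" and "b = (killed ^^ n) r2 s" and "c = (killed ^^ n) tail s"
    have sum: "(killed ^^ n) \<rho> s = 1 * (1 * a + 1 * b) + (- 2 * t) * c"
    proof -
      have "(killed ^^ n) \<rho> = (\<lambda>s. 1 * (1 * (killed ^^ n) r1 s + 1 * (killed ^^ n) r2 s) + (- 2 * t) * (killed ^^ n) tail s)"
        unfolding \<rho>_def[abs_def]
        by (subst killed_funpow_add, intro bounded_borel_add bounded_borel_cmult R1.bb R2.bb,
            rule bounded_borel_cmult[OF bounded_borel_tail], subst killed_funpow_cmult,
            subst killed_funpow_add[OF bounded_borel_cmult[OF R1.bb] bounded_borel_cmult[OF R2.bb]])
           (simp only: killed_funpow_cmult)
      then show ?thesis by (simp only: a_def b_def c_def)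
    qed
    have diff: "(killed ^^ n) \<sigma> s = 1 * a + (- 1) * b"
    proof -
      have "(killed ^^ n) \<sigma> = (\<lambda>s. 1 * (killed ^^ n) r1 s + (- 1) * (killed ^^ n) r2 s)"
        unfolding \<sigma>_def[abs_def]
        by (subst killed_funpow_add[OF bounded_borel_cmult[OF R1.bb] bounded_borel_cmult[OF R2.bb]])
           (simp only: killed_funpow_cmult)
      then show ?thesis by (simp only: a_def b_def)
    qed
    have sign: "(- 1 :: real) ^ n = (if even n then 1 else - 1)" by simp
    have tc: "(- 2 * t) * c = - 2 * (t * c)" by (simp only: mult.assoc)
    show ?thesis
    proof (cases "even n")
      case True
      then have "exit_mass (k n) = r1" by (simp only: k_def[abs_def] r1_def if_True)
      then have "(killed ^^ n) (exit_mass (k n)) s = a" by (simp only: a_def)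
      moreover have "a = 1 / 2 * (1 * (1 * (1 * a + 1 * b) + - 2 * (t * c))) + 1 / 2 * (1 * (1 * a + (- 1) * b)) + t * c"
        by algebra
      ultimately show ?thesis unfolding sum diff sign tc power_one c_def[symmetric] using True by (simp only: if_True)
    next
      case False
      then have "exit_mass (k n) = r2" by (simp only: k_def[abs_def] r2_def if_False)
      then have "(killed ^^ n) (exit_mass (k n)) s = b" by (simp only: b_def)
      moreover have "b = 1 / 2 * (1 * (1 * (1 * a + 1 * b) + - 2 * (t * c))) + 1 / 2 * (- 1 * (1 * a + (- 1) * b)) + t * c"
        by algebra
      ultimately show ?thesis unfolding sum diff sign tc power_one c_def[symmetric] using False by (simp only: if_False)
    qed
  qed
  have prob_eq: "1 / 2 * green 1 \<rho> s + 1 / 2 * green (- 1) \<sigma> s + t = prob {\<omega> \<in> space M. exit_height \<Theta> s \<omega> \<le> t}"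
    if s: "0 < s" for s
  proof -
    have "(\<lambda>n. 1 / 2 * (1 ^ n * (killed ^^ n) \<rho> s) + 1 / 2 * ((- 1) ^ n * (killed ^^ n) \<sigma> s) + t * (killed ^^ n) tail s)
        sums (1 / 2 * green 1 \<rho> s + 1 / 2 * green (- 1) \<sigma> s + t * 1)"
      unfolding green_def using s
      by (intro sums_add sums_mult summable_sums tail_series_sums_1
          tail_dominated.summable_signed[OF \<rho>] tail_dominated.summable_signed[OF \<sigma>]) auto
    then have "1 / 2 * green 1 \<rho> s + 1 / 2 * green (- 1) \<sigma> s + t * 1
        = prob {\<omega> \<in> space M. \<exists>n. exits \<Theta> s n \<omega> \<and> k n (s - walk \<Theta> n \<omega>) (step \<Theta> (Suc n) \<omega>)}"
      unfolding Tk[symmetric] by (rule sums_unique2[OF _ prob_exit_sums[OF pred]])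
    also have "\<dots> = prob {\<omega> \<in> space M. exit_height \<Theta> s \<omega> \<le> t}"
    proof (rule finite_measure_eq_AE)
      have [measurable]: "exit_height \<Theta> s \<in> borel_measurable M" by (rule exit_height_measurable[OF s])
      show "{\<omega> \<in> space M. exit_height \<Theta> s \<omega> \<le> t} \<in> sets M" by measurable
      show "{\<omega> \<in> space M. \<exists>n. exits \<Theta> s n \<omega> \<and> k n (s - walk \<Theta> n \<omega>) (step \<Theta> (Suc n) \<omega>)} \<in> sets M"
        by (rule exit_event_measurable[OF pred])
      show "AE \<omega> in M. \<omega> \<in> {\<omega> \<in> space M. \<exists>n. exits \<Theta> s n \<omega> \<and> k n (s - walk \<Theta> n \<omega>) (step \<Theta> (Suc n) \<omega>)}
          \<longleftrightarrow> \<omega> \<in> {\<omega> \<in> space M. exit_height \<Theta> s \<omega> \<le> t}"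
        using AE_exits[OF less_imp_le[OF s]]
      proof eventually_elim
        case (elim \<omega>)
        then obtain n where n: "exits \<Theta> s n \<omega>" by blast
        then have "exit_height \<Theta> s \<omega> \<le> t \<longleftrightarrow> k n (s - walk \<Theta> n \<omega>) (step \<Theta> (Suc n) \<omega>)"
          unfolding exits_exit_height(1)[OF n s] k_def by (cases "even n") (simp_all only: if_True if_False)
        moreover have "exits \<Theta> s m \<omega> \<longleftrightarrow> m = n" for m using n exits_unique[OF n, of m] by blast
        ultimately show ?case by (simp only: mem_Collect_eq simp_thms)
      qed
    qed
    finally show ?thesis by simp
  qed
  have "((\<lambda>u. \<rho> u / tail u) \<longlongrightarrow> 0) at_top"
    using symmetrised_exit_mass_negligible[OF t]
    by (simp only: \<rho>_def r1_def r2_def mult_1 mult_minus_left add_uminus_conv_diff)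
  then have "((\<lambda>s. 1 / 2 * green 1 \<rho> s + 1 / 2 * green (- 1) \<sigma> s + t) \<longlongrightarrow> 1 / 2 * 0 + 1 / 2 * 0 + t) at_top"
    by (intro tendsto_intros green_small_relative_to_tail[OF \<rho>] alternating_green_tendsto_0[OF \<sigma>])
  then have "((\<lambda>s. 1 / 2 * green 1 \<rho> s + 1 / 2 * green (- 1) \<sigma> s + t) \<longlongrightarrow> t) at_top" by simp
  moreover have "\<forall>\<^sub>F s in at_top. 1 / 2 * green 1 \<rho> s + 1 / 2 * green (- 1) \<sigma> s + t
      = prob {\<omega> \<in> space M. exit_height \<Theta> s \<omega> \<le> t}"
    using eventually_gt_at_top[of 0] by eventually_elim (rule prob_eq)
  ultimately show ?thesis by (rule Lim_transform_eventually)
qed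

text \<open>A step from a distance of at least \<open>A\<close> that passes the edge is longer than \<open>A\<close>, so the mass of the
  short exits vanishes far from the edge.\<close>
lemma prob_short_exit_step:
  "((\<lambda>s. prob {\<omega> \<in> space M. \<exists>n. exits \<Theta> s n \<omega> \<and> step \<Theta> (Suc n) \<omega> \<le> A}) \<longlongrightarrow> 0) at_top"
proof -
  let ?k = "\<lambda>u x. x \<le> A"
  have pred: "Measurable.pred (borel \<Otimes>\<^sub>M borel) (\<lambda>(u :: real, x). x \<le> A)"
    unfolding case_prod_beta by measurable
  have "\<forall>\<^sub>F u in at_top. 0 = exit_mass ?k u / tail u"
    using eventually_ge_at_top[of A]
  proof eventually_elim
    case (elim u)
    then have "{x. u < x \<and> x \<le> A} = {}" by auto
    then show ?case by (simp add: exit_mass_def)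
  qed
  then have "((\<lambda>u. exit_mass ?k u / tail u) \<longlongrightarrow> 0) at_top"
    by (rule Lim_transform_eventually[OF tendsto_const])
  from green_small_relative_to_tail[OF exit_mass_tail_dominated[OF pred] this]
  have "(green 1 (exit_mass ?k) \<longlongrightarrow> 0) at_top" .
  moreover have "green 1 (exit_mass ?k) = (\<lambda>s. prob {\<omega> \<in> space M. \<exists>n. exits \<Theta> s n \<omega> \<and> step \<Theta> (Suc n) \<omega> \<le> A})"
    unfolding green_def[abs_def] using sums_unique[OF prob_exit_sums[of "\<lambda>_. ?k", OF pred]] by simp
  ultimately show ?thesis by simp
qed

end

lemma cdf_uniform:
  assumes "prob_space M'" and Z: "distributed M' lborel Z (indicator {0..1})"
  shows "cdf (distr M' borel Z) t = max 0 (min 1 t)"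
proof -
  interpret prob_space M' by fact
  have [measurable]: "Z \<in> borel_measurable M'" using distributed_measurable[OF Z] by simp
  have "emeasure M' (Z -` {..t} \<inter> space M') = (\<integral>\<^sup>+x. indicator {0..1} x * indicator {..t} x \<partial>lborel)"
    by (rule distributed_emeasure[OF Z]) simp
  also have "\<dots> = (\<integral>\<^sup>+x. indicator {0..min 1 t} x \<partial>lborel)"
    by (intro nn_integral_cong) (auto simp: indicator_def)
  also have "\<dots> = ennreal (max 0 (min 1 t))"
    by (cases "0 \<le> t") (auto simp: max_def min_def)
  finally have "measure M' (Z -` {..t} \<inter> space M') = max 0 (min 1 t)"
    by (simp only: measure_def enn2real_ennreal max.cobounded1)
  then show ?thesis by (simp add: cdf_def measure_distr)
qed

context lambertian_ray
begin

text \<open>Outside the open unit interval the limit follows from that inside by monotonicity.\<close>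
lemma exit_height_cdf:
  "((\<lambda>s. prob {\<omega> \<in> space M. exit_height \<Theta> s \<omega> \<le> t}) \<longlongrightarrow> max 0 (min 1 t)) at_top"
proof -
  have mono: "\<forall>\<^sub>F s in at_top. prob {\<omega> \<in> space M. exit_height \<Theta> s \<omega> \<le> a} \<le> prob {\<omega> \<in> space M. exit_height \<Theta> s \<omega> \<le> b}"
    if "a \<le> b" for a b
    using eventually_gt_at_top[of 0]
  proof eventually_elim
    case (elim s)
    have [measurable]: "exit_height \<Theta> s \<in> borel_measurable M" by (rule exit_height_measurable[OF elim])
    show ?case using that by (intro finite_measure_mono) auto
  qed
  consider "0 < t" "t < 1" | "t \<le> 0" | "1 \<le> t" by linarith
  then show ?thesis
  proof cases
    case 1
    then show ?thesis using prob_exit_height_le[of t] by simp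
  next
    case 2
    have "((\<lambda>s. prob {\<omega> \<in> space M. exit_height \<Theta> s \<omega> \<le> t}) \<longlongrightarrow> 0) at_top"
    proof (rule tendstoI)
      fix \<epsilon> :: real assume "0 < \<epsilon>"
      define \<delta> where "\<delta> = min (\<epsilon> / 2) (1 / 2)"
      have \<delta>: "0 < \<delta>" "\<delta> < 1" "\<delta> < \<epsilon>" using \<open>0 < \<epsilon>\<close> by (auto simp: \<delta>_def min_def)
      have "t \<le> \<delta>" using 2 \<delta> by simp
      show "\<forall>\<^sub>F s in at_top. dist (prob {\<omega> \<in> space M. exit_height \<Theta> s \<omega> \<le> t}) 0 < \<epsilon>"
        using order_tendstoD(2)[OF prob_exit_height_le[OF \<delta>(1,2)] \<delta>(3)] mono[OF \<open>t \<le> \<delta>\<close>]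
        by eventually_elim (simp add: dist_real_def)
    qed
    then show ?thesis using 2 by simp
  next
    case 3
    have "((\<lambda>s. prob {\<omega> \<in> space M. exit_height \<Theta> s \<omega> \<le> t}) \<longlongrightarrow> 1) at_top"
    proof (rule tendstoI)
      fix \<epsilon> :: real assume "0 < \<epsilon>"
      define \<delta> where "\<delta> = 1 - min (\<epsilon> / 2) (1 / 2)"
      have \<delta>: "0 < \<delta>" "\<delta> < 1" "1 - \<epsilon> < \<delta>" using \<open>0 < \<epsilon>\<close> by (auto simp: \<delta>_def min_def)
      have "\<delta> \<le> t" using 3 \<delta> by simp
      show "\<forall>\<^sub>F s in at_top. dist (prob {\<omega> \<in> space M. exit_height \<Theta> s \<omega> \<le> t}) 1 < \<epsilon>"
        using order_tendstoD(1)[OF prob_exit_height_le[OF \<delta>(1,2)] \<delta>(3)] mono[OF \<open>\<delta> \<le> t\<close>]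
      proof eventually_elim
        case (elim s)
        then show ?case using prob_le_1[of "{\<omega> \<in> space M. exit_height \<Theta> s \<omega> \<le> t}"]
          by (simp add: dist_real_def)
      qed
    qed
    then show ?thesis using 3 by simp
  qed
qed

lemma exit_height_expectation:
  fixes g :: "real \<Rightarrow> real"
  assumes "prob_space M'" and Z: "distributed M' lborel Z (indicator {0..1})"
    and g: "continuous_on UNIV g" "\<And>y. \<bar>g y\<bar> \<le> B"
  shows "((\<lambda>s. LINT \<omega>|M. g (exit_height \<Theta> s \<omega>)) \<longlongrightarrow> (LINT \<omega>|M'. g (Z \<omega>))) at_top"
proof -
  interpret M': prob_space M' by fact
  have [measurable]: "Z \<in> borel_measurable M'" using distributed_measurable[OF Z] by simp
  have [measurable]: "g \<in> borel_measurable borel" by (rule borel_measurable_continuous_onI[OF g(1)])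
  \<comment> \<open>The default value makes \<open>Y s\<close> measurable for every \<open>s\<close>, as weak convergence of its
      laws along a sequence requires.\<close>
  define Y where "Y s = (if 0 < s then exit_height \<Theta> s else (\<lambda>_. 0))" for s
  have [measurable]: "Y s \<in> borel_measurable M" for s
    using exit_height_measurable by (simp add: Y_def)
  have ev: "\<forall>\<^sub>F s in at_top. Y s = exit_height \<Theta> s"
    using eventually_gt_at_top[of 0] by eventually_elim (simp add: Y_def)
  have "((\<lambda>s. LINT \<omega>|M. g (Y s \<omega>)) \<longlongrightarrow> (LINT \<omega>|M'. g (Z \<omega>))) at_top"
  proof (rule tendsto_at_topI_sequentially)
    fix X :: "nat \<Rightarrow> real" assume X: "filterlim X at_top sequentially"
    let ?\<mu> = "\<lambda>n. distr M borel (Y (X n))" and ?\<nu> = "distr M' borel Z"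
    have "weak_conv_m ?\<mu> ?\<nu>"
      unfolding weak_conv_m_def weak_conv_def
    proof (intro allI impI)
      fix t
      have "((\<lambda>s. prob {\<omega> \<in> space M. Y s \<omega> \<le> t}) \<longlongrightarrow> max 0 (min 1 t)) at_top"
        by (rule Lim_transform_eventually[OF exit_height_cdf])
           (use ev in \<open>auto elim: eventually_mono\<close>)
      from filterlim_compose[OF this X]
      have "(\<lambda>n. prob {\<omega> \<in> space M. Y (X n) \<omega> \<le> t}) \<longlonglongrightarrow> max 0 (min 1 t)" .
      moreover have "cdf (?\<mu> n) t = prob {\<omega> \<in> space M. Y (X n) \<omega> \<le> t}" for n
        by (simp add: cdf_def measure_distr vimage_def Int_def conj_commute)
      ultimately show "(\<lambda>n. cdf (?\<mu> n) t) \<longlonglongrightarrow> cdf ?\<nu> t"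
        by (simp add: cdf_uniform[OF assms(1) Z])
    qed
    moreover have "real_distribution (?\<mu> n)" for n by (rule real_distribution_distr) simp
    moreover have "real_distribution ?\<nu>" by (rule M'.real_distribution_distr) simp
    ultimately have "(\<lambda>n. integral\<^sup>L (?\<mu> n) g) \<longlonglongrightarrow> integral\<^sup>L ?\<nu> g"
      using g by (intro weak_conv_imp_integral_bdd_continuous_conv[where B = B])
        (auto simp: continuous_on_eq_continuous_at)
    then show "(\<lambda>n. LINT \<omega>|M. g (Y (X n) \<omega>)) \<longlonglongrightarrow> (LINT \<omega>|M'. g (Z \<omega>))"
      by (simp add: integral_distr)
  qed
  then show ?thesis
    by (rule Lim_transform_eventually) (use ev in \<open>auto elim: eventually_mono\<close>)
qed

text \<open>The tangent of the absolute angle is the reciprocal of the length of the exiting step.\<close>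
lemma exits_exit_angle:
  assumes e: "exits \<Theta> s n \<omega>" and s: "0 < s" and \<delta>: "0 < \<delta>" and long: "1 / \<delta> < step \<Theta> (Suc n) \<omega>"
  shows "\<bar>exit_angle \<Theta> s \<omega>\<bar> < \<delta>" "\<bar>exit_angle \<Theta> s \<omega>\<bar> < pi / 2"
proof -
  let ?a = "\<bar>exit_angle \<Theta> s \<omega>\<bar>"
  note P = exit_angle_props[OF exits_crosses[OF e] s exits_passage_time[OF e, symmetric]]
  show "?a < pi / 2" by (rule P(1))
  have X: "0 < step \<Theta> (Suc n) \<omega>" using long \<delta> by (meson divide_pos_pos less_trans zero_less_one)
  have "0 < ?a" using P(2,3) by (cases "odd (Suc n)") force+
  have "tan ?a = inverse (cot ?a)" by (simp add: cot_def tan_def)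
  also have "\<dots> = 1 / step \<Theta> (Suc n) \<omega>" using P(4) by (simp add: divide_inverse)
  also have "\<dots> < \<delta>" using long X \<delta> by (simp add: field_simps)
  finally have "tan ?a < \<delta>" .
  moreover have "?a \<le> tan ?a"
  proof -
    have "arctan (tan ?a) = ?a" using \<open>0 < ?a\<close> P(1) by (intro arctan_tan) auto
    moreover have "arctan (tan ?a) \<le> tan ?a"
      using \<open>0 < ?a\<close> P(1) by (intro arctan_le_self) (simp add: tan_gt_zero less_imp_le)
    ultimately show ?thesis by simp
  qed
  ultimately show "?a < \<delta>" by simp
qed

text \<open>On the compact range of the pair the test function is uniformly continuous, so a small angle may be
  replaced by zero. The angle is small unless the exiting step is short.\<close>
lemma angle_irrelevant:
  fixes f :: "real \<times> real \<Rightarrow> real"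
  assumes f: "continuous_on UNIV f" "\<And>z. \<bar>f z\<bar> \<le> B"
  shows "((\<lambda>s. (LINT \<omega>|M. f (exit_angle \<Theta> s \<omega>, exit_height \<Theta> s \<omega>)) - (LINT \<omega>|M. f (0, exit_height \<Theta> s \<omega>)))
    \<longlongrightarrow> 0) at_top"
proof (rule tendstoI)
  fix \<epsilon> :: real assume \<epsilon>: "0 < \<epsilon>"
  have B: "0 \<le> B" using f(2)[of 0] by simp
  have [measurable]: "f \<in> borel_measurable borel" by (rule borel_measurable_continuous_onI[OF f(1)])
  have "uniformly_continuous_on ({- (pi / 2)..pi / 2} \<times> {0..1}) f"
    by (intro compact_uniformly_continuous continuous_on_subset[OF f(1)] compact_Times) auto
  then obtain \<delta> where \<delta>: "0 < \<delta>" and unif: "\<And>z z'. z \<in> {- (pi / 2)..pi / 2} \<times> {0..1} \<Longrightarrow>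
      z' \<in> {- (pi / 2)..pi / 2} \<times> {0..1} \<Longrightarrow> dist z' z < \<delta> \<Longrightarrow> dist (f z') (f z) < \<epsilon> / 2"
    unfolding uniformly_continuous_on_def using half_gt_zero[OF \<epsilon>] by metis
  let ?bad = "\<lambda>s. {\<omega> \<in> space M. \<exists>n. exits \<Theta> s n \<omega> \<and> step \<Theta> (Suc n) \<omega> \<le> 1 / \<delta>}"
  have "((\<lambda>s. \<epsilon> / 2 + 2 * B * prob (?bad s)) \<longlongrightarrow> \<epsilon> / 2 + 2 * B * 0) at_top"
    by (intro tendsto_intros prob_short_exit_step)
  then have "\<forall>\<^sub>F s in at_top. \<epsilon> / 2 + 2 * B * prob (?bad s) < \<epsilon>"
    by (rule order_tendstoD) (use \<epsilon> in simp)
  then show "\<forall>\<^sub>F s in at_top. dist ((LINT \<omega>|M. f (exit_angle \<Theta> s \<omega>, exit_height \<Theta> s \<omega>))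
      - (LINT \<omega>|M. f (0, exit_height \<Theta> s \<omega>))) 0 < \<epsilon>"
    using eventually_gt_at_top[of 0]
  proof eventually_elim
    case (elim s)
    then have s: "0 < s" by simp
    let ?L = "exit_angle \<Theta> s" and ?Y = "exit_height \<Theta> s"
    note [measurable] = exit_height_measurable[OF s] exit_angle_measurable[of s]
    have [measurable]: "?bad s \<in> sets M" by measurable
    have int: "integrable M (\<lambda>\<omega>. f (?L \<omega>, ?Y \<omega>))" "integrable M (\<lambda>\<omega>. f (0, ?Y \<omega>))"
      using f(2) by (auto intro!: integrable_const_bound[of _ B])
    have "\<bar>(LINT \<omega>|M. f (?L \<omega>, ?Y \<omega>)) - (LINT \<omega>|M. f (0, ?Y \<omega>))\<bar>
        = \<bar>LINT \<omega>|M. f (?L \<omega>, ?Y \<omega>) - f (0, ?Y \<omega>)\<bar>" using int by simp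
    also have "\<dots> \<le> (LINT \<omega>|M. \<bar>f (?L \<omega>, ?Y \<omega>) - f (0, ?Y \<omega>)\<bar>)" by (rule integral_abs_bound)
    also have "\<dots> \<le> (LINT \<omega>|M. \<epsilon> / 2 + 2 * B * indicator (?bad s) \<omega>)"
    proof (rule integral_mono_AE)
      show "integrable M (\<lambda>\<omega>. \<bar>f (?L \<omega>, ?Y \<omega>) - f (0, ?Y \<omega>)\<bar>)"
        by (intro integrable_abs Bochner_Integration.integrable_diff int)
      show "integrable M (\<lambda>\<omega>. \<epsilon> / 2 + 2 * B * indicator (?bad s) \<omega>)"
        by (rule integrable_const_bound[of _ "\<epsilon> / 2 + 2 * B"]) (use B \<epsilon> in \<open>auto simp: indicator_def\<close>)
      show "AE \<omega> in M. \<bar>f (?L \<omega>, ?Y \<omega>) - f (0, ?Y \<omega>)\<bar> \<le> \<epsilon> / 2 + 2 * B * indicator (?bad s) \<omega>"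
        using AE_exits[OF less_imp_le[OF s]] AE_space
      proof eventually_elim
        case (elim \<omega>)
        then obtain n where n: "exits \<Theta> s n \<omega>" by blast
        show ?case
        proof (cases "step \<Theta> (Suc n) \<omega> \<le> 1 / \<delta>")
          case True
          then have "\<omega> \<in> ?bad s" using n elim by blast
          moreover have "\<bar>f (?L \<omega>, ?Y \<omega>) - f (0, ?Y \<omega>)\<bar> \<le> 2 * B"
            using f(2)[of "(?L \<omega>, ?Y \<omega>)"] f(2)[of "(0, ?Y \<omega>)"] by linarith
          ultimately show ?thesis using \<epsilon> by simp
        next
          case False
          then have long: "1 / \<delta> < step \<Theta> (Suc n) \<omega>" by simp
          have angle: "\<bar>?L \<omega>\<bar> < \<delta>" "\<bar>?L \<omega>\<bar> < pi / 2" by (rule exits_exit_angle[OF n s \<delta> long])+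
          have "dist (f (?L \<omega>, ?Y \<omega>)) (f (0, ?Y \<omega>)) < \<epsilon> / 2"
          proof (rule unif)
            show "(0, ?Y \<omega>) \<in> {- (pi / 2)..pi / 2} \<times> {0..1}" "(?L \<omega>, ?Y \<omega>) \<in> {- (pi / 2)..pi / 2} \<times> {0..1}"
              using exits_exit_height(2)[OF n s] angle(2) by auto
            show "dist (?L \<omega>, ?Y \<omega>) (0, ?Y \<omega>) < \<delta>" using angle(1) by (simp add: dist_Pair_Pair dist_real_def)
          qed
          then show ?thesis using B by (simp add: dist_real_def add_increasing2)
        qed
      qed
    qed
    also have "\<dots> = \<epsilon> / 2 + 2 * B * prob (?bad s)"
    proof -
      have "integrable M (\<lambda>\<omega>. 2 * B * indicator (?bad s) \<omega>)"
        by (rule integrable_const_bound[of _ "2 * B"]) (use B in \<open>auto simp: indicator_def\<close>)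
      then show ?thesis by (subst Bochner_Integration.integral_add) (auto simp: prob_space)
    qed
    also have "\<dots> < \<epsilon>" by (rule elim(1))
    finally show ?case by (simp add: dist_real_def)
  qed
qed

end

section \<open>Convergence of the exit angle and height\<close>

theorem theorem4p13:
  fixes M :: "'a measure" and \<Theta> :: "nat \<Rightarrow> 'a \<Rightarrow> real"
    and M' :: "'b measure" and Z :: "'b \<Rightarrow> real"
  assumes "prob_space M"
    and "prob_space.indep_vars M (\<lambda>_. borel) \<Theta> {1..}"
    and "\<And>n. n \<ge> 1 \<Longrightarrow>
           distributed M lborel (\<Theta> n)
             (\<lambda>\<theta>. ennreal (indicator {- (pi / 2) <..< pi / 2} \<theta> * (cos \<theta> / 2)))"
    and "prob_space M'"
    and "distributed M' lborel Z (indicator {0..1})"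
  shows "converges_in_distribution
           M (\<lambda>s \<omega>. (exit_angle \<Theta> s \<omega>, exit_height \<Theta> s \<omega>))
           M' (\<lambda>\<omega>. (0, Z \<omega>)) at_top"
proof -
  interpret prob_space M by fact
  interpret lambertian_ray M \<Theta> by standard (use assms(2,3) in auto)
  have [measurable]: "Z \<in> borel_measurable M'" using distributed_measurable[OF assms(5)] by simp
  show ?thesis
    unfolding converges_in_distribution_def
  proof (intro conjI allI impI)
    show "\<forall>\<^sub>F s in at_top. (\<lambda>\<omega>. (exit_angle \<Theta> s \<omega>, exit_height \<Theta> s \<omega>)) \<in> borel_measurable M"
      using eventually_gt_at_top[of 0]
      by eventually_elim (intro borel_measurable_Pair exit_angle_measurable exit_height_measurable)
    show "(\<lambda>\<omega>. (0 :: real, Z \<omega>)) \<in> borel_measurable M'" by measurable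
    fix f :: "real \<times> real \<Rightarrow> real" assume f: "continuous_on UNIV f \<and> bounded (range f)"
    then obtain B where B: "\<And>z. \<bar>f z\<bar> \<le> B" unfolding bounded_iff by auto
    have "continuous_on UNIV (\<lambda>y. f (0, y))"
      using f by (auto intro!: continuous_on_compose2[of UNIV f] continuous_intros)
    then have "((\<lambda>s. LINT \<omega>|M. f (0, exit_height \<Theta> s \<omega>)) \<longlongrightarrow> (LINT \<omega>|M'. f (0, Z \<omega>))) at_top"
      using B by (intro exit_height_expectation[OF assms(4,5), of "\<lambda>y. f (0, y)"]) auto
    from tendsto_add[OF this angle_irrelevant[of f B]] f B
    show "((\<lambda>s. LINT \<omega>|M. f (exit_angle \<Theta> s \<omega>, exit_height \<Theta> s \<omega>)) \<longlongrightarrow> (LINT \<omega>|M'. f (0, Z \<omega>))) at_top"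
      by simp
  qed
qed

end
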